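(* There is an absolute constant $C>0$ such that the following holds. Let $d\ge1$, let $D\in\{2d,2d+1\}$, and let $\Sigma\subset\mathbb R^{D+1}$ be the cone of coefficient vectors, in the monomial basis $\mathbf q(z)=(1,z,\dots,z^D)^{\mathrm T}$, of univariate polynomials of degree at most $D$ nonnegative on $[-1,1]$ (represented as weighted sums of squares as in the context). Let $\mathbf t\in\Sigma^\circ$ have integer components of bit size at most $\tau$. Then there exists an integer dual certificate $\overline{\mathbf y}\in(\Sigma^* )^\circ\cap\mathbb Z^{D+1}$ of $\mathbf t$ with $$\log(\|\overline{\mathbf y}\|_\infty)\le C\,(d\tau+d\log d).$$
   Context: $\mathcal V_k$ denotes univariate real polynomials of degree at most $k$; $\Sigma_{2k}$ the sums of squares of elements of $\mathcal V_k$. If $D=2d$: weights $w_1=1$, $w_2=1-z^2$, degrees $(d_1,d_2)=(d,d-1)$; if $D=2d+1$: weights $w_1=1-z$, $w_2=1+z$, degrees $(d_1,d_2)=(d,d)$. In both cases $\Sigma=\{w_1\sigma_1+w_2\sigma_2:\sigma_i\in\Sigma_{2d_i}\}$, which is exactly the cone of polynomials in $\mathcal V_D$ nonnegative on $[-1,1]$. Polynomials in $\mathcal V_D$ are identified with coefficient vectors in the basis $\mathbf q$; put $U=D+1$. $\Sigma^*=\{\mathbf y\in\mathbb R^U:\mathbf x^{\mathrm T}\mathbf y\ge0\ \forall\mathbf x\in\Sigma\}$. Fix any ordered bases $\mathbf p_i$ of $\mathcal V_{d_i}$; $\Lambda_i$ is the unique linear map from $\mathbb R^U$ to symmetric matrices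 with $\Lambda_i(\mathbf q(z))=w_i(z)\mathbf p_i(z)\mathbf p_i(z)^{\mathrm T}$ for all $z$, and $\Lambda=\Lambda_1\oplus\Lambda_2$. Then $\Sigma^*=\{\mathbf x:\Lambda(\mathbf x)\succcurlyeq0\}$ and $(\Sigma^* )^\circ=\{\mathbf x:\Lambda(\mathbf x)\succ0\}$; $^\circ$ denotes interior. Let $f(\mathbf x)=-\ln\det\Lambda(\mathbf x)$ on $(\Sigma^* )^\circ$, with (positive definite) Hessian $H$. A vector $\mathbf x\in(\Sigma^* )^\circ$ is a dual certificate of $\mathbf s\in\Sigma$ if $H(\mathbf x)^{-1}\mathbf s\in\Sigma^*$. The bit size of an integer $y$ is $1+\lceil\log_2(|y|+1)\rceil$. *)

theory Defs
  imports
    "HOL-Analysis.Analysis"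
    "HOL-Computational_Algebra.Fundamental_Theorem_Algebra"
    "Jordan_Normal_Form.Gauss_Jordan_Elimination"
    "Jordan_Normal_Form.Char_Poly"
begin

text \<open>
  The ambient dimension is quantified inside the theorem (the constant must not depend on it), so
  vectors and matrices are those of \<open>Jordan_Normal_Form\<close>, which carry their dimension as a value.
  Several names also exist in HOL-Analysis and are therefore qualified with their theory.
\<close>

subsection \<open>Polynomials and the weighted sum-of-squares cone\<close>

definition polys_upto :: "nat \<Rightarrow> real poly set" where
  "polys_upto k = {p. degree p \<le> k}"

definition sos :: "nat \<Rightarrow> real poly set" where
  "sos k = {sum_list (map (\<lambda>g. g\<^sup>2) gs) | gs. set gs \<subseteq> polys_upto k}"

definition weight1 :: "nat \<Rightarrow> real poly" where
  "weight1 D = (if even D then 1 else [:1, - 1:])"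

definition weight2 :: "nat \<Rightarrow> real poly" where
  "weight2 D = (if even D then [:1, 0, - 1:] else [:1, 1:])"

definition deg1 :: "nat \<Rightarrow> nat" where
  "deg1 D = D div 2"

definition deg2 :: "nat \<Rightarrow> nat" where
  "deg2 D = (if even D then D div 2 - 1 else D div 2)"

definition coeff_vec :: "nat \<Rightarrow> real poly \<Rightarrow> real Matrix.vec" where
  "coeff_vec D p = Matrix.vec (D + 1) (coeff p)"

definition wsos_polys :: "nat \<Rightarrow> real poly set" where
  "wsos_polys n = {weight1 n * \<sigma>1 + weight2 n * \<sigma>2 | \<sigma>1 \<sigma>2.
     \<sigma>1 \<in> sos (deg1 n) \<and> \<sigma>2 \<in> sos (deg2 n)}"

definition wsos_cone :: "nat \<Rightarrow> real Matrix.vec set" where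
  "wsos_cone D = coeff_vec D ` wsos_polys D"

subsection \<open>Interior and dual cone\<close>

definition vec_interior :: "nat \<Rightarrow> real Matrix.vec set \<Rightarrow> real Matrix.vec set" where
  "vec_interior n S = {x \<in> carrier_vec n. \<exists>\<epsilon>>0. \<forall>y\<in>carrier_vec n.
     L2_set (\<lambda>i. vec_index y i - vec_index x i) {..<n} < \<epsilon> \<longrightarrow> y \<in> S}"

definition dual_cone :: "nat \<Rightarrow> real Matrix.vec set \<Rightarrow> real Matrix.vec set" where
  "dual_cone n S = {y \<in> carrier_vec n. \<forall>x\<in>S. scalar_prod x y \<ge> 0}"

subsection \<open>The maps \<open>\<Lambda>\<^sub>i\<close>\<close>

text \<open>\<open>Modules.module\<close> is the locale of modules from HOL, not the one from HOL-Algebra.\<close>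

definition ordered_basis :: "nat \<Rightarrow> real poly list \<Rightarrow> bool" where
  "ordered_basis k ps \<longleftrightarrow> distinct ps \<and> \<not> Modules.module.dependent Polynomial.smult (set ps)
     \<and> Modules.module.span Polynomial.smult (set ps) = polys_upto k"

definition monomial_vec :: "nat \<Rightarrow> real \<Rightarrow> real Matrix.vec" where
  "monomial_vec D z = Matrix.vec (D + 1) (\<lambda>i. z ^ i)"

definition is_Lambda ::
  "nat \<Rightarrow> real poly \<Rightarrow> real poly list \<Rightarrow> (real Matrix.vec \<Rightarrow> real Matrix.mat) \<Rightarrow> bool" where
  "is_Lambda D w ps L \<longleftrightarrow>
     (\<forall>x\<in>carrier_vec (D + 1). L x \<in> carrier_mat (length ps) (length ps)
        \<and> transpose_mat (L x) = L x) \<and>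
     (\<forall>x\<in>carrier_vec (D + 1). \<forall>y\<in>carrier_vec (D + 1). L (x + y) = L x + L y) \<and>
     (\<forall>c. \<forall>x\<in>carrier_vec (D + 1). L (smult_vec c x) = smult_mat c (L x)) \<and>
     (\<forall>z. L (monomial_vec D z) = smult_mat (poly w z)
        (Matrix.mat (length ps) (length ps) (\<lambda>(a, b). poly (ps ! a) z * poly (ps ! b) z)))"

lemma is_Lambda_exists:
  assumes "\<And>p q. p \<in> set ps \<Longrightarrow> q \<in> set ps \<Longrightarrow> degree (w * p * q) \<le> D"
  shows "\<exists>L. is_Lambda D w ps L"
proof -
  define n where "n = length ps"
  define L where "L x = Matrix.mat n n (\<lambda>(a, b). \<Sum>j\<le>D. coeff (w * ps ! a * ps ! b) j * vec_index x j)"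
    for x :: "real Matrix.vec"
  have sym: "coeff (w * ps ! a * ps ! b) j = coeff (w * ps ! b * ps ! a) j" for a b j
    by (simp add: ac_simps)
  have ev: "(\<Sum>j\<le>D. coeff (w * ps ! a * ps ! b) j * z ^ j) = poly w z * (poly (ps ! a) z * poly (ps ! b) z)"
    if "a < n" "b < n" for a b z
  proof -
    have dg: "degree (w * ps ! a * ps ! b) \<le> D" using assms that by (simp add: n_def)
    have "(\<Sum>j\<le>D. coeff (w * ps ! a * ps ! b) j * z ^ j) = poly (w * ps ! a * ps ! b) z"
      unfolding poly_altdef by (rule sum.mono_neutral_right) (use dg in \<open>auto simp: coeff_eq_0\<close>)
    then show ?thesis by (simp add: mult.assoc)
  qed
  have "is_Lambda D w ps L"
    unfolding is_Lambda_def n_def[symmetric]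
  proof (intro conjI ballI allI)
    fix x :: "real Matrix.vec"
    show "L x \<in> carrier_mat n n" by (simp add: L_def)
    show "transpose_mat (L x) = L x" by (rule eq_matI) (auto simp: L_def sym)
  next
    fix x y :: "real Matrix.vec" assume "x \<in> carrier_vec (D + 1)" "y \<in> carrier_vec (D + 1)"
    then show "L (x + y) = L x + L y"
      by (intro eq_matI) (auto simp: L_def sum.distrib[symmetric] distrib_left intro!: sum.cong)
  next
    fix c and x :: "real Matrix.vec" assume "x \<in> carrier_vec (D + 1)"
    then show "L (smult_vec c x) = smult_mat c (L x)"
      by (intro eq_matI) (auto simp: L_def sum_distrib_left intro!: sum.cong)
  next
    fix z
    have "(\<Sum>j\<le>D. coeff (w * ps ! a * ps ! b) j * vec_index (monomial_vec D z) j)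
        = (\<Sum>j\<le>D. coeff (w * ps ! a * ps ! b) j * z ^ j)" for a b
      by (intro sum.cong) (auto simp: monomial_vec_def)
    then show "L (monomial_vec D z) = smult_mat (poly w z)
        (Matrix.mat n n (\<lambda>(a, b). poly (ps ! a) z * poly (ps ! b) z))"
      by (intro eq_matI) (auto simp: L_def ev)
  qed
  then show ?thesis by blast
qed

lemma is_Lambda_expand:
  assumes "is_Lambda D w ps L" "x \<in> carrier_vec (D + 1)" "a < length ps" "b < length ps"
  shows "index_mat (L x) (a, b) = (\<Sum>j\<le>D. vec_index x j * index_mat (L (unit_vec (D + 1) j)) (a, b))"
proof -
  note L = assms(1)[unfolded is_Lambda_def]
  define t where "t k = Matrix.vec (D + 1) (\<lambda>j. if j < k then vec_index x j else 0)" for k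
  have tc: "t k \<in> carrier_vec (D + 1)" for k by (simp add: t_def)
  have "index_mat (L (t k)) (a, b) = (\<Sum>j<k. vec_index x j * index_mat (L (unit_vec (D + 1) j)) (a, b))"
    if "k \<le> D + 1" for k
    using that
  proof (induction k)
    case 0
    have "t 0 = smult_vec 0 (t 0)" by (rule eq_vecI) (auto simp: t_def)
    then have "L (t 0) = smult_mat 0 (L (t 0))" using L tc by metis
    moreover have "L (t 0) \<in> carrier_mat (length ps) (length ps)" using L tc by blast
    ultimately have "index_mat (L (t 0)) (a, b) = 0"
      using assms(3,4) by (metis carrier_matD index_smult_mat(1) mult_zero_left)
    then show ?case by simp
  next
    case (Suc k)
    let ?u = "unit_vec (D + 1) k :: real Matrix.vec"
    have uc: "?u \<in> carrier_vec (D + 1)" "smult_vec (vec_index x k) ?u \<in> carrier_vec (D + 1)" by auto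
    have "t (Suc k) = t k + smult_vec (vec_index x k) ?u"
      by (rule eq_vecI) (auto simp: t_def unit_vec_def less_Suc_eq)
    then have "L (t (Suc k)) = L (t k) + smult_mat (vec_index x k) (L ?u)"
      using L tc uc by metis
    moreover have "L (t k) \<in> carrier_mat (length ps) (length ps)"
      "L ?u \<in> carrier_mat (length ps) (length ps)" using L tc uc by blast+
    ultimately show ?case using Suc assms(3,4) by auto
  qed
  from this[of "D + 1"] have "index_mat (L (t (D + 1))) (a, b)
      = (\<Sum>j\<le>D. vec_index x j * index_mat (L (unit_vec (D + 1) j)) (a, b))"
    by (simp add: lessThan_Suc_atMost)
  moreover have "t (D + 1) = x" using assms(2) by (intro eq_vecI) (auto simp: t_def)
  ultimately show ?thesis by simp
qed

lemma is_Lambda_unique: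
  assumes "is_Lambda D w ps L" "is_Lambda D w ps L'" "x \<in> carrier_vec (D + 1)"
  shows "L x = L' x"
proof (rule eq_matI)
  note L = assms(1)[unfolded is_Lambda_def] and L' = assms(2)[unfolded is_Lambda_def]
  have car: "L x \<in> carrier_mat (length ps) (length ps)" "L' x \<in> carrier_mat (length ps) (length ps)"
    using L L' assms(3) by blast+
  show "dim_row (L x) = dim_row (L' x)" "dim_col (L x) = dim_col (L' x)" using car by auto
  fix a b assume "a < dim_row (L' x)" "b < dim_col (L' x)"
  then have ab: "a < length ps" "b < length ps" using car by auto
  define c where "c j = index_mat (L (unit_vec (D + 1) j)) (a, b)
    - index_mat (L' (unit_vec (D + 1) j)) (a, b)" for j
  have diff: "index_mat (L y) (a, b) - index_mat (L' y) (a, b) = (\<Sum>j\<le>D. vec_index y j * c j)"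
    if "y \<in> carrier_vec (D + 1)" for y
    unfolding is_Lambda_expand[OF assms(1) that ab] is_Lambda_expand[OF assms(2) that ab]
    by (simp add: c_def sum_subtractf right_diff_distrib)
  have "(\<Sum>j\<le>D. c j * z ^ j) = 0" for z
  proof -
    have "L (monomial_vec D z) = L' (monomial_vec D z)" using L L' by simp
    with diff[of "monomial_vec D z"] have "(\<Sum>j\<le>D. vec_index (monomial_vec D z) j * c j) = 0"
      by (simp add: monomial_vec_def)
    moreover have "(\<Sum>j\<le>D. vec_index (monomial_vec D z) j * c j) = (\<Sum>j\<le>D. c j * z ^ j)"
      by (intro sum.cong) (auto simp: monomial_vec_def)
    ultimately show ?thesis by simp
  qed
  then have "\<forall>j\<le>D. c j = 0" using polyfun_eq_0[of c D] by blast
  with diff[OF assms(3)] show "index_mat (L x) (a, b) = index_mat (L' x) (a, b)" by simp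
qed

lemma is_Lambda_basis_exists:
  assumes "D \<ge> 1"
  shows "ordered_basis (deg1 D) ps \<Longrightarrow> \<exists>L. is_Lambda D (weight1 D) ps L"
    and "ordered_basis (deg2 D) ps \<Longrightarrow> \<exists>L. is_Lambda D (weight2 D) ps L"
proof -
  interpret poly_mod: vector_space "Polynomial.smult :: real \<Rightarrow> real poly \<Rightarrow> real poly"
    by standard (auto simp: smult_add_right smult_add_left)
  have basis: "degree p \<le> k" if "ordered_basis k ps" "p \<in> set ps" for k p
    using that poly_mod.span_base[of p "set ps"] by (auto simp: ordered_basis_def polys_upto_def)
  have dg: "degree (w * p * q) \<le> D"
    if "degree w + 2 * k \<le> D" "degree p \<le> k" "degree q \<le> k" for w p q :: "real poly" and k
    using that degree_mult_le[of "w * p" q] degree_mult_le[of w p] by linarith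
  have w: "degree (weight1 D) + 2 * deg1 D \<le> D" "degree (weight2 D) + 2 * deg2 D \<le> D"
    using assms by (auto simp: weight1_def weight2_def deg1_def deg2_def elim!: evenE oddE)
  show "\<exists>L. is_Lambda D (weight1 D) ps L" if "ordered_basis (deg1 D) ps"
    using is_Lambda_exists dg[OF w(1)] basis[OF that] by metis
  show "\<exists>L. is_Lambda D (weight2 D) ps L" if "ordered_basis (deg2 D) ps"
    using is_Lambda_exists dg[OF w(2)] basis[OF that] by metis
qed

subsection \<open>Barrier, Hessian and dual certificates\<close>

definition barrier ::
  "(real Matrix.vec \<Rightarrow> real Matrix.mat) \<Rightarrow> (real Matrix.vec \<Rightarrow> real Matrix.mat)
    \<Rightarrow> real Matrix.vec \<Rightarrow> real" where
  "barrier L1 L2 x = - ln (Determinant.det (diag_block_mat [L1 x, L2 x]))"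

definition partial :: "nat \<Rightarrow> nat \<Rightarrow> (real Matrix.vec \<Rightarrow> real) \<Rightarrow> real Matrix.vec \<Rightarrow> real" where
  "partial n i f x = deriv (\<lambda>h. f (x + smult_vec h (unit_vec n i))) 0"

definition hessian :: "nat \<Rightarrow> (real Matrix.vec \<Rightarrow> real) \<Rightarrow> real Matrix.vec \<Rightarrow> real Matrix.mat" where
  "hessian n f x = Matrix.mat n n (\<lambda>(i, j). partial n i (partial n j f) x)"

definition dual_certificate ::
  "nat \<Rightarrow> (real Matrix.vec \<Rightarrow> real Matrix.mat) \<Rightarrow> (real Matrix.vec \<Rightarrow> real Matrix.mat)
    \<Rightarrow> real Matrix.vec \<Rightarrow> real Matrix.vec \<Rightarrow> bool" where
  "dual_certificate D L1 L2 s x \<longleftrightarrow>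
     s \<in> wsos_cone D \<and>
     x \<in> vec_interior (D + 1) (dual_cone (D + 1) (wsos_cone D)) \<and>
     (\<exists>Hinv. mat_inverse (hessian (D + 1) (barrier L1 L2) x) = Some Hinv \<and>
        mult_mat_vec Hinv s \<in> dual_cone (D + 1) (wsos_cone D))"

subsection \<open>Integer vectors\<close>

definition bit_size :: "int \<Rightarrow> int" where
  "bit_size y = 1 + \<lceil>log 2 (\<bar>real_of_int y\<bar> + 1)\<rceil>"

definition real_vec :: "int Matrix.vec \<Rightarrow> real Matrix.vec" where
  "real_vec v = Matrix.map_vec real_of_int v"

definition max_norm :: "real Matrix.vec \<Rightarrow> real" where
  "max_norm v = Max ((\<lambda>i. \<bar>vec_index v i\<bar>) ` {..<dim_vec v})"

subsection \<open>The cone consists of the polynomials nonnegative on \<open>[-1, 1]\<close>\<close>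

lemma sos_add: "a \<in> sos k \<Longrightarrow> b \<in> sos k \<Longrightarrow> a + b \<in> sos k"
  unfolding sos_def
proof clarify
  fix gs hs assume "set gs \<subseteq> polys_upto k" "set hs \<subseteq> polys_upto k"
  then show "\<exists>fs. sum_list (map (\<lambda>g. g\<^sup>2) gs) + sum_list (map (\<lambda>g. g\<^sup>2) hs)
      = sum_list (map (\<lambda>g. g\<^sup>2) fs) \<and> set fs \<subseteq> polys_upto k"
    by (intro exI[of _ "gs @ hs"]) auto
qed

lemma sos_square: "degree g \<le> k \<Longrightarrow> g\<^sup>2 \<in> sos k"
  unfolding sos_def polys_upto_def by (rule CollectI, rule exI[of _ "[g]"]) auto

lemma sos_0: "0 \<in> sos k"
  unfolding sos_def by (rule CollectI, rule exI[of _ "[]"]) auto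

lemma sos_mono: "a \<in> sos j \<Longrightarrow> j \<le> k \<Longrightarrow> a \<in> sos k"
  unfolding sos_def polys_upto_def by fastforce

lemma sos_square_mult:
  assumes "degree g \<le> j" "b \<in> sos k" shows "g\<^sup>2 * b \<in> sos (j + k)"
proof -
  obtain hs where hs: "b = sum_list (map (\<lambda>h. h\<^sup>2) hs)" "set hs \<subseteq> polys_upto k"
    using assms(2) by (auto simp: sos_def)
  have "g\<^sup>2 * sum_list (map (\<lambda>h. h\<^sup>2) hs) \<in> sos (j + k)"
    using hs(2)
  proof (induction hs)
    case Nil then show ?case by (simp add: sos_0)
  next
    case (Cons h hs)
    have "degree (g * h) \<le> j + k"
      using degree_mult_le[of g h] assms(1) Cons.prems by (auto simp: polys_upto_def)
    then have "(g * h)\<^sup>2 \<in> sos (j + k)" by (rule sos_square)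
    with Cons show ?case by (simp add: distrib_left power_mult_distrib sos_add)
  qed
  with hs show ?thesis by simp
qed

lemma sos_mult:
  assumes "a \<in> sos j" "b \<in> sos k" shows "a * b \<in> sos (j + k)"
proof -
  obtain gs where gs: "a = sum_list (map (\<lambda>h. h\<^sup>2) gs)" "set gs \<subseteq> polys_upto j"
    using assms(1) by (auto simp: sos_def)
  have "sum_list (map (\<lambda>h. h\<^sup>2) gs) * b \<in> sos (j + k)"
    using gs(2)
  proof (induction gs)
    case Nil then show ?case by (simp add: sos_0)
  next
    case (Cons h hs)
    then have "h\<^sup>2 * b \<in> sos (j + k)" using assms(2) by (auto simp: polys_upto_def sos_square_mult)
    with Cons show ?case by (simp add: distrib_right sos_add)
  qed
  with gs show ?thesis by simp
qed

lemma sos_nonneg: "a \<in> sos k \<Longrightarrow> poly a z \<ge> 0"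
proof -
  assume "a \<in> sos k"
  then obtain gs where "a = sum_list (map (\<lambda>h. h\<^sup>2) gs)" by (auto simp: sos_def)
  moreover have "poly (sum_list (map (\<lambda>h. h\<^sup>2) gs)) z \<ge> 0" by (induction gs) auto
  ultimately show ?thesis by simp
qed

lemma sos_degree: "a \<in> sos k \<Longrightarrow> degree a \<le> 2 * k"
proof -
  assume "a \<in> sos k"
  then obtain gs where gs: "a = sum_list (map (\<lambda>h. h\<^sup>2) gs)" "set gs \<subseteq> polys_upto k"
    by (auto simp: sos_def)
  have "degree (sum_list (map (\<lambda>h. h\<^sup>2) gs)) \<le> 2 * k"
    using gs(2)
  proof (induction gs)
    case Nil then show ?case by simp
  next
    case (Cons g gs)
    then have "degree (g\<^sup>2) \<le> 2 * k"
      using degree_power_le[of g 2] by (auto simp: polys_upto_def)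
    with Cons show ?case by (auto intro!: degree_add_le)
  qed
  with gs show ?thesis by simp
qed

lemma wsos_polysI:
  "p = weight1 n * a + weight2 n * b \<Longrightarrow> a \<in> sos (deg1 n) \<Longrightarrow> b \<in> sos (deg2 n) \<Longrightarrow> p \<in> wsos_polys n"
  unfolding wsos_polys_def by blast

lemma wsos_polysE:
  assumes "p \<in> wsos_polys n"
  obtains a b where "p = weight1 n * a + weight2 n * b" "a \<in> sos (deg1 n)" "b \<in> sos (deg2 n)"
  using assms unfolding wsos_polys_def by blast

lemma wsos_polys_mult_even_even:
  assumes "p \<in> wsos_polys (2 * Suc m)" "q \<in> wsos_polys (2 * Suc n)"
  shows "p * q \<in> wsos_polys (2 * Suc m + 2 * Suc n)"
proof -
  let ?w = "[:1, 0, - 1:] :: real poly"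
  obtain a b where p: "p = a + ?w * b" and a: "a \<in> sos (Suc m)" and b: "b \<in> sos m"
    using wsos_polysE[OF assms(1)] by (auto simp: weight1_def weight2_def deg1_def deg2_def)
  obtain c e where q: "q = c + ?w * e" and c: "c \<in> sos (Suc n)" and e: "e \<in> sos n"
    using wsos_polysE[OF assms(2)] by (auto simp: weight1_def weight2_def deg1_def deg2_def)
  have "?w\<^sup>2 * (b * e) \<in> sos (2 + (m + n))" by (rule sos_square_mult) (simp_all add: sos_mult b e)
  then have 1: "a * c + ?w\<^sup>2 * (b * e) \<in> sos (Suc m + Suc n)"
    using sos_mult[OF a c] by (simp add: sos_add)
  have 2: "a * e + b * c \<in> sos (Suc m + n)"
    using sos_mult[OF a e] sos_mult[OF b c] by (simp add: sos_add)
  have "p * q = (a * c + ?w\<^sup>2 * (b * e)) + ?w * (a * e + b * c)"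
    unfolding p q by (simp only: power2_eq_square) (simp only: ring_distribs ac_simps)
  then show ?thesis
    using 1 2 by (intro wsos_polysI) (auto simp: weight1_def weight2_def deg1_def deg2_def)
qed

lemma wsos_polys_mult_odd_odd:
  assumes "p \<in> wsos_polys (2 * m + 1)" "q \<in> wsos_polys (2 * n + 1)"
  shows "p * q \<in> wsos_polys ((2 * m + 1) + (2 * n + 1))"
proof -
  let ?u = "[:1, - 1:] :: real poly" and ?v = "[:1, 1:] :: real poly"
  obtain a b where p: "p = ?u * a + ?v * b" and a: "a \<in> sos m" and b: "b \<in> sos m"
    using wsos_polysE[OF assms(1)] by (auto simp: weight1_def weight2_def deg1_def deg2_def)
  obtain c e where q: "q = ?u * c + ?v * e" and c: "c \<in> sos n" and e: "e \<in> sos n"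
    using wsos_polysE[OF assms(2)] by (auto simp: weight1_def weight2_def deg1_def deg2_def)
  have "?u\<^sup>2 * (a * c) \<in> sos (1 + (m + n))" "?v\<^sup>2 * (b * e) \<in> sos (1 + (m + n))"
    by (rule sos_square_mult; simp add: sos_mult a b c e)+
  then have 1: "?u\<^sup>2 * (a * c) + ?v\<^sup>2 * (b * e) \<in> sos (m + n + 1)"
    by (simp add: sos_add)
  have 2: "a * e + b * c \<in> sos (m + n)" by (simp add: sos_add sos_mult a b c e)
  have w: "[:1, 0, - 1:] = ?u * ?v" by simp
  have "p * q = (?u\<^sup>2 * (a * c) + ?v\<^sup>2 * (b * e)) + [:1, 0, - 1:] * (a * e + b * c)"
    unfolding p q w power2_eq_square by (simp only: ring_distribs ac_simps)
  then show ?thesis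
    using 1 2 by (intro wsos_polysI) (auto simp: weight1_def weight2_def deg1_def deg2_def)
qed

lemma wsos_polys_mult_odd_even:
  assumes "p \<in> wsos_polys (2 * m + 1)" "q \<in> wsos_polys (2 * Suc n)"
  shows "p * q \<in> wsos_polys ((2 * m + 1) + 2 * Suc n)"
proof -
  let ?u = "[:1, - 1:] :: real poly" and ?v = "[:1, 1:] :: real poly"
  obtain a b where p: "p = ?u * a + ?v * b" and a: "a \<in> sos m" and b: "b \<in> sos m"
    using wsos_polysE[OF assms(1)] by (auto simp: weight1_def weight2_def deg1_def deg2_def)
  obtain c e where q: "q = c + [:1, 0, - 1:] * e" and c: "c \<in> sos (Suc n)" and e: "e \<in> sos n"
    using wsos_polysE[OF assms(2)] by (auto simp: weight1_def weight2_def deg1_def deg2_def)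
  have w: "[:1, 0, - 1:] = ?u * ?v" by simp
  have s: "?u\<^sup>2 * (a * e) \<in> sos (1 + (m + n))" "?v\<^sup>2 * (b * e) \<in> sos (1 + (m + n))"
    by (rule sos_square_mult; simp add: sos_mult a b e)+
  have t: "a * c \<in> sos (m + Suc n)" "b * c \<in> sos (m + Suc n)" by (simp_all only: sos_mult a b c)
  have 1: "a * c + ?v\<^sup>2 * (b * e) \<in> sos (m + Suc n)" "b * c + ?u\<^sup>2 * (a * e) \<in> sos (m + Suc n)"
    using s t by (simp_all add: sos_add)
  have "p * q = ?u * (a * c + ?v\<^sup>2 * (b * e)) + ?v * (b * c + ?u\<^sup>2 * (a * e))"
    unfolding p q w power2_eq_square by (simp only: ring_distribs ac_simps)
  moreover have "odd ((2 * m + 1) + 2 * Suc n)" "((2 * m + 1) + 2 * Suc n) div 2 = m + Suc n"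
    by presburger+
  ultimately show ?thesis
    using 1 by (intro wsos_polysI[of _ _ "a * c + ?v\<^sup>2 * (b * e)" "b * c + ?u\<^sup>2 * (a * e)"])
      (simp_all only: weight1_def weight2_def deg1_def deg2_def if_False)
qed

lemma wsos_polys_mult:
  assumes "p \<in> wsos_polys m" "q \<in> wsos_polys n" "m \<ge> 1" "n \<ge> 1"
  shows "p * q \<in> wsos_polys (m + n)"
proof -
  have cases: "(\<exists>j. k = 2 * Suc j) \<or> (\<exists>j. k = 2 * j + 1)" if "k \<ge> 1" for k :: nat
    using that by presburger
  from cases[OF assms(3)] cases[OF assms(4)] assms(1,2) show ?thesis
    using wsos_polys_mult_even_even wsos_polys_mult_odd_odd
      wsos_polys_mult_odd_even wsos_polys_mult_odd_even[of q _ p]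
    by (metis add.commute mult.commute)
qed

lemma const_in_sos: "c \<ge> 0 \<Longrightarrow> [:c:] \<in> sos k"
  using sos_square[of "[:sqrt c:]" k] by (simp add: power2_eq_square)

lemma wsos_polys_linear:
  assumes "\<alpha> \<ge> 0" "\<beta> \<ge> 0" "p = Polynomial.smult \<alpha> [:1, - 1:] + Polynomial.smult \<beta> [:1, 1:]"
  shows "p \<in> wsos_polys 1"
  using const_in_sos[OF assms(1)] const_in_sos[OF assms(2)] assms(3)
  by (intro wsos_polysI[of _ _ "[:\<alpha>:]" "[:\<beta>:]"]) (auto simp: weight1_def weight2_def deg1_def deg2_def)

lemma wsos_polys_sos2: "p \<in> sos 1 \<Longrightarrow> p \<in> wsos_polys 2"
  by (intro wsos_polysI[of _ _ p 0]) (auto simp: weight1_def weight2_def deg1_def deg2_def sos_0)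

lemma wsos_polys_smult:
  assumes "p \<in> wsos_polys n" "c \<ge> 0" shows "Polynomial.smult c p \<in> wsos_polys n"
proof -
  obtain a b where p: "p = weight1 n * a + weight2 n * b" "a \<in> sos (deg1 n)" "b \<in> sos (deg2 n)"
    using wsos_polysE[OF assms(1)] by blast
  have "[:c:] * a \<in> sos (deg1 n)" "[:c:] * b \<in> sos (deg2 n)"
    using sos_mult[OF const_in_sos[OF assms(2), of 0]] p(2,3) by fastforce+
  then show ?thesis using p(1) by (intro wsos_polysI) (auto simp: smult_add_right)
qed

lemma wsos_polys_mono:
  assumes "p \<in> wsos_polys m" "1 \<le> m" "m \<le> n" shows "p \<in> wsos_polys n"
  using assms(3)
proof (induction n rule: dec_induct)
  case base then show ?case by (rule assms(1))
next
  case (step n)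
  have "(1 :: real poly) \<in> wsos_polys 1"
    by (rule wsos_polys_linear[of "1/2" "1/2"]) (auto simp: one_pCons)
  then show ?case using wsos_polys_mult[OF step.IH, of 1 1] step.hyps assms(2) by simp
qed

lemma poly_neg_nbhd:
  fixes r :: "real poly" assumes "poly r a < 0"
  obtains \<delta> where "\<delta> > 0" "\<And>y. \<bar>y - a\<bar> < \<delta> \<Longrightarrow> poly r y < 0"
proof -
  have "isCont (poly r) a" by simp
  then have "\<forall>\<^sub>F y in at a. poly r y < 0"
    using assms unfolding isCont_def by (rule order_tendstoD)
  then obtain \<delta> where \<delta>: "\<delta> > 0" "\<And>y. y \<noteq> a \<Longrightarrow> dist y a < \<delta> \<Longrightarrow> poly r y < 0"
    unfolding eventually_at by blast
  show thesis
  proof (rule that[OF \<delta>(1)])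
    fix y assume "\<bar>y - a\<bar> < \<delta>"
    then show "poly r y < 0" using \<delta>(2)[of y] assms by (cases "y = a") (simp_all add: dist_real_def)
  qed
qed

lemma cofactor_nonneg:
  fixes q r :: "real poly"
  assumes nn: "\<And>y. -1 \<le> y \<Longrightarrow> y \<le> 1 \<Longrightarrow> poly (q * r) y \<ge> 0"
    and pos: "\<And>y. -1 \<le> y \<Longrightarrow> y \<le> 1 \<Longrightarrow> y \<noteq> a \<Longrightarrow> poly q y > 0"
    and x: "-1 \<le> x" "x \<le> 1"
  shows "poly r x \<ge> 0"
proof (rule ccontr)
  assume "\<not> poly r x \<ge> 0"
  then obtain \<delta> where \<delta>: "\<delta> > 0" "\<And>y. \<bar>y - x\<bar> < \<delta> \<Longrightarrow> poly r y < 0"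
    using poly_neg_nbhd[of r x] by auto
  define h where "h = min (\<delta> / 2) (1 / 2)"
  have h: "h > 0" "h < \<delta>" "h \<le> 1/2" using \<delta>(1) by (auto simp: h_def min_def)
  define y where "y = (if x = a then if x \<le> 0 then x + h else x - h else x)"
  have y: "-1 \<le> y" "y \<le> 1" "y \<noteq> a" "\<bar>y - x\<bar> < \<delta>" using h x \<delta>(1) by (auto simp: y_def)
  have "poly q y * poly r y < 0" using pos[OF y(1-3)] \<delta>(2)[OF y(4)] by (rule mult_pos_neg)
  with nn[OF y(1,2)] show False by simp
qed

lemma interior_root_double:
  fixes s :: "real poly"
  assumes nn: "\<And>y. -1 \<le> y \<Longrightarrow> y \<le> 1 \<Longrightarrow> poly ([:- a, 1:] * s) y \<ge> 0" and a: "-1 < a" "a < 1"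
  shows "poly s a = 0"
proof (rule ccontr)
  assume "poly s a \<noteq> 0"
  then consider "poly s a < 0" | "poly (- s) a < 0" by fastforce
  then show False
  proof cases
    case 1
    from poly_neg_nbhd[OF 1] obtain \<delta> where \<delta>: "\<delta> > 0" "\<And>y. \<bar>y - a\<bar> < \<delta> \<Longrightarrow> poly s y < 0" by blast
    define y where "y = a + min (\<delta> / 2) (1 - a)"
    have y: "-1 \<le> y" "y \<le> 1" "a < y" "\<bar>y - a\<bar> < \<delta>" using a \<delta>(1) by (auto simp: y_def min_def)
    have "(y - a) * poly s y < 0" using y(3) \<delta>(2)[OF y(4)] by (simp add: mult_pos_neg)
    with nn[OF y(1,2)] show False by (simp add: algebra_simps)
  next
    case 2
    from poly_neg_nbhd[OF 2] obtain \<delta> where \<delta>: "\<delta> > 0" "\<And>y. \<bar>y - a\<bar> < \<delta> \<Longrightarrow> poly (- s) y < 0" by blast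
    define y where "y = a - min (\<delta> / 2) (1 + a)"
    have y: "-1 \<le> y" "y \<le> 1" "y < a" "\<bar>y - a\<bar> < \<delta>" using a \<delta>(1) by (auto simp: y_def min_def)
    have "(y - a) * poly s y < 0" using y(3) \<delta>(2)[OF y(4)] by (simp add: mult_neg_pos)
    with nn[OF y(1,2)] show False by (simp add: algebra_simps)
  qed
qed

lemma nonreal_root_quadratic_dvd:
  fixes p :: "real poly"
  assumes "poly (map_poly complex_of_real p) z = 0" "Im z \<noteq> 0"
  shows "[:(Re z)\<^sup>2 + (Im z)\<^sup>2, - 2 * Re z, 1:] dvd p"
proof -
  let ?q = "[:(Re z)\<^sup>2 + (Im z)\<^sup>2, - 2 * Re z, 1:]"
  interpret of_real: map_poly_inj_idom_hom complex_of_real ..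
  have qz: "poly (map_poly complex_of_real ?q) z = 0"
    by (simp add: complex_eq_iff power2_eq_square algebra_simps)
  define r where "r = p mod ?q"
  have "degree r < 2" if "r \<noteq> 0"
    using degree_mod_less[of ?q p] that by (auto simp: r_def)
  then have "degree r \<le> 1" by (cases "r = 0") auto
  then obtain u v where r: "r = [:u, v:]" by (metis degree1_coeffs degree_0_id le_eq_less_or_eq less_one pCons_0_0)
  have "poly (map_poly complex_of_real p) z = poly (map_poly complex_of_real (?q * (p div ?q) + r)) z"
    by (simp only: r_def mult_div_mod_eq)
  also have "\<dots> = poly (map_poly complex_of_real r) z"
    unfolding of_real.hom_mult of_real.hom_add poly_add poly_mult qz by simp
  finally have "poly (map_poly complex_of_real r) z = 0" using assms(1) by simp
  then have e: "complex_of_real u + z * complex_of_real v = 0"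
    unfolding r by (simp add: Polynomial.map_poly_pCons)
  have "Im z * v = 0" using arg_cong[OF e, of Im] by simp
  then have "v = 0" using assms(2) by simp
  moreover from this have "u = 0" using e by simp
  ultimately have "r = 0" using r by simp
  then show ?thesis by (simp add: r_def mod_eq_0_iff_dvd)
qed

lemma nonneg_factor:
  fixes p :: "real poly"
  assumes deg: "degree p > 0" and nn: "\<And>y. -1 \<le> y \<Longrightarrow> y \<le> 1 \<Longrightarrow> poly p y \<ge> 0"
  obtains q r a where "p = q * r" "degree q > 0" "q \<in> wsos_polys (degree q)"
    "\<And>y. -1 \<le> y \<Longrightarrow> y \<le> 1 \<Longrightarrow> y \<noteq> a \<Longrightarrow> poly q y > 0"
proof -
  have "degree (map_poly complex_of_real p) = degree p" by simp
  then have "\<not> constant (poly (map_poly complex_of_real p))" using deg by (simp add: constant_degree)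
  then obtain z where z: "poly (map_poly complex_of_real p) z = 0"
    using fundamental_theorem_of_algebra by blast
  show thesis
  proof (cases "Im z = 0")
    case False
    let ?q = "[:(Re z)\<^sup>2 + (Im z)\<^sup>2, - 2 * Re z, 1:]"
    obtain r where r: "p = ?q * r" using nonreal_root_quadratic_dvd[OF z False] by (elim dvdE)
    have "?q = [:- Re z, 1:]\<^sup>2 + [:Im z:]\<^sup>2" by (simp add: power2_eq_square)
    moreover have "[:- Re z, 1:]\<^sup>2 + [:Im z:]\<^sup>2 \<in> sos 1" by (intro sos_add sos_square) auto
    ultimately have q: "?q \<in> wsos_polys 2" by (simp only: wsos_polys_sos2)
    have "poly ?q y > 0" for y
    proof -
      have "poly ?q y = (y - Re z)\<^sup>2 + (Im z)\<^sup>2" by (simp add: power2_eq_square algebra_simps)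
      moreover have "(y - Re z)\<^sup>2 + (Im z)\<^sup>2 > 0" using False by (intro add_nonneg_pos) auto
      ultimately show ?thesis by (simp only:)
    qed
    then show thesis using r q by (intro that[of ?q r]) (auto simp: numeral_2_eq_2)
  next
    case True
    define x where "x = Re z"
    have "z = complex_of_real x" using True by (simp add: x_def complex_eq_iff)
    then have "poly p x = 0" using z by (simp add: of_real_hom.poly_map_poly)
    then obtain s where s: "p = [:- x, 1:] * s" by (metis dvdE poly_eq_0_iff_dvd)
    consider "x \<le> -1" | "x \<ge> 1" | "-1 < x" "x < 1" by linarith
    then show thesis
    proof cases
      case 1
      have "[:- x, 1:] \<in> wsos_polys 1"
        using 1 by (intro wsos_polys_linear[of "(- x - 1) / 2" "(1 - x) / 2"]) (auto simp: field_simps)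
      then show thesis using s 1 by (intro that[of "[:- x, 1:]" s x]) auto
    next
      case 2
      have "[:x, - 1:] \<in> wsos_polys 1"
        using 2 by (intro wsos_polys_linear[of "(x + 1) / 2" "(x - 1) / 2"]) (auto simp: field_simps)
      moreover have "p = [:x, - 1:] * (- s)" unfolding s by simp
      ultimately show thesis using 2 by (intro that[of "[:x, - 1:]" "- s" x]) auto
    next
      case 3
      have "poly s x = 0" using nn 3 unfolding s by (intro interior_root_double) auto
      then obtain r where r: "s = [:- x, 1:] * r" by (metis dvdE poly_eq_0_iff_dvd)
      let ?q = "[:- x, 1:]\<^sup>2"
      have dq: "degree ?q = 2" by (simp add: power2_eq_square)
      have "?q \<in> wsos_polys 2" by (intro wsos_polys_sos2 sos_square) auto
      moreover have "poly ?q y > 0" if "y \<noteq> x" for y using that by simp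
      moreover have "p = ?q * r" unfolding s r power2_eq_square by (simp only: ac_simps)
      ultimately show thesis using dq by (intro that[of ?q r x]) auto
    qed
  qed
qed

lemma nonneg_imp_wsos_degree:
  fixes p :: "real poly"
  assumes "degree p > 0" "\<And>y. -1 \<le> y \<Longrightarrow> y \<le> 1 \<Longrightarrow> poly p y \<ge> 0"
  shows "p \<in> wsos_polys (degree p)"
  using assms
proof (induction "degree p" arbitrary: p rule: less_induct)
  case less
  from nonneg_factor[OF less.prems] obtain q r a where
    f: "p = q * r" "degree q > 0" "q \<in> wsos_polys (degree q)"
    "\<And>y. -1 \<le> y \<Longrightarrow> y \<le> 1 \<Longrightarrow> y \<noteq> a \<Longrightarrow> poly q y > 0" by blast
  have nn: "poly r y \<ge> 0" if "-1 \<le> y" "y \<le> 1" for y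
    using cofactor_nonneg[of q r a y] less.prems(2) f(1,4) that by blast
  have "r \<noteq> 0" "q \<noteq> 0" using less.prems(1) f(1) by auto
  then have dp: "degree p = degree q + degree r" using f(1) by (simp add: degree_mult_eq)
  show ?case
  proof (cases "degree r = 0")
    case True
    then obtain c where c: "r = [:c:]" by (metis degree_eq_zeroE)
    then have "c \<ge> 0" using nn[of 0] by simp
    then have "Polynomial.smult c q \<in> wsos_polys (degree q)" by (rule wsos_polys_smult[OF f(3)])
    then show ?thesis using f(1) c dp True by simp
  next
    case False
    then have "r \<in> wsos_polys (degree r)" using less.hyps[of r] dp f(2) nn by simp
    then show ?thesis using wsos_polys_mult[OF f(3)] f(1,2) dp False by simp
  qed
qed

lemma wsos_polys_iff_nonneg:
  assumes "D \<ge> 1"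
  shows "p \<in> wsos_polys D \<longleftrightarrow> degree p \<le> D \<and> (\<forall>z\<in>{-1..1}. poly p z \<ge> 0)"
proof
  assume "p \<in> wsos_polys D"
  then obtain a b where p: "p = weight1 D * a + weight2 D * b"
    and a: "a \<in> sos (deg1 D)" and b: "b \<in> sos (deg2 D)" by (rule wsos_polysE)
  have "degree (weight1 D) + 2 * deg1 D \<le> D" "degree (weight2 D) + 2 * deg2 D \<le> D"
    using assms by (auto simp: weight1_def weight2_def deg1_def deg2_def elim!: evenE oddE)
  then have "degree p \<le> D"
    using degree_mult_le[of "weight1 D" a] degree_mult_le[of "weight2 D" b]
      sos_degree[OF a] sos_degree[OF b] unfolding p by (intro degree_add_le) linarith+
  moreover have "poly p z \<ge> 0" if "z \<in> {-1..1}" for z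
  proof -
    have "z * z \<le> 1" using that by (auto simp: abs_le_iff abs_square_le_1[unfolded power2_eq_square])
    then have "poly (weight1 D) z \<ge> 0" "poly (weight2 D) z \<ge> 0"
      using that by (auto simp: weight1_def weight2_def)
    then show ?thesis using sos_nonneg[OF a, of z] sos_nonneg[OF b, of z] by (simp add: p)
  qed
  ultimately show "degree p \<le> D \<and> (\<forall>z\<in>{-1..1}. poly p z \<ge> 0)" by blast
next
  assume asm: "degree p \<le> D \<and> (\<forall>z\<in>{-1..1}. poly p z \<ge> 0)"
  show "p \<in> wsos_polys D"
  proof (cases "degree p = 0")
    case True
    then obtain c where c: "p = [:c:]" by (metis degree_eq_zeroE)
    then have "c \<ge> 0" using asm by force
    then have "p \<in> wsos_polys 1"
      using c by (intro wsos_polys_linear[of "c / 2" "c / 2"]) auto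
    then show ?thesis using assms wsos_polys_mono by blast
  next
    case False
    then show ?thesis using asm wsos_polys_mono[OF nonneg_imp_wsos_degree[of p]] by force
  qed
qed

theorem wsos_cone_eq_nonneg:
  assumes "D \<ge> 1"
  shows "wsos_cone D = {coeff_vec D p | p. degree p \<le> D \<and> (\<forall>z\<in>{-1..1}. poly p z \<ge> 0)}"
  unfolding wsos_polys_iff_nonneg[OF assms, symmetric] by (auto simp: wsos_cone_def)

end

theory Submission
  imports Defs
begin

text \<open>
  Maximising \<open>det \<Lambda>(x)\<close> over the compact section \<open>t \<bullet> x = \<nu>\<close> of the dual cone, where \<open>\<nu>\<close> is the size of
  \<open>\<Lambda>\<close>, yields a point \<open>y\<close> with \<open>- \<nabla>f(y) = t\<close>. Every \<open>y'\<close> at local distance less than 1 from a multiple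
  \<open>N y\<close> is again a dual certificate of \<open>t\<close>, so for large \<open>N\<close> one may round \<open>N y\<close> to an integer vector.
  Lagrange interpolation at the nodes \<open>k / D\<close> bounds the local norm of a rounding error, hence the
  necessary \<open>N\<close>, by \<open>D\<close> to the power \<open>O(D)\<close> times the size of \<open>t\<close>. The coordinates of \<open>y\<close> are at most
  \<open>\<nu> / min t\<close>, the minimum being taken over \<open>[-1, 1]\<close>. An interior critical value of \<open>t\<close> is a root of
  the resultant of \<open>t - e\<close> and \<open>t'\<close>, a nonzero integer polynomial in \<open>e\<close> whose coefficients are at most
  exponential in \<open>d \<tau> + d log d\<close>, and this bounds \<open>min t\<close> from below.
\<close>

text \<open>The barrier is logarithmically homogeneous, so \<open>H(y) y\<close> is minus its
  gradient. If that gradient is \<open>-t\<close>, then \<open>H(y)^{-1} t = y\<close> is itself an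
  interior point of the dual cone, and this leaves room for rounding. Passing from \<open>y\<close>
  to \<open>N y\<close> divides the local norm of a fixed error by \<open>N\<close>, while
  \<open>t\<close> changes only by a positive factor. The obstacle is that the bases are arbitrary:
  neither the entries nor the eigenvalues of \<open>\<Lambda>(x)\<close> can be estimated. All
  quantitative information therefore passes through membership in the dual cone and through the
  identity \<open>t . x = tr(\<Lambda>(y)^{-1} \<Lambda>(x))\<close>, both invariant under a change
  of basis. If \<open>x + \<delta>\<close> and \<open>x - \<delta>\<close> lie in the dual cone, the
  local norm of \<open>\<delta>\<close> at \<open>y\<close> is at most
  \<open>sqrt 2 * (t . x)\<close>. The sum of the point evaluations at the nodes serves as
  \<open>x\<close>, because it is the centre of an explicit box inside the dual cone. Hence
  \<open>N\<close> does not involve the minimum of \<open>t\<close>, which enters only through the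
  size of \<open>y\<close>.\<close>

unbundle no vec_syntax
no_notation inner (infix "\<bullet>" 70)
hide_const (open) Determinants.det Determinants.trace
  Finite_Cartesian_Product.mat Finite_Cartesian_Product.vec Finite_Cartesian_Product.row
  Finite_Cartesian_Product.column Finite_Cartesian_Product.transpose
hide_type (open) Finite_Cartesian_Product.vec

subsection \<open>Lower bounds for positive integer polynomials\<close>

text \<open>Submultiplicativity makes this norm, rather than the largest coefficient, suit the
  Leibniz expansion of a determinant with polynomial entries. It also bounds values on
  \<open>[-1, 1]\<close>.\<close>

definition l1norm :: "'a::linordered_idom poly \<Rightarrow> 'a" where
  "l1norm p = (\<Sum>c\<leftarrow>coeffs p. \<bar>c\<bar>)"

lemma l1norm_0 [simp]: "l1norm 0 = 0"
  by (simp add: l1norm_def)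

lemma l1norm_pCons [simp]: "l1norm (pCons a p) = \<bar>a\<bar> + l1norm p"
  by (simp add: l1norm_def coeffs_pCons_eq_cCons cCons_def)

lemma l1norm_nonneg [simp]: "l1norm p \<ge> 0"
  by (induction p) auto

lemma l1norm_uminus [simp]: "l1norm (- p) = l1norm p"
  by (induction p) auto

lemma l1norm_smult [simp]: "l1norm (Polynomial.smult c p) = \<bar>c\<bar> * l1norm p"
  by (induction p) (auto simp: abs_mult distrib_left)

lemma l1norm_add: "l1norm (p + q) \<le> l1norm p + l1norm q"
proof (induction p q rule: poly_induct2)
  case (pCons a p b q)
  then show ?case using abs_triangle_ineq[of a b] by (simp only: add_pCons l1norm_pCons)
qed simp

lemma l1norm_mult: "l1norm (p * q) \<le> l1norm p * l1norm q"
proof (induction p)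
  case (pCons a p)
  have "l1norm (pCons a p * q) \<le> l1norm (Polynomial.smult a q) + l1norm (pCons 0 (p * q))"
    using l1norm_add by (simp only: mult_pCons_left)
  also have "\<dots> \<le> \<bar>a\<bar> * l1norm q + l1norm p * l1norm q" using pCons.IH by simp
  finally show ?case by (simp add: distrib_right)
qed simp

lemma l1norm_prod: "l1norm (prod f A) \<le> (\<Prod>x\<in>A. l1norm (f x))"
proof (induction A rule: infinite_finite_induct)
  case (insert x A)
  then show ?case
    using order_trans[OF l1norm_mult mult_left_mono[OF insert.IH, of "l1norm (f x)"]] by simp
qed (simp_all add: one_pCons)

lemma l1norm_sum: "l1norm (sum f A) \<le> (\<Sum>x\<in>A. l1norm (f x))"
proof (induction A rule: infinite_finite_induct)
  case (insert x A)
  then show ?case using l1norm_add[of "f x" "sum f A"] by simp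
qed simp_all

lemma abs_coeff_le_l1norm: "\<bar>coeff p i\<bar> \<le> l1norm p"
proof (induction p arbitrary: i)
  case (pCons a p)
  then show ?case
    by (cases i) (simp_all add: add_increasing)
qed simp

lemma abs_poly_le_l1norm: "\<bar>x\<bar> \<le> 1 \<Longrightarrow> \<bar>poly p x\<bar> \<le> l1norm p"
proof (induction p)
  case (pCons a p)
  have "\<bar>poly (pCons a p) x\<bar> \<le> \<bar>a\<bar> + \<bar>x\<bar> * \<bar>poly p x\<bar>"
    using abs_triangle_ineq[of a "x * poly p x"] by (simp add: abs_mult)
  also have "\<bar>x\<bar> * \<bar>poly p x\<bar> \<le> 1 * l1norm p"
    using pCons by (intro mult_mono) auto
  finally show ?case by simp
qed simp

lemma l1norm_ge_1: "(p :: int poly) \<noteq> 0 \<Longrightarrow> l1norm p \<ge> 1"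
proof -
  assume "p \<noteq> 0"
  then have "\<bar>lead_coeff p\<bar> \<ge> 1" by (simp add: int_one_le_iff_zero_less)
  then show ?thesis using abs_coeff_le_l1norm[of p "degree p"] by linarith
qed

lemma l1norm_of_int_poly: "l1norm (of_int_poly p :: real poly) = real_of_int (l1norm p)"
  by (induction p) (auto simp: Polynomial.map_poly_pCons)

text \<open>The lowest nonzero coefficient of an integer polynomial has absolute value at least one.\<close>

lemma int_poly_root_lower_bound:
  fixes p :: "int poly" and x :: real
  assumes "p \<noteq> 0" "poly (of_int_poly p) x = 0" "x > 0"
  shows "1 \<le> x * of_int (l1norm p)"
proof (cases "x \<ge> 1")
  case True
  have "real_of_int (l1norm p) \<ge> 1" using l1norm_ge_1[OF assms(1)] by simp
  then show ?thesis using mult_mono[OF True, of 1 "real_of_int (l1norm p)"] assms(3) by simp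
next
  case False
  show ?thesis using assms(1,2)
  proof (induction p)
    case (pCons a p)
    \<comment> \<open>A zero constant term is removed by dividing by \<open>x > 0\<close>. A nonzero
      one has absolute value at least 1 and must be cancelled by \<open>x\<close> times a value of
      absolute value at most \<open>l1norm p\<close>.\<close>
    have e: "real_of_int a + x * poly (of_int_poly p) x = 0"
      using pCons.prems(2) by (simp add: Polynomial.map_poly_pCons)
    show ?case
    proof (cases "a = 0")
      case True
      then show ?thesis using pCons e assms(3) by simp
    next
      case False
      then have "1 \<le> \<bar>real_of_int a\<bar>" by linarith
      also have "\<dots> = x * \<bar>poly (of_int_poly p) x\<bar>"
      proof -
        have "real_of_int a = - (x * poly (of_int_poly p) x)" using e by linarith
        then show ?thesis using assms(3) by (simp add: abs_mult)
      qed
      also have "\<dots> \<le> x * l1norm (of_int_poly p)"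
        using \<open>\<not> x \<ge> 1\<close> assms(3) by (intro mult_left_mono abs_poly_le_l1norm) auto
      also have "\<dots> \<le> x * of_int (l1norm (pCons a p))"
        using assms(3) by (simp add: l1norm_of_int_poly)
      finally show ?thesis .
    qed
  qed simp
qed

text \<open>The Leibniz expansion has \<open>fact N\<close> signed products of \<open>N\<close>
  entries, and each product has norm at most \<open>b ^ N\<close>.\<close>

lemma l1norm_det_le:
  assumes A: "A \<in> carrier_mat N N"
    and le: "\<And>i j. i < N \<Longrightarrow> j < N \<Longrightarrow> l1norm (index_mat A (i, j)) \<le> b"
  shows "l1norm (det A) \<le> fact N * (b :: 'a :: linordered_idom) ^ N"
proof -
  let ?S = "{p. p permutes {0..<N}}"
  have "l1norm (det A) \<le> (\<Sum>p\<in>?S. l1norm (signof p * (\<Prod>i = 0..<N. index_mat A (i, p i))))"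
    unfolding det_def'[OF A] by (rule l1norm_sum)
  also have "\<dots> \<le> (\<Sum>p\<in>?S. b ^ N)"
  proof (rule sum_mono)
    fix p assume "p \<in> ?S"
    then have p: "p i < N" if "i < N" for i using that permutes_in_image[of p "{0..<N}" i] by auto
    have "l1norm (signof p * (\<Prod>i = 0..<N. index_mat A (i, p i))) = l1norm (\<Prod>i = 0..<N. index_mat A (i, p i))"
      by (cases p rule: sign_cases) auto
    also have "\<dots> \<le> (\<Prod>i = 0..<N. l1norm (index_mat A (i, p i)))" by (rule l1norm_prod)
    also have "\<dots> \<le> (\<Prod>i = 0..<N. b)" using le p by (intro prod_mono) auto
    finally show "l1norm (signof p * (\<Prod>i = 0..<N. index_mat A (i, p i))) \<le> b ^ N" by simp
  qed
  also have "\<dots> = fact N * b ^ N" by (simp add: card_permutations[of "{0..<N}" N])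
  finally show ?thesis .
qed

section \<open>A Sylvester matrix for critical values\<close>

text \<open>A row of a Sylvester matrix is a coefficient sequence shifted by \<open>i\<close>;
  multiplied by \<open>x\<close>, it sees only the window of \<open>x\<close> that starts at
  \<open>i\<close>, and \<open>i + m < N\<close> keeps this window inside the matrix.\<close>

lemma sum_shift:
  fixes c :: "nat \<Rightarrow> 'a::comm_semiring_0"
  assumes "i + m < N" "\<And>j. j > m \<Longrightarrow> c j = 0"
  shows "(\<Sum>k<N. (if k < i then 0 else c (k - i)) * x k) = (\<Sum>j\<le>m. c j * x (i + j))"
proof -
  have "(\<Sum>k<N. (if k < i then 0 else c (k - i)) * x k) = (\<Sum>k\<in>(\<lambda>j. i + j) ` {..m}. c (k - i) * x k)"
  proof (rule sum.mono_neutral_cong_right)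
    show "\<forall>k\<in>{..<N} - (\<lambda>j. i + j) ` {..m}. (if k < i then 0 else c (k - i)) * x k = 0"
    proof
      fix k assume "k \<in> {..<N} - (\<lambda>j. i + j) ` {..m}"
      then have "k < i \<or> k - i > m" by (metis DiffE atMost_iff imageI le_add_diff_inverse not_le)
      then show "(if k < i then 0 else c (k - i)) * x k = 0" using assms(2) by auto
    qed
  qed (use assms(1) in auto)
  also have "\<dots> = (\<Sum>j\<le>m. c j * x (i + j))" by (subst sum.reindex) (auto simp: inj_on_def)
  finally show ?thesis .
qed

text \<open>A Sylvester matrix of \<open>p - e\<close> and \<open>p'\<close>: the entries are polynomials in the unknown \<open>e\<close>, and
  multiplication by the vector of powers of \<open>z\<close> gives the values \<open>z\<^sup>i (p(z) - e)\<close> and \<open>z\<^sup>i p'(z)\<close>.\<close>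

definition crit_mat :: "int poly \<Rightarrow> int poly mat" where
  "crit_mat p = (let n = degree p in Matrix.mat (2 * n - 1) (2 * n - 1) (\<lambda>(i, k).
     if i < n - 1 then (if k < i then 0 else [:coeff p (k - i), if k = i then - 1 else 0:])
     else (if k < i - (n - 1) then 0 else [:coeff (pderiv p) (k - (i - (n - 1))):])))"

definition crit_poly :: "int poly \<Rightarrow> int poly" where
  "crit_poly p = det (crit_mat p)"


lemma crit_mat_carrier: "crit_mat p \<in> carrier_mat (2 * degree p - 1) (2 * degree p - 1)"
  by (simp add: crit_mat_def Let_def)

abbreviation eval_int_poly :: "real \<Rightarrow> int poly \<Rightarrow> real" where
  "eval_int_poly e q \<equiv> poly (of_int_poly q) e"

lemma eval_int_poly_hom: "comm_ring_hom (eval_int_poly e)"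
  by unfold_locales (auto simp: of_int_poly_hom.hom_add of_int_poly_hom.hom_mult)

text \<open>\<open>x\<close> is arbitrary because there are two applications: to a vector of powers,
  which yields critical values as roots, and to an unknown kernel vector when
  \<open>crit_poly\<close> is shown to be nonzero.\<close>

lemma crit_mat_mult_vec:
  fixes p :: "int poly" and e :: real
  assumes n: "degree p = n" "n \<ge> 1" and x: "x \<in> carrier_vec (2 * n - 1)"
  defines "y \<equiv> map_mat (eval_int_poly e) (crit_mat p) *\<^sub>v x"
  shows "i < n - 1 \<Longrightarrow> y $ i = (\<Sum>j\<le>n. of_int (coeff p j) * x $ (i + j)) - e * x $ i"
    and "i < n \<Longrightarrow> y $ (n - 1 + i) = (\<Sum>j\<le>n - 1. of_int (coeff (pderiv p) j) * x $ (i + j))"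
proof -
  let ?N = "2 * n - 1"
  have yi: "y $ i = (\<Sum>k<?N. eval_int_poly e (index_mat (crit_mat p) (i, k)) * x $ k)" if "i < ?N" for i
    using that n(1) x crit_mat_carrier[of p]
    by (simp add: y_def scalar_prod_def atLeast0LessThan)
  show "y $ i = (\<Sum>j\<le>n. of_int (coeff p j) * x $ (i + j)) - e * x $ i" if i: "i < n - 1"
  proof -
    define c where "c j = real_of_int (coeff p j) - (if j = 0 then e else 0)" for j
    have "y $ i = (\<Sum>k<?N. (if k < i then 0 else c (k - i)) * x $ k)"
      using i n by (subst yi) (auto simp: crit_mat_def Let_def c_def Polynomial.map_poly_pCons intro!: sum.cong)
    also have "\<dots> = (\<Sum>j\<le>n. c j * x $ (i + j))"
      using i n by (intro sum_shift) (auto simp: c_def coeff_eq_0)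
    also have "\<dots> = (\<Sum>j\<le>n. of_int (coeff p j) * x $ (i + j)) - (\<Sum>j\<le>n. if j = 0 then e * x $ i else 0)"
      unfolding sum_subtractf[symmetric] by (intro sum.cong) (auto simp: c_def algebra_simps)
    finally show ?thesis by simp
  qed
  show "y $ (n - 1 + i) = (\<Sum>j\<le>n - 1. of_int (coeff (pderiv p) j) * x $ (i + j))" if i: "i < n"
  proof -
    define c where "c j = real_of_int (coeff (pderiv p) j)" for j
    have "y $ (n - 1 + i) = (\<Sum>k<?N. (if k < i then 0 else c (k - i)) * x $ k)"
      using i n by (subst yi) (auto simp: crit_mat_def Let_def c_def Polynomial.map_poly_pCons intro!: sum.cong)
    also have "\<dots> = (\<Sum>j\<le>n - 1. c j * x $ (i + j))"
      using i n by (intro sum_shift) (auto simp: c_def coeff_eq_0 degree_pderiv)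
    finally show ?thesis by (simp add: c_def)
  qed
qed

lemma eval_crit_poly:
  "eval_int_poly e (crit_poly p) = det (map_mat (eval_int_poly e) (crit_mat p))"
  unfolding crit_poly_def by (rule comm_ring_hom.hom_det[OF eval_int_poly_hom, symmetric])

lemma eval_crit_poly_eq_0_iff:
  "eval_int_poly e (crit_poly p) = 0 \<longleftrightarrow>
    (\<exists>x. x \<in> carrier_vec (2 * degree p - 1) \<and> x \<noteq> 0\<^sub>v (2 * degree p - 1)
      \<and> map_mat (eval_int_poly e) (crit_mat p) *\<^sub>v x = 0\<^sub>v (2 * degree p - 1))"
  unfolding eval_crit_poly using crit_mat_carrier[of p]
  by (intro det_0_iff_vec_prod_zero) auto

text \<open>The powers of the critical point form a kernel vector of the matrix at the critical value.\<close>

lemma crit_poly_root: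
  assumes "degree p \<ge> 1" "poly (of_int_poly (pderiv p)) z = 0"
  shows "eval_int_poly (poly (of_int_poly p) z) (crit_poly p) = 0"
proof -
  define n where "n = degree p"
  define N where "N = 2 * n - 1"
  define x where "x = Matrix.vec N (\<lambda>j. z ^ j)"
  have x: "x \<in> carrier_vec N" "x \<in> carrier_vec (2 * n - 1)" by (simp_all add: x_def N_def)
  have n: "n \<ge> 1" using assms(1) by (simp add: n_def)
  have "x $ 0 = 1" "0 < N" using n by (simp_all add: x_def N_def)
  then have nz: "x \<noteq> 0\<^sub>v N" by auto
  let ?M = "map_mat (eval_int_poly (poly (of_int_poly p) z)) (crit_mat p)"
  have M: "?M \<in> carrier_mat N N" using crit_mat_carrier[of p] by (simp add: N_def n_def)
  have pw: "(\<Sum>j\<le>m. of_int (coeff q j) * x $ (i + j)) = z ^ i * poly (of_int_poly q) z"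
    if "i + m < N" "degree q \<le> m" for i m and q :: "int poly"
  proof -
    have "poly (of_int_poly q) z = (\<Sum>j\<le>m. real_of_int (coeff q j) * z ^ j)"
      unfolding poly_altdef using that(2)
      by (intro sum.mono_neutral_cong_left) (auto simp: coeff_eq_0)
    then show ?thesis using that(1)
      by (auto simp: x_def sum_distrib_left power_add intro!: sum.cong)
  qed
  have "?M *\<^sub>v x = 0\<^sub>v N"
  proof (rule eq_vecI)
    fix i assume "i < dim_vec (0\<^sub>v N :: real vec)"
    then have "i < N" by simp
    then have "i < n - 1 \<or> i = n - 1 + (i - (n - 1)) \<and> i - (n - 1) < n"
      unfolding N_def by arith
    then consider "i < n - 1" | "i = n - 1 + (i - (n - 1))" "i - (n - 1) < n"
      by blast
    then show "(?M *\<^sub>v x) $ i = 0\<^sub>v N $ i"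
    proof cases
      case 1
      then have "i < N" "i + n < N" by (auto simp: N_def)
      with 1 show ?thesis
        using crit_mat_mult_vec(1)[OF n_def[symmetric] n x(2) 1] pw[of i n p]
        by (simp add: n_def x_def)
    next
      case 2
      define k where "k = i - (n - 1)"
      note 2 = 2[folded k_def]
      then have "i < N" "k + (n - 1) < N" using n by (auto simp: N_def)
      with 2 show ?thesis
        using crit_mat_mult_vec(2)[OF n_def[symmetric] n x(2) 2(2)] pw[of k "n - 1" "pderiv p"] assms(2)
        by (simp add: n_def degree_pderiv)
    qed
  qed (use M in auto)
  then show ?thesis
    unfolding eval_crit_poly_eq_0_iff using x nz by (auto simp: N_def n_def)
qed

text \<open>The derivative rows bound a kernel vector by its first \<open>degree p - 1\<close> entries, so for large
  \<open>e\<close> the remaining rows exclude a nonzero kernel vector.\<close>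

lemma crit_poly_nonzero:
  assumes "degree p \<ge> 2"
  shows "crit_poly p \<noteq> 0"
proof
  assume "crit_poly p = 0"
  define n where "n = degree p"
  have n: "n \<ge> 2" "n \<ge> 1" using assms by (simp_all add: n_def)
  define N where "N = 2 * n - 1"
  define a where "a = real_of_int (coeff (pderiv p) (n - 1))"
  have a: "a \<noteq> 0" using n by (simp add: a_def n_def coeff_pderiv)
      (metis degree_0 leading_coeff_0_iff n(2) n_def not_one_le_zero)
  \<comment> \<open>A derivative row, with leading coefficient \<open>a\<close>, expresses an entry
    of a kernel vector through the \<open>n - 1\<close> entries before it. \<open>c\<close> bounds
    the growth in one such step, and \<open>c \<ge> 1\<close> makes its powers monotone.\<close>
  define c where "c = 1 + (\<Sum>j<n - 1. \<bar>real_of_int (coeff (pderiv p) j)\<bar> / \<bar>a\<bar>)"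
  have c: "c \<ge> 1" "c \<ge> (\<Sum>j<n - 1. \<bar>real_of_int (coeff (pderiv p) j)\<bar> / \<bar>a\<bar>)"
    by (auto simp: c_def intro!: sum_nonneg)
  define s where "s = (\<Sum>j\<le>n. \<bar>real_of_int (coeff p j)\<bar>)"
  \<comment> \<open>With this value the rows of \<open>p - e\<close> yield
    \<open>e * \<mu> \<le> (e - 1) * \<mu>\<close>, where \<open>\<mu>\<close> is the largest
    absolute value among the first \<open>n - 1\<close> entries. This is impossible for
    \<open>\<mu> > 0\<close>.\<close>
  define e where "e = s * c ^ N + 1"
  have "eval_int_poly e (crit_poly p) = 0" using \<open>crit_poly p = 0\<close> by simp
  then obtain x where x: "x \<in> carrier_vec N" "x \<noteq> 0\<^sub>v N"
      "map_mat (eval_int_poly e) (crit_mat p) *\<^sub>v x = 0\<^sub>v N"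
    unfolding eval_crit_poly_eq_0_iff by (auto simp: N_def n_def)
  note rows = crit_mat_mult_vec[OF n_def[symmetric] n(2) x(1)[unfolded N_def], where e = e, unfolded x(3)]
  have r1: "e * x $ i = (\<Sum>j\<le>n. of_int (coeff p j) * x $ (i + j))" if "i < n - 1" for i
    using rows(1)[OF that] that by (simp add: N_def)
  have r2: "(\<Sum>j\<le>n - 1. of_int (coeff (pderiv p) j) * x $ (i + j)) = 0" if "i < n" for i
    using rows(2)[OF that] that n by (simp add: N_def)
  obtain i0 where i0: "i0 < n - 1" "\<And>i. i < n - 1 \<Longrightarrow> \<bar>x $ i\<bar> \<le> \<bar>x $ i0\<bar>"
  proof -
    have "(MAX i\<in>{..<n - 1}. \<bar>x $ i\<bar>) \<in> (\<lambda>i. \<bar>x $ i\<bar>) ` {..<n - 1}"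
      using n by (intro Max_in) (auto simp: lessThan_empty_iff)
    then obtain i where "i < n - 1" "(MAX i\<in>{..<n - 1}. \<bar>x $ i\<bar>) = \<bar>x $ i\<bar>" by auto
    then show ?thesis by (intro that[of i]) (auto intro: order_trans[OF Max_ge])
  qed
  define \<mu> where "\<mu> = \<bar>x $ i0\<bar>"
  have \<mu>0: "\<mu> \<ge> 0" by (simp add: \<mu>_def)
  have bnd: "\<bar>x $ k\<bar> \<le> c ^ k * \<mu>" if "k < N" for k
    using that
  proof (induction k rule: less_induct)
    case (less k)
    show ?case
    proof (cases "k < n - 1")
      case True
      then have "\<bar>x $ k\<bar> \<le> 1 * \<mu>" using i0 by (simp add: \<mu>_def)
      also have "\<dots> \<le> c ^ k * \<mu>" using c \<mu>0 by (intro mult_right_mono) (simp_all add: one_le_power)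
      finally show ?thesis .
    next
      case False
      define i where "i = k - (n - 1)"
      have k: "k = i + (n - 1)" "i < n" using False less.prems by (auto simp: i_def N_def)
      have "k \<ge> 1" using k n by simp
      have sp: "{..n - 1} = insert (n - 1) {..<n - 1}" using n by auto
      have "a * x $ k = - (\<Sum>j<n - 1. of_int (coeff (pderiv p) j) * x $ (i + j))"
        using r2[OF k(2), unfolded sp] unfolding k(1) a_def by (subst (asm) sum.insert) auto
      then have "\<bar>a\<bar> * \<bar>x $ k\<bar> = \<bar>\<Sum>j<n - 1. of_int (coeff (pderiv p) j) * x $ (i + j)\<bar>"
        by (simp add: abs_mult[symmetric])
      also have "\<dots> \<le> (\<Sum>j<n - 1. \<bar>of_int (coeff (pderiv p) j)\<bar> * (c ^ (k - 1) * \<mu>))"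
      proof (rule order_trans[OF sum_abs], rule sum_mono)
        fix j assume "j \<in> {..<n - 1}"
        then have j: "i + j < k" "i + j \<le> k - 1" using k by auto
        have "\<bar>x $ (i + j)\<bar> \<le> c ^ (i + j) * \<mu>" using less.IH[OF j(1)] j(1) less.prems by simp
        also have "\<dots> \<le> c ^ (k - 1) * \<mu>" using c j \<mu>0 by (intro mult_right_mono power_increasing) auto
        finally show "\<bar>of_int (coeff (pderiv p) j) * x $ (i + j)\<bar>
            \<le> \<bar>real_of_int (coeff (pderiv p) j)\<bar> * (c ^ (k - 1) * \<mu>)"
          unfolding abs_mult by (rule mult_left_mono) simp
      qed
      also have "\<dots> = \<bar>a\<bar> * ((\<Sum>j<n - 1. \<bar>real_of_int (coeff (pderiv p) j)\<bar> / \<bar>a\<bar>) * (c ^ (k - 1) * \<mu>))"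
        using a by (simp add: sum_distrib_right sum_distrib_left)
      finally have "\<bar>x $ k\<bar> \<le> (\<Sum>j<n - 1. \<bar>real_of_int (coeff (pderiv p) j)\<bar> / \<bar>a\<bar>) * (c ^ (k - 1) * \<mu>)"
        using a by (simp add: mult_le_cancel_left)
      also have "\<dots> \<le> c * (c ^ (k - 1) * \<mu>)" using c \<mu>0 by (intro mult_right_mono) auto
      also have "\<dots> = c ^ k * \<mu>" using \<open>k \<ge> 1\<close> by (cases k) auto
      finally show ?thesis .
    qed
  qed
  have \<mu>: "\<mu> > 0"
  proof (rule ccontr)
    assume "\<not> \<mu> > 0"
    then have "x $ k = 0" if "k < N" for k using bnd[OF that] \<mu>0 by simp
    then have "x = 0\<^sub>v N" using x(1) by (intro eq_vecI) auto
    with x(2) show False by simp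
  qed
  have s0: "s \<ge> 0" "e > 0" using c by (auto simp: s_def e_def intro!: sum_nonneg add_nonneg_pos)
  have "e * \<mu> = \<bar>\<Sum>j\<le>n. of_int (coeff p j) * x $ (i0 + j)\<bar>"
    using s0 unfolding r1[OF i0(1), symmetric] by (simp add: \<mu>_def abs_mult)
  also have "\<dots> \<le> (\<Sum>j\<le>n. \<bar>of_int (coeff p j)\<bar> * (c ^ N * \<mu>))"
  proof (rule order_trans[OF sum_abs], rule sum_mono)
    fix j assume "j \<in> {..n}"
    then have j: "i0 + j < N" using i0(1) n by (auto simp: N_def)
    have "\<bar>x $ (i0 + j)\<bar> \<le> c ^ (i0 + j) * \<mu>" by (rule bnd[OF j])
    also have "\<dots> \<le> c ^ N * \<mu>" using c j \<mu>0 by (intro mult_right_mono power_increasing) auto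
    finally show "\<bar>of_int (coeff p j) * x $ (i0 + j)\<bar> \<le> \<bar>real_of_int (coeff p j)\<bar> * (c ^ N * \<mu>)"
      unfolding abs_mult by (rule mult_left_mono) simp
  qed
  also have "\<dots> = (e - 1) * \<mu>" by (simp add: e_def s_def sum_distrib_right mult.assoc)
  finally show False using \<mu> by simp
qed

text \<open>The common bound \<open>(n + 1) * b\<close> for the entries, \<open>n\<close> being the
  degree, covers both kinds of row: in a row of \<open>p - e\<close> the unknown adds 1 to one
  coefficient, and in a row of the derivative a coefficient is multiplied by at most
  \<open>n\<close>.\<close>

lemma l1norm_crit_poly:
  assumes "degree p \<ge> 1" "\<And>i. \<bar>coeff p i\<bar> \<le> b" "b \<ge> 1"
  shows "l1norm (crit_poly p) \<le> fact (2 * degree p - 1) * ((int (degree p) + 1) * b) ^ (2 * degree p - 1)"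
  unfolding crit_poly_def
proof (rule l1norm_det_le[OF crit_mat_carrier])
  fix i j assume ij: "i < 2 * degree p - 1" "j < 2 * degree p - 1"
  define n where "n = int (degree p)"
  have n: "n \<ge> 1" using assms(1) by (simp add: n_def)
  have 1: "\<bar>coeff p k\<bar> + 1 \<le> (n + 1) * b" for k
  proof -
    have "1 \<le> n * b" using n assms(3) mult_mono[of 1 n 1 b] by simp
    then show ?thesis using assms(2)[of k] by (simp add: distrib_right)
  qed
  have 3: "\<bar>coeff p k\<bar> \<le> (n + 1) * b" for k using 1[of k] by linarith
  have 2: "\<bar>coeff (pderiv p) k\<bar> \<le> (n + 1) * b" for k
  proof (cases "k < degree p")
    case True
    have "\<bar>coeff (pderiv p) k\<bar> = (int k + 1) * \<bar>coeff p (Suc k)\<bar>"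
      by (simp add: coeff_pderiv abs_mult)
    also have "\<dots> \<le> (n + 1) * b" using True assms(2,3) by (intro mult_mono) (auto simp: n_def)
    finally show ?thesis .
  next
    case False
    then have "coeff (pderiv p) k = 0" by (simp add: coeff_pderiv coeff_eq_0)
    then show ?thesis using n assms(3) by simp
  qed
  have "0 \<le> (n + 1) * b" using n assms(3) by simp
  then show "l1norm (index_mat (crit_mat p) (i, j)) \<le> (int (degree p) + 1) * b"
    using ij 1 2 3 unfolding n_def
    by (auto simp: crit_mat_def Let_def)
qed

text \<open>The minimum over \<open>[-1, 1]\<close> is attained at an endpoint, where the value is a
  positive integer, or at an interior critical point, where it is a positive root of
  \<open>crit_poly p\<close>. Degrees 0 and 1 are treated apart: a constant is an integer, and a
  linear polynomial has no critical point. The product form of the conclusion avoids dividing by the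
  bound.\<close>

lemma pos_int_poly_lower_bound:
  fixes p :: "int poly" and b :: int
  assumes deg: "degree p \<le> D" and D: "D \<ge> 1" and b: "\<And>i. \<bar>coeff p i\<bar> \<le> b"
    and pos: "\<And>z. z \<in> {-1..1} \<Longrightarrow> poly (of_int_poly p) z > (0 :: real)" and z: "z \<in> {-1..1}"
  shows "1 \<le> poly (of_int_poly p) z * real_of_int (fact (2 * D) * ((int D + 1) * b) ^ (2 * D))"
proof -
  define B where "B = fact (2 * D) * ((int D + 1) * b) ^ (2 * D)"
  have "p \<noteq> 0" using pos[of 0] by auto
  then have "coeff p (degree p) \<noteq> 0" by simp
  then have b1: "b \<ge> 1" using b[of "degree p"] by linarith
  have Db: "(int D + 1) * b \<ge> 1" using b1 mult_mono[of 1 "int D + 1" 1 b] by simp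
  have B1: "B \<ge> 1"
    using mult_mono[of 1 "fact (2 * D)" 1 "((int D + 1) * b) ^ (2 * D)"] one_le_power[OF Db]
    by (simp add: B_def fact_ge_1)
  obtain z0 :: real where z0: "z0 \<in> {-1..1}" "\<And>y. y \<in> {-1..1} \<Longrightarrow> poly (of_int_poly p) z0 \<le> poly (of_int_poly p) y"
  proof -
    have "continuous_on {-1..1} (\<lambda>x. poly (of_int_poly p) x :: real)" by (intro continuous_intros)
    from continuous_attains_inf[OF compact_Icc _ this] that show thesis by force
  qed
  define v where "v = poly (of_int_poly p) z0"
  have v: "v > 0" using pos z0 by (simp add: v_def)
  have int: "1 \<le> v * of_int B" if "v = of_int k" for k
  proof -
    have "v \<ge> 1" using v that by simp
    then show ?thesis using B1 mult_mono[of 1 v 1 "of_int B"] by simp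
  qed
  have "1 \<le> v * of_int B"
  proof (cases "z0 = 1 \<or> z0 = -1")
    case True
    have "poly (of_int_poly p) (of_int y) = real_of_int (poly p y)" for y by simp
    from this[of 1] this[of "-1"] show ?thesis using True int by (auto simp: v_def)
  next
    case False
    have d0: "poly (of_int_poly (pderiv p)) z0 = (0 :: real)"
    proof -
      have "poly (pderiv (of_int_poly p)) z0 = (0 :: real)"
      proof (rule DERIV_local_min[OF poly_DERIV])
        show "0 < min (1 - z0) (1 + z0)" using False z0(1) by (auto simp: min_def)
        show "\<forall>y. \<bar>z0 - y\<bar> < min (1 - z0) (1 + z0) \<longrightarrow> poly (of_int_poly p) z0 \<le> poly (of_int_poly p) y"
          by (intro allI impI z0(2)) (auto simp: abs_if split: if_splits)
      qed
      then show ?thesis by (simp add: of_int_hom.map_poly_pderiv)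
    qed
    consider "degree p = 0" | "degree p = 1" | "degree p \<ge> 2" by linarith
    then show ?thesis
    proof cases
      case 1
      then obtain k where "p = [:k:]" by (metis degree_eq_zeroE)
      then show ?thesis using int[of k] by (simp add: v_def Polynomial.map_poly_pCons)
    next
      case 2
      then obtain a c where "p = [:c, a:]" "a \<noteq> 0" by (metis degree1_coeffs)
      then show ?thesis using d0 by (simp add: pderiv_pCons Polynomial.map_poly_pCons)
    next
      case 3
      define m where "m = 2 * degree p - 1"
      have "1 \<le> v * of_int (l1norm (crit_poly p))"
        using 3 v crit_poly_nonzero[OF 3] crit_poly_root[of p z0, OF _ d0]
        by (intro int_poly_root_lower_bound) (auto simp: v_def)
      also have "\<dots> \<le> v * of_int B"
      proof (intro mult_left_mono)
        have "l1norm (crit_poly p) \<le> fact m * ((int (degree p) + 1) * b) ^ m"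
          using 3 b b1 unfolding m_def by (intro l1norm_crit_poly) auto
        also have "\<dots> \<le> fact (2 * D) * ((int D + 1) * b) ^ m"
          using deg b1 by (intro mult_mono fact_mono power_mono) (auto simp: m_def)
        also have "\<dots> \<le> B" unfolding B_def
          using deg Db by (intro mult_left_mono power_increasing) (auto simp: m_def)
        finally show "real_of_int (l1norm (crit_poly p)) \<le> of_int B" by simp
      qed (use v in simp)
      finally show ?thesis .
    qed
  qed
  also have "\<dots> \<le> poly (of_int_poly p) z * of_int B"
    using z0(2)[OF z] B1 by (intro mult_right_mono) (auto simp: v_def)
  finally show ?thesis by (simp only: B_def)
qed

subsection \<open>Interpolation at equidistant nodes\<close>

text \<open>The Lagrange basis for the nodes \<open>k / D\<close>. Each factor is written as
  \<open>(D z - j) / (k - j)\<close>: the numerator has norm at most \<open>2 D\<close> and the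
  denominator absolute value at least 1, whence \<open>(2 D) ^ D\<close> below.\<close>

definition lagrange :: "nat \<Rightarrow> nat \<Rightarrow> real poly" where
  "lagrange D k = (\<Prod>j\<in>{..D} - {k}. Polynomial.smult (1 / (real k - real j)) [:- real j, real D:])"

lemma poly_lagrange:
  assumes "D \<ge> 1" "k \<le> D" "i \<le> D"
  shows "poly (lagrange D k) (real i / real D) = (if i = k then 1 else 0)"
proof (cases "i = k")
  case True
  have "poly (lagrange D k) (real i / real D) = (\<Prod>j\<in>{..D} - {k}. 1)"
    unfolding lagrange_def poly_prod using assms True
    by (intro prod.cong) (auto simp: diff_divide_distrib[symmetric])
  then show ?thesis using True by simp
next
  case False
  then show ?thesis unfolding lagrange_def poly_prod using assms by (auto simp: prod_zero_iff)
qed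

lemma degree_lagrange: "k \<le> D \<Longrightarrow> degree (lagrange D k) \<le> D"
proof -
  assume "k \<le> D"
  have "degree (lagrange D k) \<le> (\<Sum>j\<in>{..D} - {k}. 1)"
    unfolding lagrange_def
    by (rule order_trans[OF degree_prod_sum_le], simp, rule sum_mono, unfold o_def)
      (rule order_trans[OF degree_smult_le], simp)
  also have "\<dots> = D" using \<open>k \<le> D\<close> by simp
  finally show ?thesis .
qed

lemma l1norm_lagrange:
  assumes "k \<le> D"
  shows "l1norm (lagrange D k) \<le> (2 * real D) ^ D"
proof -
  have "l1norm (lagrange D k)
      \<le> (\<Prod>j\<in>{..D} - {k}. l1norm (Polynomial.smult (1 / (real k - real j)) [:- real j, real D:]))"
    unfolding lagrange_def by (rule l1norm_prod)
  also have "\<dots> \<le> (\<Prod>j\<in>{..D} - {k}. 2 * real D)"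
  proof (intro prod_mono conjI l1norm_nonneg)
    fix j assume j: "j \<in> {..D} - {k}"
    then have "\<bar>real k - real j\<bar> \<ge> 1" by auto
    then have "\<bar>1 / (real k - real j)\<bar> * (\<bar>- real j\<bar> + (\<bar>real D\<bar> + 0)) \<le> 1 * (real j + real D)"
      by (intro mult_mono) auto
    also have "\<dots> \<le> 2 * real D" using j by simp
    finally show "l1norm (Polynomial.smult (1 / (real k - real j)) [:- real j, real D:]) \<le> 2 * real D"
      unfolding l1norm_smult l1norm_pCons l1norm_0 .
  qed
  also have "\<dots> = (2 * real D) ^ D" using assms by simp
  finally show ?thesis .
qed

lemma lagrange_interpolation:
  assumes "D \<ge> 1" "degree p \<le> D"
  shows "p = (\<Sum>k\<le>D. Polynomial.smult (poly p (real k / real D)) (lagrange D k))" (is "p = ?q")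
proof (rule ccontr)
  assume "p \<noteq> ?q"
  then have nz: "p - ?q \<noteq> 0" by simp
  have "degree ?q \<le> D"
    by (intro degree_sum_le) (auto intro: order_trans[OF degree_smult_le] degree_lagrange)
  then have deg: "degree (p - ?q) \<le> D" using assms(2) by (intro degree_diff_le) auto
  have "poly (p - ?q) (real i / real D) = 0" if "i \<le> D" for i
  proof -
    have "poly ?q (real i / real D) = (\<Sum>k\<le>D. if i = k then poly p (real k / real D) else 0)"
      unfolding poly_sum using assms(1) that by (intro sum.cong) (auto simp: poly_lagrange)
    then show ?thesis using that by simp
  qed
  then have "(\<lambda>i. real i / real D) ` {..D} \<subseteq> {x. poly (p - ?q) x = 0}" by auto
  then have "card ((\<lambda>i. real i / real D) ` {..D}) \<le> card {x. poly (p - ?q) x = 0}"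
    using poly_roots_finite[OF nz] by (intro card_mono)
  also have "\<dots> \<le> D" using card_poly_roots_bound[OF nz] deg by simp
  also have "card ((\<lambda>i. real i / real D) ` {..D}) = D + 1"
    using assms(1) by (subst card_image) (auto simp: inj_on_def)
  finally show False by simp
qed

text \<open>For a polynomial nonnegative on \<open>[-1, 1]\<close> the sum on the right is the sum
  of its node values. Every functional with small coordinates is then dominated by the sum of the
  evaluations at the nodes.\<close>

lemma l1norm_le_node_values:
  assumes "D \<ge> 1" "degree p \<le> D"
  shows "l1norm p \<le> (2 * real D) ^ D * (\<Sum>k\<le>D. \<bar>poly p (real k / real D)\<bar>)"
proof -
  have "l1norm p \<le> (\<Sum>k\<le>D. l1norm (Polynomial.smult (poly p (real k / real D)) (lagrange D k)))"
    by (subst lagrange_interpolation[OF assms]) (rule l1norm_sum)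
  also have "\<dots> \<le> (\<Sum>k\<le>D. \<bar>poly p (real k / real D)\<bar> * (2 * real D) ^ D)"
    unfolding l1norm_smult by (intro sum_mono mult_left_mono l1norm_lagrange) auto
  finally show ?thesis by (simp add: sum_distrib_left mult.commute)
qed

subsection \<open>Positive definite matrices and local norms\<close>

definition mat_trace :: "real mat \<Rightarrow> real" where
  "mat_trace A = (\<Sum>i<dim_row A. A $$ (i, i))"

text \<open>Vectors are functions on all of \<open>nat\<close>, of which only the values below the
  dimension count. Linear combinations and the index shifts of block matrices then need no dimension
  conditions.\<close>

definition qform :: "real mat \<Rightarrow> (nat \<Rightarrow> real) \<Rightarrow> (nat \<Rightarrow> real) \<Rightarrow> real" where
  "qform A u v = (\<Sum>a<dim_row A. \<Sum>b<dim_col A. u a * A $$ (a, b) * v b)"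

definition psd :: "real mat \<Rightarrow> bool" where
  "psd A \<longleftrightarrow> (\<forall>u. qform A u u \<ge> 0)"

definition posdef :: "real mat \<Rightarrow> bool" where
  "posdef A \<longleftrightarrow> (\<forall>u. (\<exists>a<dim_row A. u a \<noteq> 0) \<longrightarrow> qform A u u > 0)"

text \<open>This is the square of the Frobenius norm, to match \<open>lnorm2\<close>.\<close>

definition frob :: "real mat \<Rightarrow> real" where
  "frob A = (\<Sum>i<dim_row A. \<Sum>j<dim_col A. (A $$ (i, j))\<^sup>2)"

lemma index_mult_mat_sum:
  assumes "A \<in> carrier_mat n k" "B \<in> carrier_mat k m" "i < n" "j < m"
  shows "(A * B) $$ (i, j) = (\<Sum>l<k. A $$ (i, l) * B $$ (l, j))"
  using assms by (simp add: scalar_prod_def atLeast0LessThan)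

lemma mat_trace_mult:
  assumes "A \<in> carrier_mat n k" "B \<in> carrier_mat k n"
  shows "mat_trace (A * B) = (\<Sum>i<n. \<Sum>j<k. A $$ (i, j) * B $$ (j, i))"
  using assms by (simp add: mat_trace_def scalar_prod_def atLeast0LessThan)

lemma mat_trace_comm:
  assumes "A \<in> carrier_mat n k" "B \<in> carrier_mat k n"
  shows "mat_trace (A * B) = mat_trace (B * A)"
  unfolding mat_trace_mult[OF assms] mat_trace_mult[OF assms(2,1)]
  by (subst sum.swap) (simp add: mult.commute)

lemma mat_trace_add:
  "A \<in> carrier_mat n n \<Longrightarrow> B \<in> carrier_mat n n \<Longrightarrow> mat_trace (A + B) = mat_trace A + mat_trace B"
  by (simp add: mat_trace_def sum.distrib)

lemma mat_trace_minus:
  "A \<in> carrier_mat n n \<Longrightarrow> B \<in> carrier_mat n n \<Longrightarrow> mat_trace (A - B) = mat_trace A - mat_trace B"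
  by (simp add: mat_trace_def sum_subtractf)

lemma mat_trace_smult:
  "A \<in> carrier_mat n n \<Longrightarrow> mat_trace (c \<cdot>\<^sub>m A) = c * mat_trace A"
  by (simp add: mat_trace_def sum_distrib_left)

lemma mat_trace_one [simp]: "mat_trace (1\<^sub>m n) = real n"
  by (simp add: mat_trace_def)

lemma frob_eq_trace:
  assumes "A \<in> carrier_mat n n" "A\<^sup>T = A"
  shows "frob A = mat_trace (A * A)"
proof -
  have "A $$ (j, i) = A $$ (i, j)" if "i < n" "j < n" for i j
    using assms that by (metis carrier_matD index_transpose_mat(1))
  then show ?thesis unfolding mat_trace_mult[OF assms(1,1)] using assms(1)
    by (simp add: frob_def power2_eq_square)
qed

lemma frob_nonneg: "frob A \<ge> 0"
  unfolding frob_def by (intro sum_nonneg) auto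

lemma sum_sum_cauchy_schwarz:
  fixes f g :: "nat \<Rightarrow> nat \<Rightarrow> real"
  shows "(\<Sum>i<n. \<Sum>j<m. f i j * g i j)\<^sup>2 \<le> (\<Sum>i<n. \<Sum>j<m. (f i j)\<^sup>2) * (\<Sum>i<n. \<Sum>j<m. (g i j)\<^sup>2)"
  using Cauchy_Schwarz_ineq_sum[of "case_prod f" "case_prod g" "{..<n} \<times> {..<m}"]
  by (simp add: sum.cartesian_product case_prod_unfold)

lemma mat_trace_mult_cauchy_schwarz:
  assumes A: "A \<in> carrier_mat n n" and B: "B \<in> carrier_mat n n" and sym: "B\<^sup>T = B"
  shows "(mat_trace (A * B))\<^sup>2 \<le> frob A * frob B"
proof -
  have "B $$ (j, i) = B $$ (i, j)" if "i < n" "j < n" for i j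
    using B sym that by (metis carrier_matD index_transpose_mat(1))
  then have "mat_trace (A * B) = (\<Sum>i<n. \<Sum>j<n. A $$ (i, j) * B $$ (i, j))"
    unfolding mat_trace_mult[OF A B] by (intro sum.cong) auto
  then show ?thesis
    using sum_sum_cauchy_schwarz[of "\<lambda>i j. A $$ (i, j)" "\<lambda>i j. B $$ (i, j)" n n] A B
    by (simp add: frob_def)
qed

lemma qform_add:
  assumes "A \<in> carrier_mat n m" "B \<in> carrier_mat n m"
  shows "qform (A + B) u v = qform A u v + qform B u v"
  using assms by (simp add: qform_def sum.distrib algebra_simps)

lemma qform_smult: "qform (c \<cdot>\<^sub>m A) u v = c * qform A u v"
  by (simp add: qform_def sum_distrib_left mult.left_commute mult.assoc)

lemma qform_one: "qform (1\<^sub>m n) u v = (\<Sum>a<n. u a * v a)"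
proof -
  have "(\<Sum>b<n. u a * 1\<^sub>m n $$ (a, b) * v b) = u a * v a" if "a < n" for a
  proof -
    have "(\<Sum>b<n. u a * 1\<^sub>m n $$ (a, b) * v b) = (\<Sum>b<n. if a = b then u a * v a else 0)"
      using that by (intro sum.cong) auto
    then show ?thesis using that by simp
  qed
  then show ?thesis by (simp add: qform_def)
qed

lemma qform_right_linear:
  "qform A u (\<lambda>b. x * v b + y * w b) = x * qform A u v + y * qform A u w"
  by (simp add: qform_def sum_distrib_left sum.distrib algebra_simps)

lemma qform_left_linear:
  "qform A (\<lambda>b. x * v b + y * w b) u = x * qform A v u + y * qform A w u"
  by (simp add: qform_def sum_distrib_left sum.distrib algebra_simps)

lemma qform_right_sum: "qform A u (\<lambda>b. \<Sum>j\<in>J. c j * f j b) = (\<Sum>j\<in>J. c j * qform A u (f j))"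
proof -
  have "qform A u (\<lambda>b. \<Sum>j\<in>J. c j * f j b)
      = (\<Sum>a<dim_row A. \<Sum>b<dim_col A. \<Sum>j\<in>J. c j * (u a * A $$ (a, b) * f j b))"
    by (simp add: qform_def sum_distrib_left mult_ac)
  also have "\<dots> = (\<Sum>j\<in>J. \<Sum>a<dim_row A. \<Sum>b<dim_col A. c j * (u a * A $$ (a, b) * f j b))"
    by (simp only: sum.swap[of _ J])
  finally show ?thesis by (simp add: qform_def sum_distrib_left)
qed

lemma qform_commute:
  assumes "A \<in> carrier_mat n n" "A\<^sup>T = A"
  shows "qform A u v = qform A v u"
proof -
  have "A $$ (j, i) = A $$ (i, j)" if "i < n" "j < n" for i j
    using assms that by (metis carrier_matD index_transpose_mat(1))
  then have "(\<Sum>a<n. \<Sum>b<n. u a * A $$ (a, b) * v b) = (\<Sum>a<n. \<Sum>b<n. v b * A $$ (b, a) * u a)"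
    by (intro sum.cong) auto
  then show ?thesis using assms(1) by (simp add: qform_def sum.swap[of "\<lambda>a b. v b * _ b a * u a"])
qed

lemma qform_indicator:
  assumes "A \<in> carrier_mat n m" "i < n" "j < m"
  shows "qform A (\<lambda>a. if a = i then 1 else 0) (\<lambda>b. if b = j then 1 else 0) = A $$ (i, j)"
proof -
  have "(\<Sum>b<m. (if a = i then 1 else 0) * A $$ (a, b) * (if b = j then 1 else 0))
      = (if a = i then A $$ (i, j) else 0)" for a
    using assms(3) by (cases "a = i") (simp_all add: if_distrib cong: if_cong)
  then show ?thesis using assms by (simp add: qform_def)
qed

lemma qform_congruence:
  assumes A: "A \<in> carrier_mat n n" and P: "P \<in> carrier_mat n m"
  shows "qform (P\<^sup>T * A * P) u v
    = qform A (\<lambda>a. \<Sum>i<m. P $$ (a, i) * u i) (\<lambda>b. \<Sum>j<m. P $$ (b, j) * v j)"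
proof -
  have e: "(P\<^sup>T * A * P) $$ (i, j) = (\<Sum>b<n. \<Sum>a<n. P $$ (a, i) * A $$ (a, b) * P $$ (b, j))"
    if "i < m" "j < m" for i j
  proof -
    have "(P\<^sup>T * A * P) $$ (i, j) = (\<Sum>b<n. (P\<^sup>T * A) $$ (i, b) * P $$ (b, j))"
      using that A P by (intro index_mult_mat_sum) auto
    also have "\<dots> = (\<Sum>b<n. (\<Sum>a<n. P\<^sup>T $$ (i, a) * A $$ (a, b)) * P $$ (b, j))"
      using that A P by (intro sum.cong refl arg_cong2[where f = "(*)"] index_mult_mat_sum) auto
    finally show ?thesis using that P by (simp add: sum_distrib_right)
  qed
  define M where "M = P\<^sup>T * A * P"
  have M: "M \<in> carrier_mat m m" using A P by (simp add: M_def)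
  have "qform M u v
      = (\<Sum>i<m. \<Sum>j<m. \<Sum>b<n. \<Sum>a<n. u i * P $$ (a, i) * A $$ (a, b) * P $$ (b, j) * v j)"
    using M by (simp add: qform_def e[folded M_def] sum_distrib_left sum_distrib_right mult_ac)
  also have "\<dots> = (\<Sum>a<n. \<Sum>b<n. \<Sum>i<m. \<Sum>j<m. u i * P $$ (a, i) * A $$ (a, b) * P $$ (b, j) * v j)"
    by (subst sum.swap[of _ "{..<m}" "{..<n}"], subst (2) sum.swap, subst sum.swap,
        subst (3) sum.swap, subst (2) sum.swap) (rule refl)
  also have "\<dots> = qform A (\<lambda>a. \<Sum>i<m. P $$ (a, i) * u i) (\<lambda>b. \<Sum>j<m. P $$ (b, j) * v j)"
    using A by (simp add: qform_def sum_product sum_distrib_left sum_distrib_right mult_ac)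
  finally show ?thesis by (simp only: M_def)
qed

section \<open>Cauchy-Schwarz for semidefinite forms and orthonormal bases\<close>

lemma quadratic_nonneg_discriminant:
  fixes p q r :: real
  assumes "\<And>x y. 0 \<le> x * (x * p + y * q) + y * (x * q + y * r)"
  shows "q\<^sup>2 \<le> p * r"
proof (cases "r = 0")
  case True
  have "q = 0"
  proof (rule ccontr)
    assume "q \<noteq> 0"
    \<comment> \<open>The form takes the value \<open>-1\<close> at this point, since
      \<open>r = 0\<close>.\<close>
    with assms[of 1 "- (p + 1) / (2 * q)"] True show False by (simp add: field_simps)
  qed
  then show ?thesis using True by simp
next
  case False
  have "r \<ge> 0" using assms[of 0 1] by simp
  with False have r: "r > 0" by simp
  have "0 \<le> r * (p * r - q\<^sup>2)" using assms[of r "- q"] by (simp add: algebra_simps power2_eq_square)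
  then show ?thesis using r by (simp add: zero_le_mult_iff)
qed

lemma psd_cauchy_schwarz:
  assumes "A \<in> carrier_mat n n" "A\<^sup>T = A" "psd A"
  shows "(qform A u v)\<^sup>2 \<le> qform A u u * qform A v v"
proof (rule quadratic_nonneg_discriminant)
  fix x y
  have "0 \<le> qform A (\<lambda>b. x * u b + y * v b) (\<lambda>b. x * u b + y * v b)"
    using assms(3) by (simp add: psd_def)
  then show "0 \<le> x * (x * qform A u u + y * qform A u v) + y * (x * qform A u v + y * qform A v v)"
    by (simp only: qform_left_linear qform_right_linear qform_commute[OF assms(1,2), of v u])
qed

lemma posdef_imp_psd: "posdef A \<Longrightarrow> psd A"
  unfolding posdef_def psd_def
proof
  fix u assume "\<forall>u. (\<exists>a<dim_row A. u a \<noteq> 0) \<longrightarrow> 0 < qform A u u"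
  then show "0 \<le> qform A u u"
    by (cases "\<exists>a<dim_row A. u a \<noteq> 0") (auto simp: qform_def less_imp_le)
qed

text \<open>Cauchy-Schwarz for two unit vectors bounds the square of the entry at
  \<open>(i, j)\<close> by the product of the diagonal entries at \<open>i\<close> and
  \<open>j\<close>; summed over all \<open>i\<close> and \<open>j\<close>, these products give the
  square of the trace.\<close>

lemma psd_frob_le_trace:
  assumes A: "A \<in> carrier_mat n n" "A\<^sup>T = A" "psd A"
  shows "frob A \<le> (mat_trace A)\<^sup>2" "mat_trace A \<ge> 0"
proof -
  have d: "A $$ (i, i) \<ge> 0" if "i < n" for i
    using A(3) qform_indicator[OF A(1) that that] unfolding psd_def by metis
  have "(A $$ (i, j))\<^sup>2 \<le> A $$ (i, i) * A $$ (j, j)" if "i < n" "j < n" for i j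
    using psd_cauchy_schwarz[OF A, of "\<lambda>a. if a = i then 1 else 0" "\<lambda>a. if a = j then 1 else 0"] that
    by (simp add: qform_indicator[OF A(1)])
  then have "frob A \<le> (\<Sum>i<n. \<Sum>j<n. A $$ (i, i) * A $$ (j, j))"
    using A(1) by (auto simp: frob_def intro!: sum_mono)
  also have "\<dots> = (mat_trace A)\<^sup>2"
    using A(1) by (simp add: mat_trace_def power2_eq_square sum_product)
  finally show "frob A \<le> (mat_trace A)\<^sup>2" .
  show "mat_trace A \<ge> 0" using A(1) d by (auto simp: mat_trace_def intro!: sum_nonneg)
qed

lemma psd_congruence:
  assumes "A \<in> carrier_mat n n" "P \<in> carrier_mat n m" "psd A"
  shows "psd (P\<^sup>T * A * P)"
  using assms(3) unfolding psd_def qform_congruence[OF assms(1,2)] by blast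

text \<open>Gram--Schmidt for the inner product of a positive definite matrix.\<close>

lemma posdef_orthonormal_basis:
  assumes A: "A \<in> carrier_mat n n" "A\<^sup>T = A" "posdef A"
  shows "k \<le> n \<Longrightarrow> \<exists>f. (\<forall>i<k. \<forall>j<k. qform A (f i) (f j) = (if i = j then 1 else 0))
    \<and> (\<forall>i<k. \<forall>l\<ge>k. f i l = 0)"
proof (induction k)
  case (Suc k)
  then obtain f where f: "\<And>i j. i < k \<Longrightarrow> j < k \<Longrightarrow> qform A (f i) (f j) = (if i = j then 1 else 0)"
    "\<And>i l. i < k \<Longrightarrow> l \<ge> k \<Longrightarrow> f i l = 0" by force
  define e :: "nat \<Rightarrow> real" where "e l = (if l = k then 1 else 0)" for l
  \<comment> \<open>The projections onto the earlier vectors are subtracted from the unit vector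
    \<open>e\<close>. The earlier vectors vanish from index \<open>k\<close> on, so
    \<open>w k = 1\<close> and \<open>w\<close> is nonzero. The factors \<open>1\<close> and
    \<open>- 1\<close>, like \<open>0 * w l\<close> further down, give the shape that the linearity
    lemmas for \<open>qform\<close> rewrite.\<close>
  define w where "w l = 1 * e l + (- 1) * (\<Sum>j<k. qform A (f j) e * f j l)" for l
  have w0: "w l = 0" if "l \<ge> Suc k" for l using that f(2) by (simp add: w_def e_def)
  have "w k = 1" using f(2) by (simp add: w_def e_def)
  then have pos: "qform A w w > 0" using A Suc.prems unfolding posdef_def
    by (metis Suc_le_lessD carrier_matD(1) zero_neq_one)
  have orth: "qform A (f i) w = 0" if i: "i < k" for i
  proof -
    have "qform A (f i) w = qform A (f i) e - (\<Sum>j<k. qform A (f j) e * qform A (f i) (f j))"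
      unfolding w_def by (simp only: qform_right_linear qform_right_sum)
    also have "(\<Sum>j<k. qform A (f j) e * qform A (f i) (f j)) = (\<Sum>j<k. if j = i then qform A (f i) e else 0)"
      using f(1) i by (intro sum.cong) auto
    finally show ?thesis using i by simp
  qed
  define c where "c = 1 / sqrt (qform A w w)"
  define g where "g = f(k := \<lambda>l. c * w l + 0 * w l)"
  have cc: "c * (c * qform A w w) = 1" using pos by (simp add: c_def power2_eq_square[symmetric] field_simps)
  have "qform A (g i) (g j) = (if i = j then 1 else 0)" if "i < Suc k" "j < Suc k" for i j
  proof -
    have "qform A (f i) (g k) = 0" "qform A (g k) (f i) = 0" if "i < k" for i
      unfolding g_def fun_upd_same qform_right_linear qform_left_linear
      using orth[OF that] qform_commute[OF A(1,2), of w "f i"] by simp_all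
    moreover have "qform A (g k) (g k) = 1"
      unfolding g_def fun_upd_same qform_right_linear qform_left_linear using cc by simp
    moreover have "i < k \<or> i = k" "j < k \<or> j = k" using that by auto
    moreover have "g i = f i" if "i < k" for i using that by (simp add: g_def)
    ultimately show ?thesis using f(1) by force
  qed
  moreover have "g i l = 0" if "i < Suc k" "l \<ge> Suc k" for i l
    using that f(2) w0 by (cases "i = k") (auto simp: g_def)
  ultimately show ?case by blast
qed auto

text \<open>The columns of \<open>P\<close> form an orthonormal basis for the form of
  \<open>A\<close>. \<open>P\<close> serves as an inverse square root: congruence by it turns
  \<open>A\<close> into the identity, and its inverse is \<open>P\<^sup>T * A\<close>. The sign of
  the determinant follows from \<open>det A * (det P)\<^sup>2 = 1\<close>.\<close>

lemma posdef_factor: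
  assumes A: "A \<in> carrier_mat n n" "A\<^sup>T = A" "posdef A"
  obtains P where "P \<in> carrier_mat n n" "P\<^sup>T * A * P = 1\<^sub>m n" "P * (P\<^sup>T * A) = 1\<^sub>m n"
    "det A > 0"
proof -
  obtain f where f: "\<And>i j. i < n \<Longrightarrow> j < n \<Longrightarrow> qform A (f i) (f j) = (if i = j then 1 else 0)"
    using posdef_orthonormal_basis[OF A, of n] by auto
  define P where "P = Matrix.mat n n (\<lambda>(a, j). f j a)"
  have P: "P \<in> carrier_mat n n" by (simp add: P_def)
  have PAP: "P\<^sup>T * A * P = 1\<^sub>m n"
  proof (rule eq_matI)
    fix i j assume "i < dim_row (1\<^sub>m n :: real mat)" "j < dim_col (1\<^sub>m n :: real mat)"
    then have ij: "i < n" "j < n" by auto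
    have cl: "(\<Sum>i<n. P $$ (a, i) * (if i = k then 1 else 0)) = f k a" if "a < n" "k < n" for a k
      using that by (simp add: P_def if_distrib cong: if_cong)
    have "(P\<^sup>T * A * P) $$ (i, j) = qform (P\<^sup>T * A * P) (\<lambda>a. if a = i then 1 else 0) (\<lambda>b. if b = j then 1 else 0)"
      using ij A P by (intro qform_indicator[symmetric, of _ n n]) auto
    also have "\<dots> = qform A (f i) (f j)"
      unfolding qform_congruence[OF A(1) P] unfolding qform_def using A(1) ij cl
      by (intro sum.cong) auto
    finally show "(P\<^sup>T * A * P) $$ (i, j) = 1\<^sub>m n $$ (i, j)" using f ij by simp
  qed (use A P in auto)
  have PA: "P\<^sup>T * A \<in> carrier_mat n n" using A P by auto
  have "det P * det A * det P = 1"
    using arg_cong[OF PAP, of det] det_mult[OF PA P] det_mult[OF _ A(1), of "P\<^sup>T"] det_transpose[OF P] P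
    by simp
  then have "det A * (det P)\<^sup>2 = 1" by (simp add: power2_eq_square mult_ac)
  then have "det A > 0"
    using zero_less_mult_iff[of "det A" "(det P)\<^sup>2"] by (simp add: not_less[symmetric])
  moreover have "P * (P\<^sup>T * A) = 1\<^sub>m n" by (rule mat_mult_left_right_inverse[OF PA P PAP])
  ultimately show thesis using that P PAP by blast
qed

lemma qform_cong:
  fixes u u' v v' :: "nat \<Rightarrow> real"
  assumes "\<And>a. a < dim_row A \<Longrightarrow> u a = u' a" "\<And>b. b < dim_col A \<Longrightarrow> v b = v' b"
  shows "qform A u v = qform A u' v'"
  unfolding qform_def using assms by (intro sum.cong) auto

lemma qform_le_frob:
  assumes "A \<in> carrier_mat n m"
  shows "(qform A u v)\<^sup>2 \<le> frob A * ((\<Sum>a<n. (u a)\<^sup>2) * (\<Sum>b<m. (v b)\<^sup>2))"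
  using sum_sum_cauchy_schwarz[of "\<lambda>a b. A $$ (a, b)" "\<lambda>a b. u a * v b" m n] assms
  by (simp add: qform_def frob_def power_mult_distrib sum_product mult_ac)

text \<open>By Cauchy-Schwarz a vector on which a semidefinite form vanishes is orthogonal to
  everything, hence lies in the kernel. This places the maximiser of the determinant in the interior
  of the cone.\<close>

lemma psd_nonsingular_imp_posdef:
  assumes A: "A \<in> carrier_mat n n" "A\<^sup>T = A" "psd A" and det: "det A \<noteq> 0"
  shows "posdef A"
  unfolding posdef_def
proof (intro allI impI)
  fix u :: "nat \<Rightarrow> real" assume "\<exists>a<dim_row A. u a \<noteq> 0"
  then obtain a where a: "a < n" "u a \<noteq> 0" using A by auto
  show "0 < qform A u u"
  proof (rule ccontr)
    assume "\<not> 0 < qform A u u"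
    then have "qform A u u = 0" using A(3) by (auto simp: psd_def order.eq_iff not_less)
    then have z: "qform A v u = 0" for v using psd_cauchy_schwarz[OF A, of v u] by simp
    define x where "x = Matrix.vec n u"
    have "A *\<^sub>v x = 0\<^sub>v n"
    proof (rule eq_vecI)
      fix i assume "i < dim_vec (0\<^sub>v n :: real vec)"
      then have i: "i < n" by simp
      have "(\<Sum>b<n. (if a = i then 1 else 0) * A $$ (a, b) * u b) = (if a = i then \<Sum>b<n. A $$ (i, b) * u b else 0)" for a
        by simp
      then have "qform A (\<lambda>a. if a = i then 1 else 0) u = (\<Sum>b<n. A $$ (i, b) * u b)"
        using A(1) i by (simp add: qform_def)
      then show "(A *\<^sub>v x) $ i = 0\<^sub>v n $ i"
        using z A(1) i by (simp add: x_def scalar_prod_def atLeast0LessThan)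
    qed (use A in auto)
    moreover have "x \<noteq> 0\<^sub>v n"
    proof
      assume "x = 0\<^sub>v n"
      then have "x $ a = 0" using a by simp
      then show False using a by (simp add: x_def)
    qed
    moreover have "x \<in> carrier_vec n" by (simp add: x_def)
    ultimately have "det A = 0" unfolding det_0_iff_vec_prod_zero[OF A(1)] by blast
    with det show False by simp
  qed
qed

text \<open>The square of the local norm of \<open>- ln det\<close> at the inverse of \<open>Xi\<close>.\<close>

definition lnorm2 :: "real mat \<Rightarrow> real mat \<Rightarrow> real" where
  "lnorm2 Xi V = mat_trace (Xi * V * (Xi * V))"

section \<open>Local norms and Dikin ellipsoids\<close>

lemma posdef_inverse_factor:
  assumes X: "X \<in> carrier_mat n n" "X\<^sup>T = X" "posdef X" and Xi: "Xi \<in> carrier_mat n n" "Xi * X = 1\<^sub>m n"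
  obtains P where "P \<in> carrier_mat n n" "P\<^sup>T * X * P = 1\<^sub>m n" "P * (P\<^sup>T * X) = 1\<^sub>m n" "Xi = P * P\<^sup>T"
proof -
  obtain P where P: "P \<in> carrier_mat n n" "P\<^sup>T * X * P = 1\<^sub>m n" "P * (P\<^sup>T * X) = 1\<^sub>m n"
    using posdef_factor[OF X] by metis
  have PP: "P * P\<^sup>T \<in> carrier_mat n n" using P by simp
  have "P * P\<^sup>T * X = 1\<^sub>m n" using P X by (simp add: assoc_mult_mat[of _ n n _ n _ n])
  then have "X * (P * P\<^sup>T) = 1\<^sub>m n" by (rule mat_mult_left_right_inverse[OF PP X(1)])
  then have "Xi = Xi * (X * (P * P\<^sup>T))" using Xi by simp
  also have "\<dots> = Xi * X * (P * P\<^sup>T)" using Xi X PP by (intro assoc_mult_mat[symmetric]) auto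
  also have "\<dots> = P * P\<^sup>T" unfolding Xi(2) by (rule left_mult_one_mat[OF PP])
  finally show thesis using that P by blast
qed

text \<open>Cyclicity of the trace moves the outer factor \<open>P\<close> to the right. In
  coordinates in which the base point becomes the identity, the local norm is the Frobenius
  norm.\<close>

lemma lnorm2_eq_frob:
  assumes P: "P \<in> carrier_mat n n" and V: "V \<in> carrier_mat n n" "V\<^sup>T = V"
  shows "lnorm2 (P * P\<^sup>T) V = frob (P\<^sup>T * V * P)"
proof -
  define M where "M = P\<^sup>T * V * P"
  have M: "M \<in> carrier_mat n n" "M\<^sup>T = M"
    using P V by (auto simp: M_def transpose_mult[of _ n n _ n] assoc_mult_mat[of _ n n _ n _ n])
  have "P * P\<^sup>T * V * (P * P\<^sup>T * V) = P * (M * (P\<^sup>T * V))"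
    using P V by (simp add: M_def assoc_mult_mat[of _ n n _ n _ n])
  then have "lnorm2 (P * P\<^sup>T) V = mat_trace (M * (P\<^sup>T * V) * P)"
    unfolding lnorm2_def using P V M by (simp add: mat_trace_comm[of P n n])
  also have "M * (P\<^sup>T * V) * P = M * M"
    using P V M(1) by (simp add: M_def assoc_mult_mat[of _ n n _ n _ n])
  finally show ?thesis using frob_eq_trace[OF M] by (simp add: M_def)
qed

lemma lnorm2_nonneg:
  assumes "X \<in> carrier_mat n n" "X\<^sup>T = X" "posdef X" "Xi \<in> carrier_mat n n" "Xi * X = 1\<^sub>m n"
    "V \<in> carrier_mat n n" "V\<^sup>T = V"
  shows "lnorm2 Xi V \<ge> 0"
  using posdef_inverse_factor[OF assms(1-5)] lnorm2_eq_frob[OF _ assms(6,7)] frob_nonneg by metis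

text \<open>The unit Dikin ellipsoid lies in the semidefinite cone: congruence by \<open>P\<close>
  turns \<open>X + V\<close> into the identity plus \<open>M\<close>, and the form of
  \<open>M\<close> is at most its Frobenius norm times the squared length.\<close>

lemma posdef_perturbation:
  assumes X: "X \<in> carrier_mat n n" "X\<^sup>T = X" "posdef X" and Xi: "Xi \<in> carrier_mat n n" "Xi * X = 1\<^sub>m n"
    and V: "V \<in> carrier_mat n n" "V\<^sup>T = V"
  shows "lnorm2 Xi V \<le> 1 \<Longrightarrow> psd (X + V)" and "lnorm2 Xi V < 1 \<Longrightarrow> posdef (X + V)"
proof -
  obtain P where P: "P \<in> carrier_mat n n" "P\<^sup>T * X * P = 1\<^sub>m n" "P * (P\<^sup>T * X) = 1\<^sub>m n" "Xi = P * P\<^sup>T"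
    using posdef_inverse_factor[OF X Xi] by metis
  define M where "M = P\<^sup>T * V * P"
  have M: "M \<in> carrier_mat n n" using P V by (simp add: M_def)
  have ln: "lnorm2 Xi V = frob M" unfolding P(4) M_def by (rule lnorm2_eq_frob[OF P(1) V])
  have XV: "X + V \<in> carrier_mat n n" using X V by simp
  have cong: "P\<^sup>T * (X + V) * P = 1\<^sub>m n + M"
    using P X V by (simp add: M_def mult_add_distrib_mat[of _ n n] add_mult_distrib_mat[of _ n n])
  have PX: "P\<^sup>T * X \<in> carrier_mat n n" using P X by simp
  have key: "\<exists>u. (\<forall>a<n. v a = (\<Sum>i<n. P $$ (a, i) * u i))
      \<and> qform (X + V) v v = (\<Sum>i<n. (u i)\<^sup>2) + qform M u u" for v
  proof -
    \<comment> \<open>These are the coordinates of \<open>v\<close> with respect to the columns of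
      \<open>P\<close>, the inverse of \<open>P\<close> being \<open>P\<^sup>T * X\<close>.\<close>
    define u where "u i = (\<Sum>b<n. (P\<^sup>T * X) $$ (i, b) * v b)" for i
    have v: "v a = (\<Sum>i<n. P $$ (a, i) * u i)" if a: "a < n" for a
    proof -
      have "(\<Sum>i<n. P $$ (a, i) * u i) = (\<Sum>b<n. (\<Sum>i<n. P $$ (a, i) * (P\<^sup>T * X) $$ (i, b)) * v b)"
        unfolding u_def sum_distrib_left sum_distrib_right by (subst sum.swap) (simp add: mult.assoc)
      also have "\<dots> = (\<Sum>b<n. (P * (P\<^sup>T * X)) $$ (a, b) * v b)"
        using index_mult_mat_sum[OF P(1) PX a] by (intro sum.cong) auto
      also have "\<dots> = (\<Sum>b<n. if b = a then v b else 0)"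
        unfolding P(3) using a by (intro sum.cong) auto
      finally show ?thesis using a by simp
    qed
    have "qform (X + V) v v = qform (P\<^sup>T * (X + V) * P) u u"
      unfolding qform_congruence[OF XV P(1)] using XV v by (intro qform_cong) auto
    also have "\<dots> = (\<Sum>i<n. (u i)\<^sup>2) + qform M u u"
      unfolding cong using M by (simp add: qform_add[of _ n n] qform_one power2_eq_square)
    finally show ?thesis using v by blast
  qed
  have bound: "\<bar>qform M u u\<bar> \<le> sqrt (frob M) * (\<Sum>i<n. (u i)\<^sup>2)" for u
  proof -
    have "(qform M u u)\<^sup>2 \<le> (sqrt (frob M) * (\<Sum>i<n. (u i)\<^sup>2))\<^sup>2"
      using qform_le_frob[OF M, of u u] frob_nonneg[of M]
      by (simp add: power_mult_distrib power2_eq_square[of "sum _ _"])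
    then have "\<bar>qform M u u\<bar> \<le> \<bar>sqrt (frob M) * (\<Sum>i<n. (u i)\<^sup>2)\<bar>"
      by (rule abs_le_square_iff[THEN iffD2])
    then show ?thesis using frob_nonneg[of M] by (simp add: abs_mult sum_nonneg)
  qed
  show "psd (X + V)" if "lnorm2 Xi V \<le> 1"
    unfolding psd_def
  proof
    fix v
    obtain u where u: "qform (X + V) v v = (\<Sum>i<n. (u i)\<^sup>2) + qform M u u" using key by blast
    have "sqrt (frob M) * (\<Sum>i<n. (u i)\<^sup>2) \<le> 1 * (\<Sum>i<n. (u i)\<^sup>2)"
      using that ln by (intro mult_right_mono sum_nonneg) auto
    then show "0 \<le> qform (X + V) v v" using u bound[of u] by linarith
  qed
  show "posdef (X + V)" if "lnorm2 Xi V < 1"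
    unfolding posdef_def
  proof (intro allI impI)
    fix v :: "nat \<Rightarrow> real" assume "\<exists>a<dim_row (X + V). v a \<noteq> 0"
    then obtain a where a: "a < n" "v a \<noteq> 0" using XV by auto
    obtain u where u: "\<forall>a<n. v a = (\<Sum>i<n. P $$ (a, i) * u i)"
      "qform (X + V) v v = (\<Sum>i<n. (u i)\<^sup>2) + qform M u u" using key by blast
    have "(\<Sum>i<n. (u i)\<^sup>2) \<noteq> 0"
    proof
      assume "(\<Sum>i<n. (u i)\<^sup>2) = 0"
      then have "u i = 0" if "i < n" for i using that by (simp add: sum_nonneg_eq_0_iff)
      then show False using u(1) a by simp
    qed
    then have "(\<Sum>i<n. (u i)\<^sup>2) > 0" using sum_nonneg[of "{..<n}" "\<lambda>i. (u i)\<^sup>2"] by force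
    then have "sqrt (frob M) * (\<Sum>i<n. (u i)\<^sup>2) < 1 * (\<Sum>i<n. (u i)\<^sup>2)"
      using that ln by (intro mult_strict_right_mono) auto
    then show "0 < qform (X + V) v v" using u(2) bound[of u] by linarith
  qed
qed

text \<open>The Frobenius norm of a positive semidefinite matrix is at most its trace; this is applied to
  congruent copies of \<open>A + B\<close> and \<open>A - B\<close>.\<close>

lemma lnorm2_sandwich:
  assumes X: "X \<in> carrier_mat n n" "X\<^sup>T = X" "posdef X" and Xi: "Xi \<in> carrier_mat n n" "Xi * X = 1\<^sub>m n"
    and A: "A \<in> carrier_mat n n" "A\<^sup>T = A" and B: "B \<in> carrier_mat n n" "B\<^sup>T = B"
    and psd: "psd (A + B)" "psd (A - B)"
  shows "lnorm2 Xi B \<le> 2 * (mat_trace (Xi * A))\<^sup>2"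
proof -
  obtain P where P: "P \<in> carrier_mat n n" "Xi = P * P\<^sup>T"
    using posdef_inverse_factor[OF X Xi] by metis
  define f where "f C = P\<^sup>T * C * P" for C
  have f: "f C \<in> carrier_mat n n" if "C \<in> carrier_mat n n" for C using that P by (simp add: f_def)
  have fs: "(f C)\<^sup>T = f C" if "C \<in> carrier_mat n n" "C\<^sup>T = C" for C
    using that P by (simp add: f_def transpose_mult[of _ n n _ n] assoc_mult_mat[of _ n n _ n _ n])
  have ft: "mat_trace (f C) = mat_trace (Xi * C)" if C: "C \<in> carrier_mat n n" for C
  proof -
    have "mat_trace (Xi * C) = mat_trace (P * (P\<^sup>T * C))"
      using P C by (simp add: assoc_mult_mat[of _ n n _ n _ n])
    then show ?thesis using P C by (simp add: mat_trace_comm[of P n n] f_def)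
  qed
  have AB: "A + B \<in> carrier_mat n n" "(A + B)\<^sup>T = A + B" "A - B \<in> carrier_mat n n" "(A - B)\<^sup>T = A - B"
    using A B by (auto simp: transpose_add[of _ n n] transpose_minus[of _ n n])
  have fa: "f (A + B) = f A + f B" "f (A - B) = f A - f B"
    using A B P by (simp_all add: f_def mult_add_distrib_mat[of _ n n] add_mult_distrib_mat[of _ n n]
      mult_minus_distrib_mat[of _ n n] minus_mult_distrib_mat[of _ n n])
  define a where "a = mat_trace (f A)"
  define b where "b = mat_trace (f B)"
  note fA = f[OF A(1)] and fB = f[OF B(1)]
  have "psd (f (A + B))" "psd (f (A - B))"
    unfolding f_def using psd_congruence[OF AB(1) P(1) psd(1)] psd_congruence[OF AB(3) P(1) psd(2)] by auto
  note p = psd_frob_le_trace[OF f[OF AB(1)] fs[OF AB(1,2)] this(1)]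
    and m = psd_frob_le_trace[OF f[OF AB(3)] fs[OF AB(3,4)] this(2)]
  have t: "mat_trace (f (A + B)) = a + b" "mat_trace (f (A - B)) = a - b"
    unfolding fa a_def b_def using fA fB by (simp_all add: mat_trace_add[of _ n] mat_trace_minus[of _ n])
  have "lnorm2 Xi B = frob (f B)" unfolding P(2) f_def by (rule lnorm2_eq_frob[OF P(1) B])
  also have "\<dots> \<le> (frob (f A + f B) + frob (f A - f B)) / 2"
  proof -
    \<comment> \<open>Parallelogram identity, with the square of the entry of \<open>f A\<close>
      dropped. It transfers the bounds for the two semidefinite matrices to
      \<open>f B\<close>.\<close>
    have "2 * (f B $$ (i, j))\<^sup>2 \<le> ((f A + f B) $$ (i, j))\<^sup>2 + ((f A - f B) $$ (i, j))\<^sup>2"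
      if "i < n" "j < n" for i j
      using that fA fB by (simp add: power2_sum power2_diff)
    then have "(\<Sum>i<n. \<Sum>j<n. 2 * (f B $$ (i, j))\<^sup>2)
        \<le> (\<Sum>i<n. \<Sum>j<n. ((f A + f B) $$ (i, j))\<^sup>2 + ((f A - f B) $$ (i, j))\<^sup>2)"
      by (intro sum_mono) auto
    also have "\<dots> = frob (f A + f B) + frob (f A - f B)"
      using fA fB unfolding frob_def by (simp add: sum.distrib del: index_add_mat(1) index_minus_mat(1))
    finally have "2 * frob (f B) \<le> frob (f A + f B) + frob (f A - f B)"
      using fB unfolding frob_def sum_distrib_left by simp
    then show ?thesis by simp
  qed
  also have "\<dots> \<le> ((a + b)\<^sup>2 + (a - b)\<^sup>2) / 2"
    using p(1)[unfolded t] m(1)[unfolded t] unfolding fa by simp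
  also have "\<dots> \<le> 2 * a\<^sup>2"
  proof -
    \<comment> \<open>Both \<open>a + b\<close> and \<open>a - b\<close> are traces of semidefinite
      matrices, hence nonnegative. The average of their squares is
      \<open>a\<^sup>2 + b\<^sup>2\<close>, and this is where the factor 2 arises.\<close>
    have "\<bar>b\<bar> \<le> \<bar>a\<bar>" using p(2) m(2) unfolding t by linarith
    then have "b\<^sup>2 \<le> a\<^sup>2" by (rule abs_le_square_iff[THEN iffD1])
    then show ?thesis by (simp add: power2_sum power2_diff)
  qed
  finally show ?thesis using ft[OF A(1)] by (simp add: a_def)
qed

text \<open>Conjugation by the factor of \<open>X\<close> makes the trace an inner product of
  \<open>R\<close> and \<open>M\<close>, to which Cauchy-Schwarz applies. \<open>M\<close> measures
  \<open>W\<close> at \<open>X\<close>. The squared norm of \<open>R\<close> is the trace of the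
  square of \<open>G * X\<close>, and \<open>G * X = Yi * (X - Y)\<close>, so the difference of the
  base points is measured at \<open>Y\<close> instead. The certificate estimate rests on this
  mixture of base points.\<close>

lemma inverse_perturbation:
  assumes X: "X \<in> carrier_mat n n" "X\<^sup>T = X" "posdef X" and Xi: "Xi \<in> carrier_mat n n" "Xi * X = 1\<^sub>m n"
    and Y: "Y \<in> carrier_mat n n" "Y\<^sup>T = Y" and Yi: "Yi \<in> carrier_mat n n" "Yi * Y = 1\<^sub>m n"
    and W: "W \<in> carrier_mat n n" "W\<^sup>T = W"
  shows "(mat_trace ((Yi - Xi) * W))\<^sup>2 \<le> lnorm2 Yi (X - Y) * lnorm2 Xi W"
proof -
  obtain P where P: "P \<in> carrier_mat n n" "P\<^sup>T * X * P = 1\<^sub>m n" "P * (P\<^sup>T * X) = 1\<^sub>m n" "Xi = P * P\<^sup>T"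
    using posdef_inverse_factor[OF X Xi] by metis
  note as = assoc_mult_mat[of _ n n _ n _ n]
  have YYi: "Y * Yi = 1\<^sub>m n" by (rule mat_mult_left_right_inverse[OF Yi(1) Y(1) Yi(2)])
  have "Yi\<^sup>T * Y = 1\<^sub>m n" using arg_cong[OF YYi, of transpose_mat] Y Yi by (simp add: transpose_mult[of _ n n _ n])
  then have YiT: "Yi\<^sup>T = Yi"
    using Yi YYi Y(1) by (metis assoc_mult_mat left_mult_one_mat right_mult_one_mat transpose_carrier_mat)
  have XiT: "Xi\<^sup>T = Xi" using P(1) by (simp add: P(4) transpose_mult[of _ n n _ n])
  define G where "G = Yi - Xi"
  have G: "G \<in> carrier_mat n n" "G\<^sup>T = G" using Yi Xi YiT XiT by (auto simp: G_def transpose_minus[of _ n n])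
  define Q where "Q = P\<^sup>T * X"
  have Q: "Q \<in> carrier_mat n n" "Q * P = 1\<^sub>m n" "P * Q = 1\<^sub>m n" "Q\<^sup>T = X * P"
    using P X by (auto simp: Q_def transpose_mult[of _ n n _ n])
  have QP: "Q\<^sup>T * P\<^sup>T = 1\<^sub>m n" using arg_cong[OF Q(3), of transpose_mat] P(1) Q(1) by (simp add: transpose_mult[of _ n n _ n])
  define R where "R = Q * G * Q\<^sup>T"
  have R: "R \<in> carrier_mat n n" "R\<^sup>T = R"
    using Q(1) G by (auto simp: R_def transpose_mult[of _ n n _ n] as)
  define M where "M = P\<^sup>T * W * P"
  have M: "M \<in> carrier_mat n n" "M\<^sup>T = M"
    using P(1) W by (auto simp: M_def transpose_mult[of _ n n _ n] as)
  have PR: "P * R * P\<^sup>T = G"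
  proof -
    have "P * R * P\<^sup>T = (P * Q) * G * (Q\<^sup>T * P\<^sup>T)" using P(1) Q(1) G(1) by (simp add: R_def as)
    then show ?thesis using G(1) by (simp add: Q(3) QP)
  qed
  define Z where "Z = Yi * (X - Y)"
  have Z: "Z \<in> carrier_mat n n" unfolding Z_def using Yi(1) Y(1) by (intro mult_carrier_mat[of _ n n] minus_carrier_mat) auto
  have GX: "G * X = Z"
    using X Y Yi Xi by (simp add: G_def Z_def minus_mult_distrib_mat[of _ n n] mult_minus_distrib_mat[of _ n n])
  have RZ: "R = Q * Z * P" unfolding R_def Q(4) using Q(1) G(1) X(1) P(1) GX[symmetric] by (simp add: as)
  have "mat_trace (G * W) = mat_trace (P * (R * (P\<^sup>T * W)))"
    unfolding PR[symmetric] using P(1) R(1) W(1) by (simp add: as)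
  also have "\<dots> = mat_trace (R * (P\<^sup>T * W) * P)" using P(1) R(1) W(1) by (intro mat_trace_comm[of _ n n]) auto
  also have "R * (P\<^sup>T * W) * P = R * M" using P(1) R(1) W(1) by (simp add: M_def as)
  finally have "(mat_trace (G * W))\<^sup>2 \<le> frob R * frob M"
    using mat_trace_mult_cauchy_schwarz[OF R(1) M] by simp
  also have "frob M = lnorm2 Xi W" unfolding P(4) M_def by (rule lnorm2_eq_frob[OF P(1) W, symmetric])
  also have "frob R = lnorm2 Yi (X - Y)"
  proof -
    have "R * R = Q * Z * (P * Q) * Z * P" unfolding RZ using Q(1) Z P(1) by (simp add: as)
    also have "\<dots> = Q * (Z * Z * P)" unfolding Q(3) using Q(1) Z P(1) by (simp add: as)
    finally have "frob R = mat_trace (Q * (Z * Z * P))" unfolding frob_eq_trace[OF R] by simp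
    also have "\<dots> = mat_trace (Z * Z * P * Q)" using Q(1) Z P(1) by (intro mat_trace_comm[of _ n n]) auto
    also have "Z * Z * P * Q = Z * Z * (P * Q)" using Q(1) Z P(1) by (simp add: as)
    finally show ?thesis
      unfolding Q(3) right_mult_one_mat[OF mult_carrier_mat[OF Z Z]] by (simp add: lnorm2_def Z_def)
  qed
  finally show ?thesis by (simp add: G_def)
qed

subsection \<open>Derivatives of the logarithmic determinant\<close>

lemma permutes_lessThan_less: "(p :: nat \<Rightarrow> nat) permutes {0..<n} \<Longrightarrow> i < n \<Longrightarrow> p i < n"
  using permutes_in_image[of p "{0..<n}" i] by simp

lemma continuous_det_line:
  fixes A E :: "real mat"
  assumes "A \<in> carrier_mat n n" "E \<in> carrier_mat n n"
  shows "isCont (\<lambda>h::real. det (A + h \<cdot>\<^sub>m E)) x"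
proof -
  have AE: "A + h \<cdot>\<^sub>m E \<in> carrier_mat n n" for h using assms by simp
  have "(\<lambda>h. det (A + h \<cdot>\<^sub>m E)) = (\<lambda>h. \<Sum>p\<in>{p. p permutes {0..<n}}.
      signof p * (\<Prod>i = 0..<n. A $$ (i, p i) + h * E $$ (i, p i)))"
    unfolding det_def'[OF AE]
    using assms by (intro ext sum.cong refl arg_cong2[where f = "(*)"] prod.cong) (auto simp: permutes_lessThan_less)
  then show ?thesis by (simp only: isCont_def) (intro tendsto_intros)
qed

text \<open>A permutation other than the identity moves at least two indices, so its Leibniz product
  has two factors that vanish at 0 and contributes nothing to the derivative.\<close>

lemma det_one_plus_deriv:
  assumes F: "F \<in> carrier_mat n n"
  shows "((\<lambda>h. det (1\<^sub>m n + h \<cdot>\<^sub>m F)) has_field_derivative mat_trace F) (at 0)"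
proof -
  let ?S = "{p. p permutes {0..<n}}"
  let ?g = "\<lambda>p i h. (if p i = i then 1 else 0) + h * F $$ (i, p i)"
  have C: "1\<^sub>m n + h \<cdot>\<^sub>m F \<in> carrier_mat n n" for h using F by simp
  have eq: "(\<lambda>h. det (1\<^sub>m n + h \<cdot>\<^sub>m F)) = (\<lambda>h. \<Sum>p\<in>?S. signof p * (\<Prod>i = 0..<n. ?g p i h))"
    unfolding det_def'[OF C]
    using F by (intro ext sum.cong refl arg_cong2[where f = "(*)"] prod.cong) (auto simp: permutes_lessThan_less)
  have fin: "finite ?S" by (rule finite_permutations) simp
  have "((\<lambda>h. \<Sum>p\<in>?S. signof p * (\<Prod>i = 0..<n. ?g p i h)) has_field_derivative
      (\<Sum>p\<in>?S. signof p * (\<Sum>i = 0..<n. F $$ (i, p i) * (\<Prod>j\<in>{0..<n} - {i}. ?g p j 0)))) (at 0)"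
    by (intro DERIV_sum DERIV_cmult has_field_derivative_prod) (auto intro!: derivative_eq_intros)
  also have "(\<Sum>p\<in>?S. signof p * (\<Sum>i = 0..<n. F $$ (i, p i) * (\<Prod>j\<in>{0..<n} - {i}. ?g p j 0)))
      = (\<Sum>p\<in>?S. if p = id then mat_trace F else 0)"
  proof (rule sum.cong[OF refl])
    fix p assume p: "p \<in> ?S"
    show "signof p * (\<Sum>i = 0..<n. F $$ (i, p i) * (\<Prod>j\<in>{0..<n} - {i}. ?g p j 0))
        = (if p = id then mat_trace F else 0)"
    proof (cases "p = id")
      case True
      then show ?thesis using F by (simp add: mat_trace_def atLeast0LessThan)
    next
      case False
      then obtain a where a: "p a \<noteq> a" by (auto simp: fun_eq_iff)
      have an: "a < n" using p a by (metis atLeast0LessThan lessThan_iff mem_Collect_eq permutes_not_in)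
      have inj: "inj p" using p by (auto intro: permutes_inj)
      have pa: "p a < n" using p an by (auto simp: permutes_lessThan_less)
      have ppa: "p (p a) \<noteq> p a" using a inj by (auto dest: injD)
      have pz: "(\<Prod>j\<in>{0..<n} - {i}. ?g p j 0) = 0" for i
      proof (rule prod_zero)
        show "\<exists>j\<in>{0..<n} - {i}. ?g p j 0 = 0"
          using a an pa ppa by (cases "i = a") (auto intro: bexI[of _ "p a"] bexI[of _ a])
      qed simp
      then show ?thesis using False by (simp only: pz mult_zero_right sum.neutral_const if_False)
    qed
  qed
  also have "\<dots> = mat_trace F" using fin by (simp add: permutes_id)
  finally show ?thesis unfolding eq .
qed

text \<open>Jacobi's formula, reduced to the identity matrix by the factorisation
  \<open>X + h E = X (1 + h Xi E)\<close>.\<close>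

lemma det_line_deriv:
  assumes X: "X \<in> carrier_mat n n" and E: "E \<in> carrier_mat n n"
    and Xi: "Xi \<in> carrier_mat n n" "X * Xi = 1\<^sub>m n"
  shows "((\<lambda>h. det (X + h \<cdot>\<^sub>m E)) has_field_derivative det X * mat_trace (Xi * E)) (at 0)"
proof -
  have F: "Xi * E \<in> carrier_mat n n" using Xi E by simp
  have "X + h \<cdot>\<^sub>m E = X * (1\<^sub>m n + h \<cdot>\<^sub>m (Xi * E))" for h
  proof -
    have "X * (1\<^sub>m n + h \<cdot>\<^sub>m (Xi * E)) = X * 1\<^sub>m n + X * (h \<cdot>\<^sub>m (Xi * E))"
      using X F by (intro mult_add_distrib_mat) auto
    also have "X * (h \<cdot>\<^sub>m (Xi * E)) = h \<cdot>\<^sub>m (X * (Xi * E))"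
      by (rule mult_smult_distrib[OF X F])
    also have "X * (Xi * E) = E"
      unfolding assoc_mult_mat[OF X Xi(1) E, symmetric] Xi(2) by (rule left_mult_one_mat[OF E])
    finally show ?thesis using X by simp
  qed
  then have "(\<lambda>h. det (X + h \<cdot>\<^sub>m E)) = (\<lambda>h. det X * det (1\<^sub>m n + h \<cdot>\<^sub>m (Xi * E)))"
    using det_mult[OF X, of "1\<^sub>m n + _ \<cdot>\<^sub>m (Xi * E)"] F by (simp add: fun_eq_iff)
  then show ?thesis using DERIV_cmult[OF det_one_plus_deriv[OF F]] by simp
qed

text \<open>The adjugate formula makes each entry a quotient of determinants, so that continuity of
  the inverse along a line follows from continuity of determinants.\<close>

definition minv :: "real mat \<Rightarrow> real mat" where
  "minv A = (1 / det A) \<cdot>\<^sub>m adj_mat A"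

lemma minv_carrier: "A \<in> carrier_mat n n \<Longrightarrow> minv A \<in> carrier_mat n n"
  by (simp add: minv_def adj_mat(1))

lemma minv:
  assumes "A \<in> carrier_mat n n" "det A \<noteq> 0"
  shows "A * minv A = 1\<^sub>m n" "minv A * A = 1\<^sub>m n"
proof -
  note adj = adj_mat[OF assms(1)]
  have one: "(1 / det A) \<cdot>\<^sub>m (det A \<cdot>\<^sub>m 1\<^sub>m n) = 1\<^sub>m n"
    using assms(2) by (intro eq_matI) auto
  have "A * minv A = (1 / det A) \<cdot>\<^sub>m (A * adj_mat A)"
    unfolding minv_def by (rule mult_smult_distrib[OF assms(1) adj(1)])
  then show "A * minv A = 1\<^sub>m n" unfolding adj(2) one .
  have "minv A * A = (1 / det A) \<cdot>\<^sub>m (adj_mat A * A)"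
    unfolding minv_def by (rule mult_smult_assoc_mat[OF adj(1) assms(1)])
  then show "minv A * A = 1\<^sub>m n" unfolding adj(3) one .
qed

lemma continuous_minv_line:
  assumes A: "A \<in> carrier_mat n n" and E: "E \<in> carrier_mat n n" and d: "det A \<noteq> 0"
    and ij: "i < n" "j < n"
  shows "isCont (\<lambda>h. minv (A + h \<cdot>\<^sub>m E) $$ (i, j)) 0"
proof -
  have md: "mat_delete (A + h \<cdot>\<^sub>m E) j i = mat_delete A j i + h \<cdot>\<^sub>m mat_delete E j i" for h
    using A E by (intro eq_matI) (auto simp: mat_delete_def)
  have "A + 0 \<cdot>\<^sub>m E = A" using A E by (intro eq_matI) auto
  then have d0: "det (A + 0 \<cdot>\<^sub>m E) \<noteq> 0" using d by simp
  have "(\<lambda>h. minv (A + h \<cdot>\<^sub>m E) $$ (i, j)) = (\<lambda>h. 1 / det (A + h \<cdot>\<^sub>m E)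
      * ((- 1) ^ (j + i) * det (mat_delete A j i + h \<cdot>\<^sub>m mat_delete E j i)))"
    using A E ij by (simp add: minv_def adj_mat_def cofactor_def md)
  then show ?thesis
    using d0 continuous_det_line[OF mat_delete_carrier[OF A] mat_delete_carrier[OF E]]
      continuous_det_line[OF A E]
    by (simp only:) (intro isCont_mult isCont_divide continuous_const, auto)
qed

lemma continuous_trace_minv_line:
  assumes A: "A \<in> carrier_mat n n" and E: "E \<in> carrier_mat n n" and d: "det A \<noteq> 0"
    and G: "G \<in> carrier_mat n n"
  shows "isCont (\<lambda>h. mat_trace (minv (A + h \<cdot>\<^sub>m E) * G)) 0"
proof -
  have C: "minv (A + h \<cdot>\<^sub>m E) \<in> carrier_mat n n" for h using A E by (intro minv_carrier) simp
  have "isCont (\<lambda>h. \<Sum>i<n. \<Sum>j<n. minv (A + h \<cdot>\<^sub>m E) $$ (i, j) * G $$ (j, i)) 0"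
    using continuous_minv_line[OF A E d] by (intro continuous_sum isCont_mult continuous_const) auto
  then show ?thesis by (simp only: mat_trace_mult[OF C G])
qed

lemma line_nonsingular:
  fixes A E :: "real mat"
  assumes "A \<in> carrier_mat n n" "E \<in> carrier_mat n n" "det A \<noteq> 0"
  shows "\<forall>\<^sub>F h in nhds 0. det (A + h \<cdot>\<^sub>m E) \<noteq> 0"
proof -
  have "A + 0 \<cdot>\<^sub>m E = A" using assms by (intro eq_matI) auto
  then have "((\<lambda>h. det (A + h \<cdot>\<^sub>m E)) \<longlongrightarrow> det A) (nhds 0)"
    using continuous_det_line[OF assms(1,2), of 0]
    by (simp add: isCont_def tendsto_nhds_iff)
  then show ?thesis using assms(3) by (rule tendsto_imp_eventually_ne)
qed

text \<open>By the resolvent identity \<open>minv A = ?Y h + h minv A E (?Y h)\<close> the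
  difference quotient equals a trace that is linear in \<open>?Y h\<close>. Continuity of the
  inverse then gives the limit.\<close>

lemma trace_minv_line_deriv:
  assumes A: "A \<in> carrier_mat n n" and E: "E \<in> carrier_mat n n" and d: "det A \<noteq> 0"
    and G: "G \<in> carrier_mat n n"
  shows "((\<lambda>h. mat_trace (minv (A + h \<cdot>\<^sub>m E) * G)) has_field_derivative
    - mat_trace (minv A * E * (minv A * G))) (at 0)"
proof -
  let ?Y = "\<lambda>h. minv (A + h \<cdot>\<^sub>m E)"
  note Ai = minv_carrier[OF A] and as = assoc_mult_mat[of _ n n _ n _ n]
  have C: "?Y h \<in> carrier_mat n n" for h using A E by (intro minv_carrier) simp
  have A0: "A + 0 \<cdot>\<^sub>m E = A" using A E by (intro eq_matI) auto
  define K where "K = G * (minv A * E)"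
  have K: "K \<in> carrier_mat n n" using G Ai E by (simp add: K_def)
  have tr: "mat_trace (minv A * E * (Y * G)) = mat_trace (Y * K)" if Y: "Y \<in> carrier_mat n n" for Y
  proof -
    have "mat_trace (minv A * E * (Y * G)) = mat_trace (Y * G * (minv A * E))"
      using Ai E Y G by (intro mat_trace_comm[of _ n n]) auto
    then show ?thesis using Ai E Y G by (simp add: K_def as)
  qed
  have quot: "(mat_trace (?Y h * G) - mat_trace (minv A * G)) / h = - mat_trace (?Y h * K)"
    if h: "h \<noteq> 0" "det (A + h \<cdot>\<^sub>m E) \<noteq> 0" for h
  proof -
    have AE: "A + h \<cdot>\<^sub>m E \<in> carrier_mat n n" using A E by simp
    have "minv A = minv A * ((A + h \<cdot>\<^sub>m E) * ?Y h)" using minv(1)[OF AE h(2)] Ai by simp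
    also have "\<dots> = (minv A * A + h \<cdot>\<^sub>m (minv A * E)) * ?Y h"
      using Ai A E C by (simp add: as[symmetric] mult_add_distrib_mat[of _ n n] mult_smult_distrib[of _ n n _ n])
    also have "\<dots> = ?Y h + h \<cdot>\<^sub>m (minv A * E * ?Y h)"
      using Ai E C[of h] unfolding minv(2)[OF A d]
      by (subst add_mult_distrib_mat[of _ n n]) (auto simp: mult_smult_assoc_mat[of _ n n _ n])
    finally have "minv A * G = (?Y h + h \<cdot>\<^sub>m (minv A * E * ?Y h)) * G" by simp
    also have "\<dots> = ?Y h * G + h \<cdot>\<^sub>m (minv A * E * ?Y h) * G"
      using Ai E C[of h] G by (intro add_mult_distrib_mat[of _ n n]) auto
    also have "h \<cdot>\<^sub>m (minv A * E * ?Y h) * G = h \<cdot>\<^sub>m (minv A * E * ?Y h * G)"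
      using Ai E C[of h] G by (intro mult_smult_assoc_mat[of _ n n _ n]) auto
    also have "minv A * E * ?Y h * G = minv A * E * (?Y h * G)"
      using Ai E C[of h] G by (intro assoc_mult_mat[of _ n n _ n _ n]) auto
    finally have "mat_trace (minv A * G) = mat_trace (?Y h * G) + h * mat_trace (?Y h * K)"
      using Ai E C[of h] G tr[OF C[of h]]
      by (simp add: mat_trace_add[of _ n] mat_trace_smult[of _ n] mult_carrier_mat[of _ n n _ n])
    then show ?thesis using h(1) by (simp add: field_simps)
  qed
  have "((\<lambda>h. - mat_trace (?Y h * K)) \<longlongrightarrow> - mat_trace (minv A * K)) (at 0)"
    using continuous_trace_minv_line[OF A E d K] by (intro tendsto_minus) (simp add: isCont_def A0)
  moreover have "\<forall>\<^sub>F h in at 0. - mat_trace (?Y h * K)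
      = (mat_trace (?Y h * G) - mat_trace (minv A * G)) / h"
    using line_nonsingular[OF A E d] unfolding eventually_at_filter
    by eventually_elim (simp add: quot)
  ultimately have "((\<lambda>h. (mat_trace (?Y h * G) - mat_trace (minv A * G)) / h)
      \<longlongrightarrow> - mat_trace (minv A * K)) (at 0)"
    by (rule Lim_transform_eventually)
  then show ?thesis
    unfolding tr[OF Ai] by (simp add: has_field_derivative_iff A0)
qed

lemma ln_det_line_deriv:
  assumes A: "A \<in> carrier_mat n n" and E: "E \<in> carrier_mat n n" and d: "det A > 0"
  shows "((\<lambda>h. ln (det (A + h \<cdot>\<^sub>m E))) has_field_derivative mat_trace (minv A * E)) (at 0)"
proof -
  have A0: "A + 0 \<cdot>\<^sub>m E = A" using A E by (intro eq_matI) auto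
  have "((\<lambda>h. det (A + h \<cdot>\<^sub>m E)) has_field_derivative det A * mat_trace (minv A * E)) (at 0)"
    using d minv(1)[OF A] by (intro det_line_deriv[OF A E minv_carrier[OF A]]) auto
  from DERIV_chain2[OF DERIV_ln_divide this] d show ?thesis by (simp add: A0)
qed

lemma linear_expand:
  fixes \<phi> :: "real vec \<Rightarrow> real"
  assumes add: "\<And>x y. x \<in> carrier_vec n \<Longrightarrow> y \<in> carrier_vec n \<Longrightarrow> \<phi> (x + y) = \<phi> x + \<phi> y"
    and smult: "\<And>c x. x \<in> carrier_vec n \<Longrightarrow> \<phi> (c \<cdot>\<^sub>v x) = c * \<phi> x"
    and x: "x \<in> carrier_vec n"
  shows "\<phi> x = (\<Sum>j<n. x $ j * \<phi> (unit_vec n j))"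
proof -
  define t where "t k = Matrix.vec n (\<lambda>j. if j < k then x $ j else 0)" for k
  have tc: "t k \<in> carrier_vec n" for k by (simp add: t_def)
  have "\<phi> (t k) = (\<Sum>j<k. x $ j * \<phi> (unit_vec n j))" if "k \<le> n" for k
    using that
  proof (induction k)
    case 0
    have "t 0 = 0 \<cdot>\<^sub>v t 0" by (rule eq_vecI) (auto simp: t_def)
    then have "\<phi> (t 0) = 0 * \<phi> (t 0)" using smult tc by metis
    then show ?case by simp
  next
    case (Suc k)
    have "t (Suc k) = t k + x $ k \<cdot>\<^sub>v unit_vec n k"
      by (rule eq_vecI) (auto simp: t_def unit_vec_def less_Suc_eq)
    then have "\<phi> (t (Suc k)) = \<phi> (t k) + x $ k * \<phi> (unit_vec n k)"
      using add[OF tc, of "x $ k \<cdot>\<^sub>v unit_vec n k"] smult[of "unit_vec n k" "x $ k"] by simp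
    then show ?case using Suc by simp
  qed
  moreover have "t n = x" using x by (intro eq_vecI) (auto simp: t_def)
  ultimately show ?thesis by fastforce
qed

text \<open>The squared local norm of \<open>h \<cdot>\<^sub>m E\<close> is quadratic in
  \<open>h\<close>, so near 0 the perturbation stays in the open Dikin ellipsoid.\<close>

lemma eventually_posdef:
  assumes "A \<in> carrier_mat n n" "A\<^sup>T = A" "posdef A" "E \<in> carrier_mat n n" "E\<^sup>T = E"
  shows "\<forall>\<^sub>F h in nhds 0. posdef (A + h \<cdot>\<^sub>m E)"
proof -
  have d: "det A \<noteq> 0" using posdef_factor[OF assms(1-3)] by (metis less_irrefl)
  note Ai = minv_carrier[OF assms(1)]
  have sc: "lnorm2 (minv A) (h \<cdot>\<^sub>m E) = h\<^sup>2 * lnorm2 (minv A) E" for h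
  proof -
    have "minv A * (h \<cdot>\<^sub>m E) = h \<cdot>\<^sub>m (minv A * E)" by (rule mult_smult_distrib[OF Ai assms(4)])
    then show ?thesis using Ai assms(4)
      unfolding lnorm2_def
      by (simp add: mat_trace_def sum_distrib_left mult_smult_distrib[of _ n n _ n]
          mult_smult_assoc_mat[of _ n n _ n] power2_eq_square mult.assoc)
  qed
  have "((\<lambda>h. h\<^sup>2 * lnorm2 (minv A) E) \<longlongrightarrow> 0\<^sup>2 * lnorm2 (minv A) E) (nhds 0)"
    by (intro tendsto_intros filterlim_ident)
  then have "\<forall>\<^sub>F h in nhds 0. h\<^sup>2 * lnorm2 (minv A) E < 1" by (rule order_tendstoD) simp
  then show ?thesis
  proof eventually_elim
    case (elim h)
    have "E $$ (j, i) = E $$ (i, j)" if "i < n" "j < n" for i j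
      using assms(4,5) that by (metis carrier_matD index_transpose_mat(1))
    then have "(h \<cdot>\<^sub>m E)\<^sup>T = h \<cdot>\<^sub>m E" using assms(4) by (intro eq_matI) auto
    then show ?case
      using elim posdef_perturbation(2)[OF assms(1-3) Ai minv(2)[OF assms(1) d], of "h \<cdot>\<^sub>m E"] assms(4) sc
      by simp
  qed
qed

subsection \<open>The logarithmic barrier of a linear matrix pencil\<close>

text \<open>The barrier is studied for a single linear map; the two blocks are joined only in the
  instance. Injectivity is what makes the Hessian nonsingular.\<close>

locale sym_pencil =
  fixes n m :: nat and L :: "real vec \<Rightarrow> real mat"
  assumes L_carrier: "x \<in> carrier_vec n \<Longrightarrow> L x \<in> carrier_mat m m"
    and L_sym: "x \<in> carrier_vec n \<Longrightarrow> (L x)\<^sup>T = L x"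
    and L_add: "x \<in> carrier_vec n \<Longrightarrow> y \<in> carrier_vec n \<Longrightarrow> L (x + y) = L x + L y"
    and L_smult: "x \<in> carrier_vec n \<Longrightarrow> L (c \<cdot>\<^sub>v x) = c \<cdot>\<^sub>m L x"
    and L_inj: "x \<in> carrier_vec n \<Longrightarrow> L x = 0\<^sub>m m m \<Longrightarrow> x = 0\<^sub>v n"
begin

lemma L_unit: "L (unit_vec n j) \<in> carrier_mat m m" "(L (unit_vec n j))\<^sup>T = L (unit_vec n j)"
  by (auto intro: L_carrier L_sym)

lemma posdef_det: "x \<in> carrier_vec n \<Longrightarrow> posdef (L x) \<Longrightarrow> det (L x) > 0"
  using posdef_factor[OF L_carrier L_sym] by blast

lemma L_minv:
  assumes "x \<in> carrier_vec n" "posdef (L x)"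
  shows "minv (L x) \<in> carrier_mat m m" "minv (L x) * L x = 1\<^sub>m m" "L x * minv (L x) = 1\<^sub>m m"
  using minv_carrier[OF L_carrier] minv[OF L_carrier] posdef_det[OF assms] assms by force+

lemma L_trace_expand:
  assumes "B \<in> carrier_mat m m" "x \<in> carrier_vec n"
  shows "mat_trace (B * L x) = (\<Sum>j<n. x $ j * mat_trace (B * L (unit_vec n j)))"
proof (rule linear_expand[OF _ _ assms(2)])
  fix x y :: "real vec" assume "x \<in> carrier_vec n" "y \<in> carrier_vec n"
  then show "mat_trace (B * L (x + y)) = mat_trace (B * L x) + mat_trace (B * L y)"
    using assms(1) L_carrier
    by (simp add: L_add mult_add_distrib_mat[of _ m m _ m] mat_trace_add[of _ m] mult_carrier_mat[of _ m m _ m])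
next
  fix c and x :: "real vec" assume "x \<in> carrier_vec n"
  then show "mat_trace (B * L (c \<cdot>\<^sub>v x)) = c * mat_trace (B * L x)"
    using assms(1) L_carrier
    by (simp add: L_smult mult_smult_distrib[of _ m m _ m] mat_trace_smult[of _ m] mult_carrier_mat[of _ m m _ m])
qed

lemma qform_L_expand:
  assumes "x \<in> carrier_vec n"
  shows "qform (L x) u v = (\<Sum>j<n. x $ j * qform (L (unit_vec n j)) u v)"
  by (rule linear_expand[OF _ _ assms]) (simp_all add: L_add L_smult qform_add[OF L_carrier L_carrier] qform_smult)

lemma L_index_expand:
  assumes "x \<in> carrier_vec n" "a < m" "b < m"
  shows "L x $$ (a, b) = (\<Sum>j<n. x $ j * L (unit_vec n j) $$ (a, b))"
  using qform_L_expand[OF assms(1), of "\<lambda>i. if i = a then 1 else 0" "\<lambda>i. if i = b then 1 else 0"]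
  by (simp add: qform_indicator[OF L_carrier assms(2,3)] assms(1) L_unit)

abbreviation logdet_barrier :: "real vec \<Rightarrow> real" where
  "logdet_barrier x \<equiv> - ln (det (L x))"

lemma partial_barrier:
  assumes x: "x \<in> carrier_vec n" "posdef (L x)"
  shows "partial n j logdet_barrier x = - mat_trace (minv (L x) * L (unit_vec n j))"
proof -
  have "(\<lambda>h. logdet_barrier (x + h \<cdot>\<^sub>v unit_vec n j))
      = (\<lambda>h. - ln (det (L x + h \<cdot>\<^sub>m L (unit_vec n j))))"
    using x(1) by (simp add: L_add L_smult)
  then show ?thesis unfolding partial_def
    using DERIV_minus[OF ln_det_line_deriv[OF L_carrier[OF x(1)] L_unit(1) posdef_det[OF x]]]
    by (simp add: DERIV_imp_deriv)
qed

lemma hessian_barrier: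
  assumes x: "x \<in> carrier_vec n" "posdef (L x)" and ij: "i < n" "j < n"
  shows "hessian n logdet_barrier x $$ (i, j)
    = mat_trace (minv (L x) * L (unit_vec n i) * (minv (L x) * L (unit_vec n j)))"
proof -
  let ?e = "\<lambda>i. unit_vec n i :: real vec"
  \<comment> \<open>The formula for the first partial derivative is available only at positive
    definite points. These include a neighbourhood of \<open>h = 0\<close>, which is all that the
    second derivative sees.\<close>
  have "\<forall>\<^sub>F h in nhds 0. posdef (L x + h \<cdot>\<^sub>m L (?e i))"
    using x by (intro eventually_posdef[OF L_carrier L_sym _ L_unit]) auto
  then have "\<forall>\<^sub>F h in nhds 0. partial n j logdet_barrier (x + h \<cdot>\<^sub>v ?e i)
      = - mat_trace (minv (L x + h \<cdot>\<^sub>m L (?e i)) * L (?e j))"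
  proof eventually_elim
    case (elim h)
    have "L (x + h \<cdot>\<^sub>v ?e i) = L x + h \<cdot>\<^sub>m L (?e i)" using x(1) by (simp add: L_add L_smult)
    then show ?case using elim x(1) by (subst partial_barrier) auto
  qed
  then have "partial n i (partial n j logdet_barrier) x
      = deriv (\<lambda>h. - mat_trace (minv (L x + h \<cdot>\<^sub>m L (?e i)) * L (?e j))) 0"
    unfolding partial_def[of n i] by (rule deriv_cong_ev) simp
  also have "\<dots> = mat_trace (minv (L x) * L (?e i) * (minv (L x) * L (?e j)))"
    using DERIV_minus[OF trace_minv_line_deriv[OF L_carrier[OF x(1)] L_unit(1) _ L_unit(1)]] posdef_det[OF x]
    by (intro DERIV_imp_deriv) fastforce
  finally show ?thesis using ij by (simp add: hessian_def)
qed

lemma hessian_carrier: "hessian n f x \<in> carrier_mat n n"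
  by (simp add: hessian_def)

text \<open>For \<open>u = x\<close> the inner product \<open>minv (L x) * L x\<close> cancels and
  the right-hand side is minus the gradient: this is the homogeneity identity
  \<open>H(x) x = - \<nabla>f(x)\<close>.\<close>

lemma hessian_mult_vec:
  assumes x: "x \<in> carrier_vec n" "posdef (L x)" and u: "u \<in> carrier_vec n" and i: "i < n"
  shows "(hessian n logdet_barrier x *\<^sub>v u) $ i
    = mat_trace (minv (L x) * L (unit_vec n i) * (minv (L x) * L u))"
proof -
  note Xi = L_minv(1)[OF x] and as = assoc_mult_mat[of _ m m _ m _ m]
  define B where "B = minv (L x) * L (unit_vec n i) * minv (L x)"
  have B: "B \<in> carrier_mat m m" using Xi L_unit(1) unfolding B_def by (intro mult_carrier_mat[of _ m m]) auto
  have eq: "minv (L x) * L (unit_vec n i) * (minv (L x) * L y) = B * L y" if "y \<in> carrier_vec n" for y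
    using Xi L_unit(1) L_carrier[OF that] unfolding B_def by (simp add: as mult_carrier_mat[of _ m m _ m])
  have "(hessian n logdet_barrier x *\<^sub>v u) $ i = (\<Sum>j<n. hessian n logdet_barrier x $$ (i, j) * u $ j)"
    using u i hessian_carrier[of logdet_barrier x] by (simp add: scalar_prod_def atLeast0LessThan)
  also have "\<dots> = (\<Sum>j<n. u $ j * mat_trace (B * L (unit_vec n j)))"
    using hessian_barrier[OF x i] eq by (intro sum.cong) auto
  also have "\<dots> = mat_trace (B * L u)" by (rule L_trace_expand[OF B u, symmetric])
  finally show ?thesis using eq[OF u] by simp
qed

lemma hessian_form:
  assumes x: "x \<in> carrier_vec n" "posdef (L x)" and u: "u \<in> carrier_vec n"
  shows "(\<Sum>i<n. u $ i * (hessian n logdet_barrier x *\<^sub>v u) $ i) = lnorm2 (minv (L x)) (L u)"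
proof -
  note Xi = L_minv(1)[OF x] and as = assoc_mult_mat[of _ m m _ m _ m]
  define B where "B = minv (L x) * L u * minv (L x)"
  have B: "B \<in> carrier_mat m m" using Xi L_carrier[OF u] unfolding B_def by (intro mult_carrier_mat[of _ m m]) auto
  have eq: "mat_trace (minv (L x) * L y * (minv (L x) * L u)) = mat_trace (B * L y)"
    if y: "y \<in> carrier_vec n" for y
  proof -
    have "mat_trace (minv (L x) * L y * (minv (L x) * L u)) = mat_trace (minv (L x) * L u * (minv (L x) * L y))"
      using Xi L_carrier[OF y] L_carrier[OF u] by (intro mat_trace_comm[of _ m m] mult_carrier_mat[of _ m m]) auto
    then show ?thesis using Xi L_carrier[OF y] L_carrier[OF u]
      unfolding B_def by (simp add: as mult_carrier_mat[of _ m m _ m])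
  qed
  have "(\<Sum>i<n. u $ i * (hessian n logdet_barrier x *\<^sub>v u) $ i) = (\<Sum>i<n. u $ i * mat_trace (B * L (unit_vec n i)))"
    using hessian_mult_vec[OF x u] eq by (intro sum.cong) auto
  also have "\<dots> = mat_trace (B * L u)" by (rule L_trace_expand[OF B u, symmetric])
  finally show ?thesis using eq[OF u] by (simp add: lnorm2_def)
qed

text \<open>If the local norm vanishes, so does the congruent copy \<open>M\<close> of
  \<open>L u\<close>. As \<open>P\<close> is invertible, \<open>L u\<close> vanishes too, contrary
  to injectivity of the pencil.\<close>

lemma lnorm2_pos:
  assumes x: "x \<in> carrier_vec n" "posdef (L x)" and u: "u \<in> carrier_vec n" "u \<noteq> 0\<^sub>v n"
  shows "lnorm2 (minv (L x)) (L u) > 0"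
proof (rule ccontr)
  assume neg: "\<not> lnorm2 (minv (L x)) (L u) > 0"
  obtain P where P: "P \<in> carrier_mat m m" "P * (P\<^sup>T * L x) = 1\<^sub>m m" "minv (L x) = P * P\<^sup>T"
    using posdef_inverse_factor[OF L_carrier[OF x(1)] L_sym[OF x(1)] x(2) L_minv(1,2)[OF x]] by metis
  define Q where "Q = P\<^sup>T * L x"
  note Lu = L_carrier[OF u(1)] and as = assoc_mult_mat[of _ m m _ m _ m]
  have Q: "Q \<in> carrier_mat m m" "P * Q = 1\<^sub>m m"
    using P L_carrier[OF x(1)] by (auto simp: Q_def intro!: mult_carrier_mat[of _ m m])
  have QT: "Q\<^sup>T * P\<^sup>T = 1\<^sub>m m"
    using arg_cong[OF Q(2), of transpose_mat] P(1) Q(1) by (simp add: transpose_mult[of _ m m _ m])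
  define M where "M = P\<^sup>T * L u * P"
  have M: "M \<in> carrier_mat m m" using P(1) Lu unfolding M_def by (intro mult_carrier_mat[of _ m m]) auto
  have "frob M = 0"
    using neg lnorm2_eq_frob[OF P(1) Lu L_sym[OF u(1)]] frob_nonneg[of M] by (simp add: P(3) M_def)
  then have "M $$ (i, j) = 0" if "i < m" "j < m" for i j
    using M that by (simp add: frob_def sum_nonneg_eq_0_iff sum_nonneg)
  then have M0: "M = 0\<^sub>m m m" using M by (intro eq_matI) auto
  have "L u = (Q\<^sup>T * P\<^sup>T) * L u * (P * Q)" unfolding Q(2) QT using Lu by simp
  also have "\<dots> = Q\<^sup>T * M * Q" using P(1) Q(1) Lu by (simp add: M_def as mult_carrier_mat[of _ m m _ m])
  also have "\<dots> = 0\<^sub>m m m" using Q(1) by (simp add: M0)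
  finally show False using L_inj[OF u(1)] u(2) by simp
qed

lemma hessian_inverse:
  assumes x: "x \<in> carrier_vec n" "posdef (L x)"
  obtains Hinv where "mat_inverse (hessian n logdet_barrier x) = Some Hinv" "Hinv \<in> carrier_mat n n"
    "hessian n logdet_barrier x * Hinv = 1\<^sub>m n"
proof -
  let ?H = "hessian n logdet_barrier x"
  note H = hessian_carrier[of logdet_barrier x]
  have "det ?H \<noteq> 0"
  proof
    assume "det ?H = 0"
    then obtain u where u: "u \<in> carrier_vec n" "u \<noteq> 0\<^sub>v n" "?H *\<^sub>v u = 0\<^sub>v n"
      unfolding det_0_iff_vec_prod_zero[OF H] by blast
    then show False using hessian_form[OF x u(1)] lnorm2_pos[OF x u(1,2)] by simp
  qed
  then have "?H \<in> Units (ring_mat TYPE(real) n ())" by (rule det_non_zero_imp_unit[OF H])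
  then obtain Hinv where "mat_inverse ?H = Some Hinv"
    using mat_inverse(1)[OF H, of "()"] by (cases "mat_inverse ?H") auto
  with mat_inverse(2)[OF H this] that show thesis by blast
qed

text \<open>With \<open>w = H(y)\<inverse> t\<close> and \<open>t = H(y0) y0\<close>, the local norm of \<open>w - y\<close> at \<open>y\<close> is at most the local
  norm of \<open>y - y0\<close> at \<open>y0\<close>, so that \<open>w\<close> stays in the unit Dikin ellipsoid around \<open>y\<close>.\<close>

lemma certificate_perturbation:
  assumes y0: "y0 \<in> carrier_vec n" "posdef (L y0)" and y: "y \<in> carrier_vec n"
    and t: "t \<in> carrier_vec n" "\<And>j. j < n \<Longrightarrow> t $ j = mat_trace (minv (L y0) * L (unit_vec n j))"
    and close: "lnorm2 (minv (L y0)) (L (y - y0)) < 1"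
  shows "posdef (L y)"
    and "\<exists>Hinv. mat_inverse (hessian n logdet_barrier y) = Some Hinv \<and> Hinv *\<^sub>v t \<in> carrier_vec n
      \<and> psd (L (Hinv *\<^sub>v t))"
proof -
  have yd: "y - y0 \<in> carrier_vec n" using y y0 by simp
  have Ly: "L y = L y0 + L (y - y0)"
  proof -
    have "y0 + (y - y0) = y" using y y0 by (intro eq_vecI) auto
    then show ?thesis using L_add[OF y0(1) yd] by simp
  qed
  then have diff: "L (y - y0) = L y - L y0"
    using L_carrier[OF y] L_carrier[OF y0(1)] L_carrier[OF yd] by (intro eq_matI) auto
  show pd: "posdef (L y)"
    unfolding Ly by (rule posdef_perturbation(2)[OF L_carrier[OF y0(1)] L_sym[OF y0(1)] y0(2) L_minv(1,2)[OF y0] L_carrier[OF yd] L_sym[OF yd] close])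
  let ?H = "hessian n logdet_barrier y"
  obtain Hinv where H: "mat_inverse ?H = Some Hinv" "Hinv \<in> carrier_mat n n" "?H * Hinv = 1\<^sub>m n"
    using hessian_inverse[OF y pd] .
  define w where "w = Hinv *\<^sub>v t"
  have w: "w \<in> carrier_vec n" using H(2) t(1) by (simp add: w_def)
  define u where "u = w - y"
  have u: "u \<in> carrier_vec n" using w y by (simp add: u_def)
  have "?H *\<^sub>v w = (?H * Hinv) *\<^sub>v t" unfolding w_def by (rule assoc_mult_mat_vec[OF hessian_carrier H(2) t(1), symmetric])
  then have Hw: "?H *\<^sub>v w = t" using t(1) by (simp add: H(3))
  note Xi = L_minv[OF y pd] and Yi = L_minv[OF y0]
  define G where "G = minv (L y0) - minv (L y)"
  have G: "G \<in> carrier_mat m m" using Xi(1) unfolding G_def by (intro minus_carrier_mat)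
  \<comment> \<open>\<open>?H *\<^sub>v w = t\<close> is a trace against the inverse of
    \<open>L y0\<close> by assumption, and \<open>?H *\<^sub>v y\<close> is one against the inverse
    of \<open>L y\<close> by homogeneity. Only the difference \<open>G\<close> of the inverses
    remains.\<close>
  have Hu: "(?H *\<^sub>v u) $ i = mat_trace (G * L (unit_vec n i))" if i: "i < n" for i
  proof -
    note E = L_unit(1)[of i]
    have "?H *\<^sub>v u = ?H *\<^sub>v w - ?H *\<^sub>v y"
      unfolding u_def by (rule mult_minus_distrib_mat_vec[OF hessian_carrier w y])
    then have "(?H *\<^sub>v u) $ i = t $ i - (?H *\<^sub>v y) $ i" unfolding Hw using i hessian_carrier[of logdet_barrier y] by simp
    also have "(?H *\<^sub>v y) $ i = mat_trace (minv (L y) * L (unit_vec n i))"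
      unfolding hessian_mult_vec[OF y pd y i] Xi(2) using Xi(1) E by (simp add: mult_carrier_mat[of _ m m _ m])
    also have "t $ i - mat_trace (minv (L y) * L (unit_vec n i)) = mat_trace (G * L (unit_vec n i))"
      unfolding t(2)[OF i] G_def minus_mult_distrib_mat[OF Yi(1) Xi(1) E]
      by (rule mat_trace_minus[symmetric]) (use Xi(1) Yi(1) E in \<open>auto intro!: mult_carrier_mat[of _ m m]\<close>)
    finally show ?thesis .
  qed
  define a where "a = lnorm2 (minv (L y)) (L u)"
  have "a = (\<Sum>i<n. u $ i * mat_trace (G * L (unit_vec n i)))"
    unfolding a_def hessian_form[OF y pd u, symmetric] using Hu by (intro sum.cong) auto
  also have "\<dots> = mat_trace (G * L u)" by (rule L_trace_expand[OF G u, symmetric])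
  \<comment> \<open>The Hessian form gives \<open>a\<close> as a trace against \<open>G\<close>, and
    the Cauchy-Schwarz bound for its square contains \<open>a\<close> again. Dividing by
    \<open>a\<close> leaves the squared local distance from \<open>y\<close> to \<open>y0\<close>,
    measured at \<open>y0\<close>.\<close>
  finally have "a\<^sup>2 \<le> lnorm2 (minv (L y0)) (L y - L y0) * a"
    unfolding a_def G_def using inverse_perturbation[OF L_carrier[OF y] L_sym[OF y] pd Xi(1,2)
      L_carrier[OF y0(1)] L_sym[OF y0(1)] Yi(1,2) L_carrier[OF u] L_sym[OF u]] by simp
  moreover have a0: "a \<ge> 0"
    unfolding a_def by (rule lnorm2_nonneg[OF L_carrier[OF y] L_sym[OF y] pd Xi(1,2) L_carrier[OF u] L_sym[OF u]])
  ultimately have "a \<le> 1"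
    using close unfolding diff[symmetric] power2_eq_square
    by (cases "a = 0") auto
  then have "psd (L y + L u)" unfolding a_def
    by (rule posdef_perturbation(1)[OF L_carrier[OF y] L_sym[OF y] pd Xi(1,2) L_carrier[OF u] L_sym[OF u]])
  moreover have "y + u = w" using y w by (intro eq_vecI) (auto simp: u_def)
  ultimately have "psd (L w)" using L_add[OF y u] by simp
  then show "\<exists>Hinv. mat_inverse ?H = Some Hinv \<and> Hinv *\<^sub>v t \<in> carrier_vec n \<and> psd (L (Hinv *\<^sub>v t))"
    using H(1) w w_def by blast
qed

end

section \<open>Existence of the maximiser and rounding radius\<close>

lemma compact_box_fun:
  fixes S :: "nat \<Rightarrow> real set"
  assumes "\<And>i. compact (S i)"
  shows "compact {x. \<forall>i. x i \<in> S i}"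
proof -
  have "compactin (product_topology (\<lambda>i. euclidean) UNIV) (PiE UNIV S)"
    unfolding compactin_PiE using assms by simp
  moreover have "PiE UNIV S = {x. \<forall>i. x i \<in> S i}" by (auto simp: PiE_def Pi_def)
  ultimately show ?thesis by (simp add: euclidean_product_topology)
qed

context sym_pencil
begin

lemma continuous_on_det_L: "continuous_on UNIV (\<lambda>x :: nat \<Rightarrow> real. det (L (Matrix.vec n x)))"
proof -
  have "L (Matrix.vec n x) $$ (a, b) = (\<Sum>j<n. x j * L (unit_vec n j) $$ (a, b))" if "a < m" "b < m" for x a b
    using L_index_expand[OF _ that, of "Matrix.vec n x"] by simp
  then have "(\<lambda>x. det (L (Matrix.vec n x))) = (\<lambda>x. \<Sum>p\<in>{p. p permutes {0..<m}}.
      signof p * (\<Prod>i = 0..<m. \<Sum>j<n. x j * L (unit_vec n j) $$ (i, p i)))"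
    by (intro ext, subst det_def'[OF L_carrier])
      (auto simp: permutes_lessThan_less intro!: sum.cong arg_cong2[where f = "(*)"] prod.cong)
  then show ?thesis by (simp only:) (intro continuous_intros continuous_on_product_coordinates)
qed

lemma closed_psd_L: "closed {x :: nat \<Rightarrow> real. psd (L (Matrix.vec n x))}"
proof -
  have "qform (L (Matrix.vec n x)) u u = (\<Sum>j<n. x j * qform (L (unit_vec n j)) u u)" for x u
    using qform_L_expand[of "Matrix.vec n x" u u] by simp
  then have "{x. psd (L (Matrix.vec n x))} = (\<Inter>u. {x. 0 \<le> (\<Sum>j<n. x j * qform (L (unit_vec n j)) u u)})"
    by (auto simp: psd_def)
  also have "closed \<dots>"
    by (intro closed_INT ballI closed_Collect_le continuous_intros continuous_on_product_coordinates)
  finally show ?thesis .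
qed

text \<open>The maximiser of the determinant on the section \<open>t \<bullet> x = m\<close> satisfies \<open>- \<nabla>f(x) = t\<close>.\<close>

lemma gradient_certificate_exists:
  assumes t: "t \<in> carrier_vec n" and m: "m > 0"
    and xh: "xh \<in> carrier_vec n" "posdef (L xh)" "t \<bullet> xh > 0"
    and bounded: "\<And>x j. x \<in> carrier_vec n \<Longrightarrow> psd (L x) \<Longrightarrow> t \<bullet> x = real m \<Longrightarrow> j < n \<Longrightarrow> \<bar>x $ j\<bar> \<le> M"
  obtains y where "y \<in> carrier_vec n" "posdef (L y)" "t \<bullet> y = real m"
    "\<And>j. j < n \<Longrightarrow> t $ j = mat_trace (minv (L y) * L (unit_vec n j))"
proof -
  \<comment> \<open>Compactness is obtained for functions on \<open>nat\<close> with the product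
    topology, by Tychonoff. The coordinates from \<open>n\<close> on are pinned to 0 to keep the box
    compact.\<close>
  define box where "box = {x. \<forall>i. x i \<in> (if i < n then {- M..M} else {0})}"
  define K where "K = box \<inter> ({x. psd (L (Matrix.vec n x))} \<inter> {x. (\<Sum>j<n. t $ j * x j) = real m})"
  have "compact box" unfolding box_def by (rule compact_box_fun) auto
  moreover have "closed {x :: nat \<Rightarrow> real. (\<Sum>j<n. t $ j * x j) = real m}"
    by (intro closed_Collect_eq continuous_intros continuous_on_product_coordinates)
  ultimately have comp: "compact K" unfolding K_def using closed_psd_L by (intro compact_Int_closed closed_Int) auto
  have sp: "t \<bullet> x = (\<Sum>j<n. t $ j * x $ j)" if "x \<in> carrier_vec n" for x
    using that by (simp add: scalar_prod_def atLeast0LessThan)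
  have inK: "(\<lambda>j. if j < n then x $ j else 0) \<in> K" if x: "x \<in> carrier_vec n" "psd (L x)" "t \<bullet> x = real m" for x
  proof -
    have "Matrix.vec n (\<lambda>j. if j < n then x $ j else 0) = x" using x by (intro eq_vecI) auto
    then show ?thesis using x bounded[OF x] sp[OF x(1)] by (auto simp: K_def box_def abs_le_iff minus_le_iff)
  qed
  define c where "c = real m / (t \<bullet> xh)"
  have c: "c > 0" using m xh(3) by (simp add: c_def)
  define x1 where "x1 = c \<cdot>\<^sub>v xh"
  have x1: "x1 \<in> carrier_vec n" "t \<bullet> x1 = real m"
    using xh t m by (auto simp: x1_def c_def)
  have pd1: "posdef (L x1)"
    unfolding x1_def L_smult[OF xh(1)] using xh(2) c by (simp add: posdef_def qform_smult)
  have "(\<lambda>j. if j < n then x1 $ j else 0) \<in> K" by (rule inK[OF x1(1) posdef_imp_psd[OF pd1] x1(2)])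
  moreover have "continuous_on K (\<lambda>x. det (L (Matrix.vec n x)))"
    by (rule continuous_on_subset[OF continuous_on_det_L]) simp
  ultimately obtain y' where y': "y' \<in> K" "\<And>x. x \<in> K \<Longrightarrow> det (L (Matrix.vec n x)) \<le> det (L (Matrix.vec n y'))"
    using continuous_attains_sup[OF comp] by blast
  define y where "y = Matrix.vec n y'"
  have y: "y \<in> carrier_vec n" "psd (L y)" "t \<bullet> y = real m"
    using y'(1) sp[of y] by (auto simp: y_def K_def)
  have max: "det (L x) \<le> det (L y)"
    if x: "x \<in> carrier_vec n" "psd (L x)" "t \<bullet> x = real m" for x
  proof -
    have "Matrix.vec n (\<lambda>j. if j < n then x $ j else 0) = x" using x by (intro eq_vecI) auto
    then show ?thesis using y'(2)[OF inK[OF x]] by (simp add: y_def)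
  qed
  \<comment> \<open>The maximum is at least the determinant at \<open>x1\<close>, the positive
    definite point \<open>xh\<close> scaled onto the section. This keeps the maximiser off the
    boundary of the cone.\<close>
  have "det (L y) > 0"
    using max[OF x1(1) posdef_imp_psd[OF pd1] x1(2)] posdef_det[OF x1(1) pd1] by simp
  then have pd: "posdef (L y)" by (intro psd_nonsingular_imp_posdef[OF L_carrier L_sym] y) simp
  have grad: "mat_trace (minv (L y) * L v) = 0" if v: "v \<in> carrier_vec n" "t \<bullet> v = 0" for v
  proof -
    have "\<forall>\<^sub>F h in nhds 0. posdef (L y + h \<cdot>\<^sub>m L v)"
      by (intro eventually_posdef[OF L_carrier L_sym pd L_carrier L_sym] y v)
    then obtain e where e: "e > 0" "\<And>h. \<bar>h\<bar> < e \<Longrightarrow> posdef (L y + h \<cdot>\<^sub>m L v)"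
      unfolding eventually_nhds_metric by (auto simp: dist_real_def)
    have "det (L y + h \<cdot>\<^sub>m L v) \<le> det (L y + 0 \<cdot>\<^sub>m L v)" if h: "\<bar>0 - h\<bar> < e" for h
    proof -
      have eq: "L (y + h \<cdot>\<^sub>v v) = L y + h \<cdot>\<^sub>m L v" using y v by (simp add: L_add L_smult)
      have "t \<bullet> (y + h \<cdot>\<^sub>v v) = real m" using t y v by (simp add: scalar_prod_add_distrib[of _ n])
      moreover have "psd (L (y + h \<cdot>\<^sub>v v))" unfolding eq using e(2)[of h] h by (intro posdef_imp_psd) simp
      ultimately have "det (L (y + h \<cdot>\<^sub>v v)) \<le> det (L y)" using y v by (intro max) auto
      moreover have "L y + 0 \<cdot>\<^sub>m L v = L y" using L_carrier[OF y(1)] L_carrier[OF v(1)] by (intro eq_matI) auto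
      ultimately show ?thesis by (simp add: eq)
    qed
    then have "det (L y) * mat_trace (minv (L y) * L v) = 0"
      using DERIV_local_max[OF det_line_deriv[OF L_carrier[OF y(1)] L_carrier[OF v(1)] L_minv(1,3)[OF y(1) pd]] e(1)]
      by blast
    then show ?thesis using \<open>det (L y) > 0\<close> by simp
  qed
  have "t $ j = mat_trace (minv (L y) * L (unit_vec n j))" if j: "j < n" for j
  proof -
    \<comment> \<open>The unit vector is projected along \<open>y\<close> onto the tangent space of
      the section. Choosing the level of the section as the matrix size \<open>m\<close> makes the
      Lagrange multiplier 1, because the trace of \<open>minv (L y) * L y\<close> is
      \<open>m\<close>.\<close>
    define v where "v = unit_vec n j + (- (t $ j / real m)) \<cdot>\<^sub>v y"
    have v: "v \<in> carrier_vec n" using y by (simp add: v_def)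
    have "t \<bullet> v = 0"
      using t y m j by (simp add: v_def scalar_prod_add_distrib[of _ n])
    then have "0 = mat_trace (minv (L y) * L v)" using grad[OF v] by simp
    also have "L v = L (unit_vec n j) + (- (t $ j / real m)) \<cdot>\<^sub>m L y"
      unfolding v_def using y by (simp add: L_add L_smult)
    also have "mat_trace (minv (L y) * \<dots>)
        = mat_trace (minv (L y) * L (unit_vec n j)) + (- (t $ j / real m)) * mat_trace (minv (L y) * L y)"
      using L_minv(1)[OF y(1) pd] L_carrier[OF y(1)] L_unit(1)
      by (simp add: mult_add_distrib_mat[of _ m m _ m] mult_smult_distrib[of _ m m _ m] mat_trace_add[of _ m]
        mat_trace_smult[of _ m] mult_carrier_mat[of _ m m _ m])
    also have "\<dots> = mat_trace (minv (L y) * L (unit_vec n j)) - t $ j"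
      unfolding L_minv(2)[OF y(1) pd] using m by simp
    finally show ?thesis by simp
  qed
  then show thesis using that y pd by blast
qed

text \<open>The gradient condition turns \<open>t \<bullet> xh\<close> into the trace of
  \<open>minv (L y) * L xh\<close>, so \<open>lnorm2_sandwich\<close> applies. The bound refers to
  \<open>y\<close> only through \<open>t\<close>.\<close>

lemma local_norm_le:
  assumes y: "y \<in> carrier_vec n" "posdef (L y)"
    and t: "t \<in> carrier_vec n" "\<And>j. j < n \<Longrightarrow> t $ j = mat_trace (minv (L y) * L (unit_vec n j))"
    and xh: "xh \<in> carrier_vec n" and \<delta>: "\<delta> \<in> carrier_vec n"
    and psd: "psd (L (xh + \<delta>))" "psd (L (xh - \<delta>))"
  shows "lnorm2 (minv (L y)) (L \<delta>) \<le> 2 * (t \<bullet> xh)\<^sup>2"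
proof -
  have "t \<bullet> xh = (\<Sum>j<n. xh $ j * mat_trace (minv (L y) * L (unit_vec n j)))"
    using t xh by (simp add: scalar_prod_def atLeast0LessThan mult.commute)
  also have "\<dots> = mat_trace (minv (L y) * L xh)" by (rule L_trace_expand[OF L_minv(1)[OF y] xh, symmetric])
  finally have tr: "t \<bullet> xh = mat_trace (minv (L y) * L xh)" .
  have "xh - \<delta> = xh + (- 1) \<cdot>\<^sub>v \<delta>" using xh \<delta> by (intro eq_vecI) auto
  then have "L (xh - \<delta>) = L xh + (- 1) \<cdot>\<^sub>m L \<delta>" using xh \<delta> by (simp add: L_add L_smult)
  then have "L (xh - \<delta>) = L xh - L \<delta>"
    using L_carrier[OF xh] L_carrier[OF \<delta>] by (intro eq_matI) auto
  with psd show ?thesis unfolding tr L_add[OF xh \<delta>]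
    by (intro lnorm2_sandwich[OF L_carrier L_sym y(2) L_minv(1,2)[OF y] L_carrier L_sym L_carrier L_sym] y xh \<delta>) auto
qed

lemma lnorm2_L_smult:
  assumes "Xi \<in> carrier_mat m m" "x \<in> carrier_vec n"
  shows "lnorm2 Xi (L (c \<cdot>\<^sub>v x)) = c\<^sup>2 * lnorm2 Xi (L x)"
proof -
  note C = L_carrier[OF assms(2)]
  have "lnorm2 Xi (c \<cdot>\<^sub>m L x) = mat_trace (c \<cdot>\<^sub>m (Xi * L x) * (c \<cdot>\<^sub>m (Xi * L x)))"
    using mult_smult_distrib[OF assms(1) C] by (simp add: lnorm2_def)
  also have "\<dots> = c * (c * mat_trace (Xi * L x * (Xi * L x)))"
    using assms(1) C by (simp add: mult_smult_distrib[of _ m m _ m] mult_smult_assoc_mat[of _ m m _ m]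
      mat_trace_smult[of _ m] mult_carrier_mat[of _ m m _ m])
  finally show ?thesis using assms(2) by (simp add: L_smult lnorm2_def power2_eq_square)
qed

text \<open>The squared local norm is the quadratic form of the Hessian, hence at most
  \<open>c\<close> times the squared Euclidean norm with \<open>c\<close> as defined in the proof.
  Radius \<open>1 / c\<close> is inside the Dikin ellipsoid because
  \<open>c \<ge> 1\<close>.\<close>

lemma posdef_neighbourhood:
  assumes x: "x \<in> carrier_vec n" "posdef (L x)"
  shows "\<exists>\<epsilon>>0. \<forall>y\<in>carrier_vec n. L2_set (\<lambda>i. y $ i - x $ i) {..<n} < \<epsilon> \<longrightarrow> psd (L y)"
proof -
  let ?H = "hessian n logdet_barrier x"
  define c where "c = 1 + (\<Sum>i<n. \<Sum>j<n. \<bar>?H $$ (i, j)\<bar>)"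
  have c: "c \<ge> 1" by (auto simp: c_def intro!: sum_nonneg)
  show ?thesis
  proof (intro exI[of _ "1 / c"] conjI ballI impI)
    fix y assume y: "y \<in> carrier_vec n" "L2_set (\<lambda>i. y $ i - x $ i) {..<n} < 1 / c"
    define v where "v = y - x"
    define l where "l = L2_set (\<lambda>i. y $ i - x $ i) {..<n}"
    have v: "v \<in> carrier_vec n" using x y by (simp add: v_def)
    have vl: "\<bar>v $ i\<bar> \<le> l" if "i < n" for i
      using member_le_L2_set[of "{..<n}" i "\<lambda>i. \<bar>y $ i - x $ i\<bar>"] that x y
      by (simp add: v_def l_def L2_set_def)
    have l: "0 \<le> l" "l < 1 / c" using y by (simp_all add: l_def)
    have "lnorm2 (minv (L x)) (L v) = (\<Sum>i<n. v $ i * (\<Sum>j<n. ?H $$ (i, j) * v $ j))"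
      unfolding hessian_form[OF x v, symmetric] using v hessian_carrier[of logdet_barrier x]
      by (intro sum.cong) (simp_all add: scalar_prod_def atLeast0LessThan)
    also have "\<dots> \<le> (\<Sum>i<n. \<Sum>j<n. \<bar>?H $$ (i, j)\<bar> * l\<^sup>2)"
      unfolding sum_distrib_left
    proof (intro sum_mono)
      fix i j assume "i \<in> {..<n}" "j \<in> {..<n}"
      then have "\<bar>v $ i\<bar> * \<bar>v $ j\<bar> \<le> l * l" using vl l by (intro mult_mono) auto
      then have "\<bar>?H $$ (i, j)\<bar> * (\<bar>v $ i\<bar> * \<bar>v $ j\<bar>) \<le> \<bar>?H $$ (i, j)\<bar> * l\<^sup>2"
        by (intro mult_left_mono) (simp_all add: power2_eq_square)
      then show "v $ i * (?H $$ (i, j) * v $ j) \<le> \<bar>?H $$ (i, j)\<bar> * l\<^sup>2"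
        using abs_ge_self[of "v $ i * (?H $$ (i, j) * v $ j)"] by (simp add: abs_mult mult_ac)
    qed
    also have "\<dots> \<le> c * l\<^sup>2" by (simp add: c_def sum_distrib_right distrib_right)
    also have "\<dots> \<le> c * (1 / c)\<^sup>2" using l c by (intro mult_left_mono power_mono) auto
    also have "\<dots> \<le> 1" using c by (simp add: power2_eq_square)
    finally have "psd (L x + L v)"
      by (intro posdef_perturbation(1)[OF L_carrier L_sym x(2) L_minv(1,2)[OF x] L_carrier L_sym] x v)
    moreover have "x + v = y" using x y by (intro eq_vecI) (auto simp: v_def)
    ultimately show "psd (L y)" using L_add[OF x(1) v] by simp
  qed (use c in simp)
qed

text \<open>At \<open>c \<cdot>\<^sub>v y0\<close> the inverse matrix, and with it the local norm,
  is divided by \<open>c\<close>, so the admissible radius grows to \<open>c\<close>. The negative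
  gradient there is \<open>t\<close> divided by \<open>c\<close>, and the positive factor is removed
  from the certificate at the end.\<close>

lemma scaled_certificate_perturbation:
  assumes y0: "y0 \<in> carrier_vec n" "posdef (L y0)" and y: "y \<in> carrier_vec n"
    and t: "t \<in> carrier_vec n" "\<And>j. j < n \<Longrightarrow> t $ j = mat_trace (minv (L y0) * L (unit_vec n j))"
    and c: "c > 0" and close: "lnorm2 (minv (L y0)) (L (y - c \<cdot>\<^sub>v y0)) < c\<^sup>2"
  shows "posdef (L y)"
    and "\<exists>Hinv. mat_inverse (hessian n logdet_barrier y) = Some Hinv \<and> Hinv *\<^sub>v t \<in> carrier_vec n
      \<and> psd (L (Hinv *\<^sub>v t))"
proof -
  let ?z = "c \<cdot>\<^sub>v y0" and ?s = "(1 / c) \<cdot>\<^sub>v t"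
  have z: "?z \<in> carrier_vec n" using y0 by simp
  have pz: "posdef (L ?z)"
    unfolding L_smult[OF y0(1)] using y0(2) c by (simp add: posdef_def qform_smult)
  note Yi = L_minv[OF y0] and Zi = L_minv[OF z pz] and Y = L_carrier[OF y0(1)]
  have "minv (L ?z) = minv (L ?z) * (L y0 * minv (L y0))" using Zi(1) Yi(3) by simp
  also have "\<dots> = minv (L ?z) * ((1 / c) \<cdot>\<^sub>m L ?z * minv (L y0))"
  proof -
    have "(1 / c) \<cdot>\<^sub>m L ?z = L y0" unfolding L_smult[OF y0(1)] using Y c by (intro eq_matI) auto
    then show ?thesis by simp
  qed
  also have "\<dots> = (1 / c) \<cdot>\<^sub>m (minv (L ?z) * (L ?z * minv (L y0)))"
    using Zi(1) Yi(1) L_carrier[OF z]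
    by (simp add: mult_smult_distrib[of _ m m _ m] mult_smult_assoc_mat[of _ m m _ m] mult_carrier_mat[of _ m m _ m])
  also have "minv (L ?z) * (L ?z * minv (L y0)) = minv (L y0)"
    using Zi Yi(1) L_carrier[OF z] by (simp add: assoc_mult_mat[of _ m m _ m _ m, symmetric])
  finally have inv: "minv (L ?z) = (1 / c) \<cdot>\<^sub>m minv (L y0)" .
  have s: "?s \<in> carrier_vec n" using t by simp
  have sj: "?s $ j = mat_trace (minv (L ?z) * L (unit_vec n j))" if "j < n" for j
    unfolding inv using that t Yi(1) L_unit(1)
    by (simp add: mult_smult_assoc_mat[of _ m m _ m] mat_trace_smult[of _ m] mult_carrier_mat[of _ m m _ m])
  have V: "L (y - ?z) \<in> carrier_mat m m" using y z by (intro L_carrier) simp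
  have "lnorm2 (minv (L ?z)) (L (y - ?z)) = (1 / c) * ((1 / c) * lnorm2 (minv (L y0)) (L (y - ?z)))"
    unfolding inv lnorm2_def using Yi(1) V
    by (simp add: mult_smult_assoc_mat[of _ m m _ m] mult_smult_distrib[of _ m m _ m]
        mat_trace_smult[of _ m] mult_carrier_mat[of _ m m _ m])
  also have "\<dots> < 1" using close c by (simp add: power2_eq_square field_simps)
  finally have cl: "lnorm2 (minv (L ?z)) (L (y - ?z)) < 1" .
  show "posdef (L y)" by (rule certificate_perturbation(1)[OF z pz y s sj cl])
  obtain Hinv where H: "mat_inverse (hessian n logdet_barrier y) = Some Hinv" "psd (L (Hinv *\<^sub>v ?s))"
    using certificate_perturbation(2)[OF z pz y s sj cl] by blast
  have Hc: "Hinv \<in> carrier_mat n n" using mat_inverse(2)[OF hessian_carrier H(1)] by simp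
  have Ht: "Hinv *\<^sub>v t \<in> carrier_vec n" using Hc t(1) by simp
  have "Hinv *\<^sub>v ?s = (1 / c) \<cdot>\<^sub>v (Hinv *\<^sub>v t)" using Hc t(1) by (rule mult_mat_vec)
  then have "L (Hinv *\<^sub>v ?s) = (1 / c) \<cdot>\<^sub>m L (Hinv *\<^sub>v t)" using Ht by (simp add: L_smult)
  then have "psd (L (Hinv *\<^sub>v t))" using H(2) c by (simp add: psd_def qform_smult zero_le_divide_iff)
  with H(1) Ht show "\<exists>Hinv. mat_inverse (hessian n logdet_barrier y) = Some Hinv
      \<and> Hinv *\<^sub>v t \<in> carrier_vec n \<and> psd (L (Hinv *\<^sub>v t))" by blast
qed

end

subsection \<open>The dual of the weighted sum-of-squares cone\<close>

lemma coeff_vec_carrier [simp]: "coeff_vec D p \<in> carrier_vec (D + 1)"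
  by (simp add: coeff_vec_def)

lemma scalar_prod_sum_atMost:
  "x \<in> carrier_vec (D + 1) \<Longrightarrow> (v :: real vec) \<bullet> x = (\<Sum>j\<le>D. v $ j * x $ j)"
  by (simp add: scalar_prod_def atLeast0LessThan lessThan_Suc_atMost)

lemma coeff_vec_scalar_prod:
  "x \<in> carrier_vec (D + 1) \<Longrightarrow> coeff_vec D p \<bullet> x = (\<Sum>j\<le>D. coeff p j * x $ j)"
  by (simp add: scalar_prod_sum_atMost coeff_vec_def)

lemma sum_abs_coeff_le_l1norm: "(\<Sum>j\<le>D. \<bar>coeff p j\<bar>) \<le> l1norm p"
proof (induction p arbitrary: D)
  case (pCons a p)
  show ?case
    using pCons.IH by (cases D) (simp_all add: sum.atMost_Suc_shift del: sum.atMost_Suc)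
qed simp

text \<open>The defining identity of the map equates two polynomials in \<open>z\<close> of degree
  at most \<open>D\<close> for every \<open>z\<close>; comparing coefficients determines the
  map.\<close>

lemma is_Lambda_index:
  assumes L: "is_Lambda D w ps L" and x: "x \<in> carrier_vec (D + 1)" and ab: "a < length ps" "b < length ps"
    and deg: "degree (w * ps ! a * ps ! b) \<le> D"
  shows "L x $$ (a, b) = (\<Sum>j\<le>D. coeff (w * ps ! a * ps ! b) j * x $ j)"
proof -
  define c where "c j = L (unit_vec (D + 1) j) $$ (a, b)" for j
  note ex = is_Lambda_expand[OF L _ ab, folded c_def]
  have "(\<Sum>j\<le>D. (c j - coeff (w * ps ! a * ps ! b) j) * z ^ j) = 0" for z
  proof -
    have "L (monomial_vec D z) = poly w z \<cdot>\<^sub>m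
        Matrix.mat (length ps) (length ps) (\<lambda>(a, b). poly (ps ! a) z * poly (ps ! b) z)"
      using L by (simp add: is_Lambda_def)
    then have "L (monomial_vec D z) $$ (a, b) = poly (w * ps ! a * ps ! b) z" using ab by simp
    moreover have "L (monomial_vec D z) $$ (a, b) = (\<Sum>j\<le>D. z ^ j * c j)"
      by (subst ex) (auto simp: monomial_vec_def)
    moreover have "poly (w * ps ! a * ps ! b) z = (\<Sum>j\<le>D. coeff (w * ps ! a * ps ! b) j * z ^ j)"
      unfolding poly_altdef by (rule sum.mono_neutral_left) (use deg in \<open>auto simp: coeff_eq_0\<close>)
    ultimately show ?thesis by (simp add: algebra_simps sum_subtractf)
  qed
  then have "\<forall>j\<le>D. c j - coeff (w * ps ! a * ps ! b) j = 0"
    using polyfun_eq_0[of "\<lambda>j. c j - coeff (w * ps ! a * ps ! b) j" D] by blast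
  then show ?thesis unfolding ex[OF x] by (intro sum.cong) auto
qed

definition poly_comb :: "real poly list \<Rightarrow> (nat \<Rightarrow> real) \<Rightarrow> real poly" where
  "poly_comb ps u = (\<Sum>a<length ps. Polynomial.smult (u a) (ps ! a))"

text \<open>The quadratic form of \<open>L x\<close> is the pairing of \<open>x\<close> with
  weighted squares, the link between semidefiniteness and the dual cone.\<close>

lemma qform_is_Lambda:
  assumes L: "is_Lambda D w ps L" and x: "x \<in> carrier_vec (D + 1)"
    and deg: "\<And>p q. p \<in> set ps \<Longrightarrow> q \<in> set ps \<Longrightarrow> degree (w * p * q) \<le> D"
  shows "qform (L x) u u = coeff_vec D (w * (poly_comb ps u)\<^sup>2) \<bullet> x"
proof -
  let ?k = "length ps"
  have car: "L x \<in> carrier_mat ?k ?k" using L x by (auto simp: is_Lambda_def)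
  have sq: "w * (poly_comb ps u)\<^sup>2 = (\<Sum>a<?k. \<Sum>b<?k. Polynomial.smult (u a * u b) (w * ps ! a * ps ! b))"
    by (simp add: poly_comb_def power2_eq_square sum_product sum_distrib_left mult_ac)
  have "qform (L x) u u
      = (\<Sum>a<?k. \<Sum>b<?k. \<Sum>j\<le>D. u a * u b * coeff (w * ps ! a * ps ! b) j * x $ j)"
    using car by (auto simp: qform_def is_Lambda_index[OF L x _ _ deg] sum_distrib_left sum_distrib_right mult_ac
        intro!: sum.cong)
  also have "\<dots> = (\<Sum>j\<le>D. \<Sum>a<?k. \<Sum>b<?k. u a * u b * coeff (w * ps ! a * ps ! b) j * x $ j)"
    by (simp only: sum.swap[of _ "{..D}"])
  finally show ?thesis
    by (simp add: coeff_vec_scalar_prod[OF x] sq coeff_sum sum_distrib_right)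
qed

lemma poly_vector_space: "vector_space (Polynomial.smult :: real \<Rightarrow> real poly \<Rightarrow> real poly)"
  by standard (auto simp: smult_add_right smult_add_left)

lemma sum_set_nth:
  assumes "distinct ps"
  shows "(\<Sum>p\<in>set ps. f p) = (\<Sum>a<length ps. f (ps ! a))"
  using sum.reindex_bij_betw[OF bij_betw_nth[OF assms refl refl], of f] by simp

text \<open>Translates span and independence, which are notions for sets, into statements about
  coefficient functions along the list. The bound on the length is used for
  \<open>\<nu>\<close>.\<close>

lemma ordered_basis_poly_comb:
  assumes "ordered_basis k ps"
  shows "range (poly_comb ps) = polys_upto k"
    and "poly_comb ps u = 0 \<Longrightarrow> a < length ps \<Longrightarrow> u a = 0"
    and "length ps \<le> k + 1"
    and "p \<in> set ps \<Longrightarrow> degree p \<le> k"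
proof -
  interpret pv: vector_space "Polynomial.smult :: real \<Rightarrow> real poly \<Rightarrow> real poly"
    by (rule poly_vector_space)
  have b: "distinct ps" "\<not> pv.dependent (set ps)" "pv.span (set ps) = polys_upto k"
    using assms by (auto simp: ordered_basis_def)
  have idx: "\<exists>i<length ps. p = ps ! i" if "p \<in> set ps" for p using that by (metis in_set_conv_nth)
  have sub: "poly_comb ps u \<in> polys_upto k" for u
    unfolding b(3)[symmetric] poly_comb_def by (intro pv.span_sum pv.span_scale pv.span_base) auto
  show "range (poly_comb ps) = polys_upto k"
  proof (intro equalityI subsetI)
    fix p assume "p \<in> polys_upto k"
    then obtain v where "p = (\<Sum>q\<in>set ps. Polynomial.smult (v q) q)"
      unfolding b(3)[symmetric] pv.span_finite[OF finite_set] by blast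
    then have "p = poly_comb ps (\<lambda>a. v (ps ! a))"
      unfolding poly_comb_def sum_set_nth[OF b(1)] .
    then show "p \<in> range (poly_comb ps)" by blast
  qed (use sub in auto)
  show "u a = 0" if z: "poly_comb ps u = 0" and a: "a < length ps"
  proof (rule ccontr)
    assume ua: "u a \<noteq> 0"
    \<comment> \<open>Distinctness makes the index of a list element unique, so \<open>v\<close>
      carries \<open>u\<close> over to the set of basis elements.\<close>
    define v where "v p = u (THE i. i < length ps \<and> ps ! i = p)" for p
    have v: "v (ps ! i) = u i" if "i < length ps" for i
      using that b(1) unfolding v_def
      by (intro arg_cong[where f = u] the_equality) (auto simp: nth_eq_iff_index_eq)
    have "(\<Sum>q\<in>set ps. Polynomial.smult (v q) q) = 0"
      unfolding sum_set_nth[OF b(1)] using z v by (simp add: poly_comb_def)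
    moreover have "\<exists>q\<in>set ps. v q \<noteq> 0" using ua a v by (metis nth_mem)
    ultimately have "pv.dependent (set ps)" unfolding pv.dependent_finite[OF finite_set] by blast
    with b(2) show False by simp
  qed
  show "length ps \<le> k + 1"
  proof -
    let ?T = "(\<lambda>i. monom (1 :: real) i) ` {..k}"
    have "set ps \<subseteq> pv.span ?T"
    proof
      fix p assume "p \<in> set ps"
      then have "degree p \<le> k" using pv.span_base[of p "set ps"] b(3) by (auto simp: polys_upto_def)
      then have "p = (\<Sum>i\<le>k. Polynomial.smult (coeff p i) (monom 1 i))"
        using poly_as_sum_of_monoms'[of p k] by (simp add: smult_monom)
      moreover have "(\<Sum>i\<le>k. Polynomial.smult (coeff p i) (monom 1 i)) \<in> pv.span ?T"
        by (intro pv.span_sum pv.span_scale pv.span_base) auto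
      ultimately show "p \<in> pv.span ?T" by simp
    qed
    then have "card (set ps) \<le> card ?T"
      using pv.independent_span_bound[of ?T "set ps"] b(2) by blast
    also have "\<dots> \<le> k + 1" using card_image_le[of "{..k}" "\<lambda>i. monom (1 :: real) i"] by simp
    finally show ?thesis using b(1) by (simp add: distinct_card)
  qed
  show "degree p \<le> k" if "p \<in> set ps"
    using that pv.span_base[of p "set ps"] b(3) by (auto simp: polys_upto_def)
qed

lemma degree_weights:
  assumes "D \<ge> 1"
  shows "degree (weight1 D) + 2 * deg1 D \<le> D" "degree (weight2 D) + 2 * deg2 D \<le> D"
  using assms by (auto simp: weight1_def weight2_def deg1_def deg2_def elim!: evenE oddE)

lemma degree_weighted_mult:
  assumes "degree w + 2 * k \<le> D" "degree p \<le> k" "degree q \<le> k"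
  shows "degree (w * p * q :: real poly) \<le> D"
  using assms degree_mult_le[of "w * p" q] degree_mult_le[of w p] by linarith

section \<open>Block matrices with two blocks\<close>

lemma diag_block_two:
  assumes "A \<in> carrier_mat n n" "B \<in> carrier_mat k k"
  shows "diag_block_mat [A, B] \<in> carrier_mat (n + k) (n + k)"
    and "i < n + k \<Longrightarrow> j < n + k \<Longrightarrow> diag_block_mat [A, B] $$ (i, j) =
      (if i < n then if j < n then A $$ (i, j) else 0 else if j < n then 0 else B $$ (i - n, j - n))"
  using assms by (auto simp: Let_def)

lemma qform_diag_block_two:
  assumes "A \<in> carrier_mat n n" "B \<in> carrier_mat k k"
  shows "qform (diag_block_mat [A, B]) u u = qform A u u + qform B (\<lambda>i. u (n + i)) (\<lambda>i. u (n + i))"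
proof -
  let ?M = "diag_block_mat [A, B]"
  note M = diag_block_two[OF assms]
  have split: "(\<Sum>i<n + k. f i) = (\<Sum>i<n. f i) + (\<Sum>i<k. f (n + i))" for f :: "nat \<Rightarrow> real"
    by (induction k) (simp_all add: add.assoc)
  have 1: "(\<Sum>j<n + k. u i * ?M $$ (i, j) * u j) = (\<Sum>j<n. u i * A $$ (i, j) * u j)" if "i < n" for i
  proof -
    have "(\<Sum>j<n. u i * ?M $$ (i, j) * u j) = (\<Sum>j<n. u i * A $$ (i, j) * u j)"
      using M(2)[of i] that by (intro sum.cong refl) (auto simp del: diag_block_mat.simps)
    moreover have "(\<Sum>j<k. u i * ?M $$ (i, n + j) * u (n + j)) = 0"
      using M(2)[of i] that by (intro sum.neutral) (auto simp del: diag_block_mat.simps)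
    ultimately show ?thesis unfolding split by simp
  qed
  have 2: "(\<Sum>j<n + k. u (n + i) * ?M $$ (n + i, j) * u j) = (\<Sum>j<k. u (n + i) * B $$ (i, j) * u (n + j))"
    if "i < k" for i
  proof -
    have "(\<Sum>j<n. u (n + i) * ?M $$ (n + i, j) * u j) = 0"
      using M(2)[of "n + i"] that by (intro sum.neutral) (auto simp del: diag_block_mat.simps)
    moreover have "(\<Sum>j<k. u (n + i) * ?M $$ (n + i, n + j) * u (n + j)) = (\<Sum>j<k. u (n + i) * B $$ (i, j) * u (n + j))"
      using M(2)[of "n + i"] that by (intro sum.cong refl) (auto simp del: diag_block_mat.simps)
    ultimately show ?thesis unfolding split by simp
  qed
  have dims: "dim_row ?M = n + k" "dim_col ?M = n + k" using M(1) by (rule carrier_matD)+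
  have "qform ?M u u = (\<Sum>i<n + k. \<Sum>j<n + k. u i * ?M $$ (i, j) * u j)"
    unfolding qform_def dims ..
  also have "\<dots> = (\<Sum>i<n. \<Sum>j<n + k. u i * ?M $$ (i, j) * u j)
      + (\<Sum>i<k. \<Sum>j<n + k. u (n + i) * ?M $$ (n + i, j) * u j)" by (rule split)
  also have "\<dots> = (\<Sum>i<n. \<Sum>j<n. u i * A $$ (i, j) * u j)
      + (\<Sum>i<k. \<Sum>j<k. u (n + i) * B $$ (i, j) * u (n + j))"
    by (rule arg_cong2[where f = "(+)"]; rule sum.cong[OF refl]) (simp_all add: 1 2 del: diag_block_mat.simps)
  finally show ?thesis using assms by (simp add: qform_def)
qed

lemma psd_diag_block_two:
  assumes "A \<in> carrier_mat n n" "B \<in> carrier_mat k k"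
  shows "psd (diag_block_mat [A, B]) \<longleftrightarrow> psd A \<and> psd B"
proof
  assume M: "psd (diag_block_mat [A, B])"
  have "0 \<le> qform A u u" for u
  proof -
    define v where "v i = (if i < n then u i else 0)" for i
    have "qform A v v = qform A u u" using assms by (intro qform_cong) (auto simp: v_def)
    moreover have "qform B (\<lambda>i. v (n + i)) (\<lambda>i. v (n + i)) = 0" by (simp add: v_def qform_def)
    ultimately show ?thesis using M qform_diag_block_two[OF assms, of v] unfolding psd_def by (metis add.right_neutral)
  qed
  moreover have "0 \<le> qform B u u" for u
  proof -
    define v where "v i = (if i < n then 0 else u (i - n))" for i
    have "qform A v v = 0" using assms by (auto simp: v_def qform_def intro!: sum.neutral)
    moreover have "qform B (\<lambda>i. v (n + i)) (\<lambda>i. v (n + i)) = qform B u u" by (simp add: v_def)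
    ultimately show ?thesis using M qform_diag_block_two[OF assms, of v] unfolding psd_def by (metis add.left_neutral)
  qed
  ultimately show "psd A \<and> psd B" by (simp add: psd_def)
next
  assume "psd A \<and> psd B"
  then show "psd (diag_block_mat [A, B])"
    unfolding psd_def qform_diag_block_two[OF assms] by (simp add: add_nonneg_nonneg)
qed

section \<open>The matrix pencil of the cone\<close>

locale wsos_pencil =
  fixes D :: nat and p1 p2 :: "real poly list" and L1 L2 :: "real vec \<Rightarrow> real mat"
  assumes D: "D \<ge> 1"
    and p1: "ordered_basis (deg1 D) p1" and p2: "ordered_basis (deg2 D) p2"
    and L1: "is_Lambda D (weight1 D) p1 L1" and L2: "is_Lambda D (weight2 D) p2 L2"
begin

abbreviation \<Lambda> :: "real vec \<Rightarrow> real mat" where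
  "\<Lambda> x \<equiv> diag_block_mat [L1 x, L2 x]"

abbreviation \<nu> :: nat where "\<nu> \<equiv> length p1 + length p2"

lemma block_carrier:
  assumes "x \<in> carrier_vec (D + 1)"
  shows "L1 x \<in> carrier_mat (length p1) (length p1)" "L2 x \<in> carrier_mat (length p2) (length p2)"
    "\<Lambda> x \<in> carrier_mat \<nu> \<nu>"
proof -
  show c: "L1 x \<in> carrier_mat (length p1) (length p1)" "L2 x \<in> carrier_mat (length p2) (length p2)"
    using L1 L2 assms by (auto simp: is_Lambda_def)
  show "\<Lambda> x \<in> carrier_mat \<nu> \<nu>" by (rule diag_block_two(1)[OF c])
qed

lemma qform_block:
  assumes "x \<in> carrier_vec (D + 1)"
  shows "qform (L1 x) u u = coeff_vec D (weight1 D * (poly_comb p1 u)\<^sup>2) \<bullet> x"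
    and "qform (L2 x) u u = coeff_vec D (weight2 D * (poly_comb p2 u)\<^sup>2) \<bullet> x"
proof -
  show "qform (L1 x) u u = coeff_vec D (weight1 D * (poly_comb p1 u)\<^sup>2) \<bullet> x"
    using degree_weighted_mult[OF degree_weights(1)[OF D]] ordered_basis_poly_comb(4)[OF p1]
    by (intro qform_is_Lambda[OF L1 assms]) blast
  show "qform (L2 x) u u = coeff_vec D (weight2 D * (poly_comb p2 u)\<^sup>2) \<bullet> x"
    using degree_weighted_mult[OF degree_weights(2)[OF D]] ordered_basis_poly_comb(4)[OF p2]
    by (intro qform_is_Lambda[OF L2 assms]) blast
qed

text \<open>The combinations of a basis exhaust \<open>polys_upto k\<close>, so each block is
  semidefinite exactly when \<open>x\<close> is nonnegative on the corresponding weighted squares;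
  additivity passes to sums of squares. The right-hand side is free of the bases.\<close>

lemma psd_\<Lambda>_iff:
  assumes x: "x \<in> carrier_vec (D + 1)"
  shows "psd (\<Lambda> x) \<longleftrightarrow> x \<in> dual_cone (D + 1) (wsos_cone D)"
proof -
  have range: "(\<forall>u. 0 \<le> coeff_vec D (w * (poly_comb ps u)\<^sup>2) \<bullet> x)
      \<longleftrightarrow> (\<forall>g\<in>polys_upto k. 0 \<le> coeff_vec D (w * g\<^sup>2) \<bullet> x)" if "ordered_basis k ps" for w k ps
    unfolding ordered_basis_poly_comb(1)[OF that, symmetric] by simp
  have lin: "coeff_vec D (p + q) \<bullet> x = coeff_vec D p \<bullet> x + coeff_vec D q \<bullet> x" for p q
    by (simp add: coeff_vec_scalar_prod[OF x] sum.distrib distrib_right)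
  have sos: "0 \<le> coeff_vec D (w * s) \<bullet> x"
    if "s \<in> sos k" "\<And>g. g \<in> polys_upto k \<Longrightarrow> 0 \<le> coeff_vec D (w * g\<^sup>2) \<bullet> x" for w s k
  proof -
    obtain gs where gs: "s = sum_list (map (\<lambda>g. g\<^sup>2) gs)" "set gs \<subseteq> polys_upto k"
      using \<open>s \<in> sos k\<close> by (auto simp: sos_def)
    show ?thesis unfolding gs(1) using gs(2)
    proof (induction gs)
      case Nil
      then show ?case by (simp add: coeff_vec_scalar_prod[OF x])
    next
      case (Cons g gs)
      then show ?case using that(2)[of g] by (simp add: distrib_left lin)
    qed
  qed
  have "psd (\<Lambda> x) \<longleftrightarrow> psd (L1 x) \<and> psd (L2 x)" by (rule psd_diag_block_two[OF block_carrier(1,2)[OF x]])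
  also have "\<dots> \<longleftrightarrow> (\<forall>g\<in>polys_upto (deg1 D). 0 \<le> coeff_vec D (weight1 D * g\<^sup>2) \<bullet> x)
      \<and> (\<forall>g\<in>polys_upto (deg2 D). 0 \<le> coeff_vec D (weight2 D * g\<^sup>2) \<bullet> x)"
    unfolding psd_def qform_block[OF x] range[OF p1] range[OF p2] ..
  also have "\<dots> \<longleftrightarrow> x \<in> dual_cone (D + 1) (wsos_cone D)" (is "?l \<longleftrightarrow> ?r")
  proof
    assume l: ?l
    then have "0 \<le> coeff_vec D (weight1 D * s1 + weight2 D * s2) \<bullet> x"
      if "s1 \<in> sos (deg1 D)" "s2 \<in> sos (deg2 D)" for s1 s2
      unfolding lin using sos[OF that(1), of "weight1 D"] sos[OF that(2), of "weight2 D"] by auto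
    then show ?r using x by (auto simp: dual_cone_def wsos_cone_def wsos_polys_def)
  next
    assume r: ?r
    have "coeff_vec D (weight1 D * g\<^sup>2) \<in> wsos_cone D" if "g \<in> polys_upto (deg1 D)" for g
    proof -
      have "weight1 D * g\<^sup>2 + weight2 D * 0 \<in> wsos_polys D"
        using that sos_square[of g "deg1 D"] sos_0 unfolding wsos_polys_def polys_upto_def by blast
      then show ?thesis by (simp add: wsos_cone_def)
    qed
    moreover have "coeff_vec D (weight2 D * g\<^sup>2) \<in> wsos_cone D" if "g \<in> polys_upto (deg2 D)" for g
    proof -
      have "weight1 D * 0 + weight2 D * g\<^sup>2 \<in> wsos_polys D"
        using that sos_square[of g "deg2 D"] sos_0 unfolding wsos_polys_def polys_upto_def by blast
      then show ?thesis by (simp add: wsos_cone_def)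
    qed
    ultimately show ?l using r by (auto simp: dual_cone_def)
  qed
  finally show ?thesis .
qed

lemma dual_coneD:
  assumes "x \<in> dual_cone (D + 1) (wsos_cone D)" "degree p \<le> D" "\<And>z. z \<in> {-1..1} \<Longrightarrow> poly p z \<ge> 0"
  shows "(\<Sum>j\<le>D. coeff p j * x $ j) \<ge> 0"
proof -
  have x: "x \<in> carrier_vec (D + 1)" using assms(1) by (simp add: dual_cone_def)
  have "coeff_vec D p \<in> wsos_cone D" using wsos_cone_eq_nonneg[OF D] assms(2,3) by blast
  then have "0 \<le> coeff_vec D p \<bullet> x" using assms(1) by (auto simp: dual_cone_def)
  then show ?thesis by (simp only: coeff_vec_scalar_prod[OF x])
qed

text \<open>The test polynomials \<open>1 + z ^ j\<close> and \<open>1 - z ^ j\<close> are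
  nonnegative on \<open>[-1, 1]\<close>.\<close>

lemma dual_cone_abs_le:
  assumes x: "x \<in> dual_cone (D + 1) (wsos_cone D)" and j: "j \<le> D"
  shows "\<bar>x $ j\<bar> \<le> x $ 0"
proof -
  have "0 \<le> (\<Sum>i\<le>D. coeff (1 + monom c j) i * x $ i)" if "\<bar>c\<bar> = 1" for c
  proof (rule dual_coneD[OF x])
    show "degree (1 + monom c j) \<le> D" using j by (intro degree_add_le) (auto intro: order_trans[OF degree_monom_le])
    fix z :: real assume "z \<in> {-1..1}"
    then have "\<bar>c * z ^ j\<bar> \<le> 1" using that by (simp add: abs_mult power_abs power_le_one abs_le_iff)
    then show "0 \<le> poly (1 + monom c j) z" by (simp add: poly_monom abs_le_iff)
  qed
  moreover have "(\<Sum>i\<le>D. coeff (1 + monom c j) i * x $ i) = x $ 0 + c * x $ j" for c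
  proof -
    have "(\<Sum>i\<le>D. coeff (1 + monom c j) i * x $ i)
        = (\<Sum>i\<le>D. (if i = 0 then x $ 0 else 0) + (if i = j then c * x $ j else 0))"
      by (intro sum.cong) (auto simp: one_pCons coeff_pCons distrib_right split: nat.splits)
    then show ?thesis using j by (simp add: sum.distrib)
  qed
  ultimately have "0 \<le> x $ 0 + c * x $ j" if "\<bar>c\<bar> = 1" for c using that by simp
  from this[of 1] this[of "-1"] show ?thesis by (simp add: abs_le_iff)
qed

lemma \<Lambda>_add:
  assumes "x \<in> carrier_vec (D + 1)" "y \<in> carrier_vec (D + 1)"
  shows "\<Lambda> (x + y) = \<Lambda> x + \<Lambda> y"
proof -
  note cx = block_carrier[OF assms(1)] and cy = block_carrier[OF assms(2)]
  have xy: "x + y \<in> carrier_vec (D + 1)" using assms by simp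
  have "L1 (x + y) = L1 x + L1 y" "L2 (x + y) = L2 x + L2 y" using L1 L2 assms by (auto simp: is_Lambda_def)
  note L = this and cxy = block_carrier[OF xy]
  show ?thesis
  proof (rule eq_matI)
    fix i j assume "i < dim_row (\<Lambda> x + \<Lambda> y)" "j < dim_col (\<Lambda> x + \<Lambda> y)"
    then have ij: "i < \<nu>" "j < \<nu>" using cy(3) by (auto simp del: diag_block_mat.simps)
    have "(\<Lambda> x + \<Lambda> y) $$ (i, j) = \<Lambda> x $$ (i, j) + \<Lambda> y $$ (i, j)"
      using ij cy(3) by (auto simp del: diag_block_mat.simps)
    then show "\<Lambda> (x + y) $$ (i, j) = (\<Lambda> x + \<Lambda> y) $$ (i, j)"
      unfolding diag_block_two(2)[OF cx(1,2) ij] diag_block_two(2)[OF cy(1,2) ij]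
        diag_block_two(2)[OF cxy(1,2) ij] unfolding L using ij cy by auto
  qed (use cxy(3) cx(3) cy(3) in \<open>auto simp del: diag_block_mat.simps\<close>)
qed

lemma \<Lambda>_smult:
  assumes "x \<in> carrier_vec (D + 1)"
  shows "\<Lambda> (c \<cdot>\<^sub>v x) = c \<cdot>\<^sub>m \<Lambda> x"
proof -
  note cx = block_carrier[OF assms]
  have cc: "c \<cdot>\<^sub>v x \<in> carrier_vec (D + 1)" using assms by simp
  have "L1 (c \<cdot>\<^sub>v x) = c \<cdot>\<^sub>m L1 x" "L2 (c \<cdot>\<^sub>v x) = c \<cdot>\<^sub>m L2 x" using L1 L2 assms by (auto simp: is_Lambda_def)
  note L = this and ccx = block_carrier[OF cc]
  show ?thesis
  proof (rule eq_matI)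
    fix i j assume "i < dim_row (c \<cdot>\<^sub>m \<Lambda> x)" "j < dim_col (c \<cdot>\<^sub>m \<Lambda> x)"
    then have ij: "i < \<nu>" "j < \<nu>" using cx(3) by (auto simp del: diag_block_mat.simps)
    have "(c \<cdot>\<^sub>m \<Lambda> x) $$ (i, j) = c * \<Lambda> x $$ (i, j)"
      using ij cx(3) by (auto simp del: diag_block_mat.simps)
    then show "\<Lambda> (c \<cdot>\<^sub>v x) $$ (i, j) = (c \<cdot>\<^sub>m \<Lambda> x) $$ (i, j)"
      unfolding diag_block_two(2)[OF cx(1,2) ij] diag_block_two(2)[OF ccx(1,2) ij]
      unfolding L using ij cx by auto
  qed (use ccx(3) cx(3) in \<open>auto simp del: diag_block_mat.simps\<close>)
qed

lemma \<Lambda>_sym: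
  assumes "x \<in> carrier_vec (D + 1)"
  shows "(\<Lambda> x)\<^sup>T = \<Lambda> x"
proof -
  note cx = block_carrier[OF assms]
  have "(L1 x)\<^sup>T = L1 x" "(L2 x)\<^sup>T = L2 x" using L1 L2 assms by (auto simp: is_Lambda_def)
  then have "L1 x $$ (j, i) = L1 x $$ (i, j)" if "i < length p1" "j < length p1" for i j
    using cx that by (metis carrier_matD index_transpose_mat(1))
  moreover have "L2 x $$ (j, i) = L2 x $$ (i, j)" if "i < length p2" "j < length p2" for i j
    using \<open>(L2 x)\<^sup>T = L2 x\<close> cx that by (metis carrier_matD index_transpose_mat(1))
  ultimately show ?thesis using diag_block_two(2)[OF cx(1,2)] cx
    by (intro eq_matI) (auto simp del: diag_block_mat.simps)
qed

text \<open>The dual cone is pointed: if \<open>\<Lambda> x\<close> vanishes, then \<open>x\<close>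
  and its negative both lie in the cone, and the absolute value of every coordinate is at most
  \<open>x $ 0\<close> and at most \<open>- x $ 0\<close>.\<close>

lemma \<Lambda>_inj:
  assumes x: "x \<in> carrier_vec (D + 1)" and z: "\<Lambda> x = 0\<^sub>m \<nu> \<nu>"
  shows "x = 0\<^sub>v (D + 1)"
proof -
  let ?K = "dual_cone (D + 1) (wsos_cone D)"
  have nx: "(- 1) \<cdot>\<^sub>v x \<in> carrier_vec (D + 1)" using x by simp
  have "psd (0\<^sub>m \<nu> \<nu>)" by (simp add: psd_def qform_def)
  moreover have "\<Lambda> ((- 1) \<cdot>\<^sub>v x) = 0\<^sub>m \<nu> \<nu>" unfolding \<Lambda>_smult[OF x] z by (intro eq_matI) auto
  ultimately have "x \<in> ?K" "(- 1) \<cdot>\<^sub>v x \<in> ?K"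
    using psd_\<Lambda>_iff[OF x] psd_\<Lambda>_iff[OF nx] z by simp_all
  then have "\<bar>x $ j\<bar> \<le> x $ 0" "\<bar>x $ j\<bar> \<le> - x $ 0" if "j \<le> D" for j
    using dual_cone_abs_le[OF _ that] x that by fastforce+
  then have "x $ j = 0" if "j \<le> D" for j using that by fastforce
  then show ?thesis using x by (intro eq_vecI) auto
qed

sublocale sym_pencil "D + 1" \<nu> \<Lambda>
proof (rule sym_pencil.intro)
  show "\<And>x. x \<in> carrier_vec (D + 1) \<Longrightarrow> \<Lambda> x \<in> carrier_mat \<nu> \<nu>" by (rule block_carrier(3))
  show "\<And>x. x \<in> carrier_vec (D + 1) \<Longrightarrow> (\<Lambda> x)\<^sup>T = \<Lambda> x" by (rule \<Lambda>_sym)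
  show "\<And>x y. x \<in> carrier_vec (D + 1) \<Longrightarrow> y \<in> carrier_vec (D + 1) \<Longrightarrow> \<Lambda> (x + y) = \<Lambda> x + \<Lambda> y"
    by (rule \<Lambda>_add)
  show "\<And>x c. x \<in> carrier_vec (D + 1) \<Longrightarrow> \<Lambda> (c \<cdot>\<^sub>v x) = c \<cdot>\<^sub>m \<Lambda> x" by (rule \<Lambda>_smult)
  show "\<And>x. x \<in> carrier_vec (D + 1) \<Longrightarrow> \<Lambda> x = 0\<^sub>m \<nu> \<nu> \<Longrightarrow> x = 0\<^sub>v (D + 1)" by (rule \<Lambda>_inj)
qed

text \<open>\<open>\<nu>\<close> is the level of the section on which the determinant is maximised,
  so it has to be positive; its upper bound enters the size of the maximiser.\<close>

lemma \<nu>_bounds: "1 \<le> \<nu>" "\<nu> \<le> 2 * (D + 1)"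
proof -
  have "deg1 D \<le> D" "deg2 D \<le> D" by (auto simp: deg1_def deg2_def)
  then have "length p1 \<le> D + 1" "length p2 \<le> D + 1"
    using ordered_basis_poly_comb(3)[OF p1] ordered_basis_poly_comb(3)[OF p2] by auto
  then show "\<nu> \<le> 2 * (D + 1)" by simp
  have "p1 \<noteq> []"
  proof
    assume "p1 = []"
    then have "poly_comb p1 u = 0" for u by (simp add: poly_comb_def)
    moreover have "(1 :: real poly) \<in> range (poly_comb p1)"
      unfolding ordered_basis_poly_comb(1)[OF p1] by (simp add: polys_upto_def)
    ultimately show False by auto
  qed
  then show "1 \<le> \<nu>" by (simp add: Suc_le_eq)
qed

lemma posdef_imp_interior:
  assumes "x \<in> carrier_vec (D + 1)" "posdef (\<Lambda> x)"
  shows "x \<in> vec_interior (D + 1) (dual_cone (D + 1) (wsos_cone D))"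
proof -
  obtain \<epsilon> where \<epsilon>: "\<epsilon> > 0" "\<And>y. y \<in> carrier_vec (D + 1) \<Longrightarrow>
      L2_set (\<lambda>i. y $ i - x $ i) {..<D + 1} < \<epsilon> \<Longrightarrow> psd (\<Lambda> y)"
    using posdef_neighbourhood[OF assms] by blast
  have "y \<in> dual_cone (D + 1) (wsos_cone D)"
    if "y \<in> carrier_vec (D + 1)" "L2_set (\<lambda>i. y $ i - x $ i) {..<D + 1} < \<epsilon>" for y
    using \<epsilon>(2)[OF that] psd_\<Lambda>_iff[OF that(1)] by blast
  then show ?thesis unfolding vec_interior_def using assms(1) \<epsilon>(1) by blast
qed

text \<open>As a functional on polynomials this is the sum of the evaluations at the
  \<open>D + 1\<close> nodes, an explicit interior point of the dual cone chosen without reference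
  to the bases.\<close>

definition node_sum :: "real vec" where
  "node_sum = Matrix.vec (D + 1) (\<lambda>j. \<Sum>k\<le>D. (real k / real D) ^ j)"

lemma node_sum_carrier: "node_sum \<in> carrier_vec (D + 1)"
  by (simp add: node_sum_def)

lemma coeff_node_sum:
  assumes "degree p \<le> D"
  shows "(\<Sum>j\<le>D. coeff p j * node_sum $ j) = (\<Sum>k\<le>D. poly p (real k / real D))"
proof -
  have "(\<Sum>j\<le>D. coeff p j * node_sum $ j) = (\<Sum>j\<le>D. \<Sum>k\<le>D. coeff p j * (real k / real D) ^ j)"
    by (intro sum.cong) (auto simp: node_sum_def sum_distrib_left)
  also have "\<dots> = (\<Sum>k\<le>D. \<Sum>j\<le>D. coeff p j * (real k / real D) ^ j)" by (rule sum.swap)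
  also have "\<dots> = (\<Sum>k\<le>D. poly p (real k / real D))"
  proof (rule sum.cong[OF refl])
    fix k
    show "(\<Sum>j\<le>D. coeff p j * (real k / real D) ^ j) = poly p (real k / real D)"
      unfolding poly_altdef by (rule sum.mono_neutral_right) (use assms in \<open>auto simp: coeff_eq_0\<close>)
  qed
  finally show ?thesis .
qed

lemma node_in_interval: "k \<le> D \<Longrightarrow> real k / real D \<in> {-1..1}"
  using D by (auto simp: field_simps)

text \<open>If \<open>p\<close> is nonnegative on \<open>[-1, 1]\<close>, its pairing with
  \<open>node_sum\<close> is at least \<open>l1norm p / (2 D) ^ D\<close> by interpolation, and this
  dominates the pairing with \<open>v\<close>. Thus \<open>node_sum\<close> is the centre of a box
  inside the dual cone.\<close>

lemma node_sum_perturbation: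
  assumes v: "v \<in> carrier_vec (D + 1)" "\<And>j. j \<le> D \<Longrightarrow> \<bar>v $ j\<bar> \<le> 1 / (2 * real D) ^ D"
  shows "psd (\<Lambda> (node_sum + v))"
proof -
  let ?r = "1 / (2 * real D) ^ D"
  have c: "node_sum + v \<in> carrier_vec (D + 1)" using v node_sum_carrier by simp
  have "0 \<le> (\<Sum>j\<le>D. coeff p j * (node_sum + v) $ j)"
    if p: "degree p \<le> D" "\<forall>z\<in>{-1..1}. 0 \<le> poly p z" for p
  proof -
    have "(\<Sum>j\<le>D. \<bar>coeff p j * v $ j\<bar>) \<le> (\<Sum>j\<le>D. \<bar>coeff p j\<bar> * ?r)"
      unfolding abs_mult using v(2) by (intro sum_mono mult_left_mono) auto
    also have "\<dots> \<le> l1norm p * ?r"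
      unfolding sum_distrib_right[symmetric] by (intro mult_right_mono sum_abs_coeff_le_l1norm) simp
    also have "\<dots> \<le> ((2 * real D) ^ D * (\<Sum>k\<le>D. \<bar>poly p (real k / real D)\<bar>)) * ?r"
      by (intro mult_right_mono l1norm_le_node_values[OF D p(1)]) simp
    also have "\<dots> = (\<Sum>k\<le>D. \<bar>poly p (real k / real D)\<bar>)" using D by simp
    also have "\<dots> = (\<Sum>k\<le>D. poly p (real k / real D))" using p(2) node_in_interval by (intro sum.cong) auto
    finally have "(\<Sum>j\<le>D. \<bar>coeff p j * v $ j\<bar>) \<le> (\<Sum>j\<le>D. coeff p j * node_sum $ j)"
      by (simp only: coeff_node_sum[OF p(1)])
    moreover have "\<bar>\<Sum>j\<le>D. coeff p j * v $ j\<bar> \<le> (\<Sum>j\<le>D. \<bar>coeff p j * v $ j\<bar>)" by (rule sum_abs)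
    moreover have "(\<Sum>j\<le>D. coeff p j * (node_sum + v) $ j)
        = (\<Sum>j\<le>D. coeff p j * node_sum $ j) + (\<Sum>j\<le>D. coeff p j * v $ j)"
      using v(1) by (simp add: sum.distrib[symmetric] distrib_left)
    ultimately show ?thesis by linarith
  qed
  then show ?thesis
    unfolding psd_\<Lambda>_iff[OF c] dual_cone_def wsos_cone_eq_nonneg[OF D]
    using c coeff_vec_scalar_prod[OF c] by auto
qed

text \<open>A weighted square whose pairing with \<open>node_sum\<close> is not positive vanishes at
  all nodes, hence identically by interpolation. Independence of the bases then makes the
  coefficient vector zero.\<close>

lemma node_sum_posdef: "posdef (\<Lambda> node_sum)"
proof -
  note c = node_sum_carrier
  have zero: "g = 0" if "degree (w * g\<^sup>2) \<le> D" "\<And>z. z \<in> {-1..1} \<Longrightarrow> poly w z \<ge> 0" "w \<noteq> 0"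
      "coeff_vec D (w * g\<^sup>2) \<bullet> node_sum \<le> 0" for w g
  proof -
    let ?s = "w * g\<^sup>2"
    have nn: "poly ?s (real k / real D) \<ge> 0" if "k \<le> D" for k
      using \<open>\<And>z. z \<in> {-1..1} \<Longrightarrow> poly w z \<ge> 0\<close>[OF node_in_interval[OF that]] by simp
    have "(\<Sum>k\<le>D. \<bar>poly ?s (real k / real D)\<bar>) = (\<Sum>k\<le>D. poly ?s (real k / real D))"
      using nn by (intro sum.cong refl abs_of_nonneg) auto
    also have "\<dots> \<le> 0" using that(4) unfolding coeff_vec_scalar_prod[OF c] coeff_node_sum[OF that(1)] .
    finally have "l1norm ?s \<le> 0"
      using l1norm_le_node_values[OF D that(1)] mult_nonneg_nonpos[of "(2 * real D) ^ D" "\<Sum>k\<le>D. \<bar>poly ?s (real k / real D)\<bar>"]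
      by auto
    then have "coeff ?s j = 0" for j using abs_coeff_le_l1norm[of ?s j] by simp
    then have "?s = 0" by (intro poly_eqI) simp
    then show "g = 0" using that(3) by simp
  qed
  have wnn: "poly (weight1 D) z \<ge> 0" "poly (weight2 D) z \<ge> 0" if "z \<in> {-1..1}" for z
  proof -
    have "z * z \<le> 1" using that by (auto simp: abs_le_iff abs_square_le_1[unfolded power2_eq_square])
    then show "poly (weight1 D) z \<ge> 0" "poly (weight2 D) z \<ge> 0"
      using that by (auto simp: weight1_def weight2_def)
  qed
  have w0: "weight1 D \<noteq> 0" "weight2 D \<noteq> 0" by (auto simp: weight1_def weight2_def)
  have dg: "degree (w * (poly_comb ps u)\<^sup>2) \<le> D"
    if "degree w + 2 * k \<le> D" "ordered_basis k ps" for w k ps u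
  proof -
    have "degree (poly_comb ps u) \<le> k"
      using ordered_basis_poly_comb(1)[OF that(2)] by (auto simp: polys_upto_def)
    then show ?thesis
      using degree_weighted_mult[OF that(1)] by (simp add: power2_eq_square mult.assoc)
  qed
  show ?thesis unfolding posdef_def
  proof (intro allI impI, rule ccontr)
    fix u :: "nat \<Rightarrow> real"
    assume "\<exists>a<dim_row (\<Lambda> node_sum). u a \<noteq> 0" and neg: "\<not> 0 < qform (\<Lambda> node_sum) u u"
    then obtain a where a: "a < \<nu>" "u a \<noteq> 0" using block_carrier(3)[OF c] by (metis carrier_matD(1))
    let ?v = "\<lambda>i. u (length p1 + i)"
    have "psd (\<Lambda> (node_sum + 0\<^sub>v (D + 1)))" by (rule node_sum_perturbation) auto
    then have "psd (L1 node_sum)" "psd (L2 node_sum)"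
      using c psd_diag_block_two[OF block_carrier(1,2)[OF c]] by auto
    moreover have "qform (L1 node_sum) u u + qform (L2 node_sum) ?v ?v \<le> 0"
      using neg unfolding qform_diag_block_two[OF block_carrier(1,2)[OF c]] by simp
    moreover from calculation(1,2) have "0 \<le> qform (L1 node_sum) u u" "0 \<le> qform (L2 node_sum) ?v ?v"
      unfolding psd_def by blast+
    ultimately have "qform (L1 node_sum) u u \<le> 0" "qform (L2 node_sum) ?v ?v \<le> 0"
      by linarith+
    then have "poly_comb p1 u = 0" "poly_comb p2 ?v = 0"
      unfolding qform_block[OF c]
      using zero[OF dg[OF degree_weights(1)[OF D] p1] wnn(1) w0(1)]
        zero[OF dg[OF degree_weights(2)[OF D] p2] wnn(2) w0(2)] by blast+
    then have "u i = 0" if "i < length p1" for i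
      using ordered_basis_poly_comb(2)[OF p1] that by blast
    moreover have "u (length p1 + i) = 0" if "i < length p2" for i
      using ordered_basis_poly_comb(2)[OF p2 \<open>poly_comb p2 ?v = 0\<close> that] .
    ultimately show False using a by (metis add_diff_inverse_nat add_less_cancel_left)
  qed
qed

end

subsection \<open>Integer dual certificates\<close>

lemma L2_set_single:
  assumes "finite A" "a \<in> A" "\<And>i. i \<in> A \<Longrightarrow> i \<noteq> a \<Longrightarrow> f i = 0"
  shows "L2_set f A = \<bar>f a\<bar>"
proof -
  have "(\<Sum>i\<in>A. (f i)\<^sup>2) = (\<Sum>i\<in>A. if i = a then (f a)\<^sup>2 else 0)"
    using assms(3) by (intro sum.cong) auto
  then show ?thesis using assms(1,2) by (simp add: L2_set_def)
qed

text \<open>The cone still contains \<open>s\<close> after \<open>\<epsilon> / 2\<close> is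
  subtracted from the constant coefficient, so \<open>s\<close> is at least
  \<open>\<epsilon> / 2\<close> on the interval.\<close>

lemma interior_wsos_cone_pos:
  assumes D: "D \<ge> 1" and deg: "degree s \<le> D"
    and int: "coeff_vec D s \<in> vec_interior (D + 1) (wsos_cone D)" and z: "z \<in> {-1..1}"
  shows "poly s z > 0"
proof -
  obtain \<epsilon> where \<epsilon>: "\<epsilon> > 0" "\<And>y. y \<in> carrier_vec (D + 1) \<Longrightarrow>
      L2_set (\<lambda>i. y $ i - coeff_vec D s $ i) {..<D + 1} < \<epsilon> \<Longrightarrow> y \<in> wsos_cone D"
    using int by (auto simp: vec_interior_def)
  have "L2_set (\<lambda>i. coeff_vec D (s - [:\<epsilon> / 2:]) $ i - coeff_vec D s $ i) {..<D + 1}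
      = \<bar>coeff_vec D (s - [:\<epsilon> / 2:]) $ 0 - coeff_vec D s $ 0\<bar>"
    by (rule L2_set_single) (auto simp: coeff_vec_def coeff_pCons split: nat.splits)
  also have "\<dots> < \<epsilon>" using \<epsilon>(1) by (simp add: coeff_vec_def)
  finally have "coeff_vec D (s - [:\<epsilon> / 2:]) \<in> wsos_cone D" by (rule \<epsilon>(2)[OF coeff_vec_carrier])
  then obtain p where p: "coeff_vec D (s - [:\<epsilon> / 2:]) = coeff_vec D p" "degree p \<le> D" "\<forall>z\<in>{-1..1}. poly p z \<ge> 0"
    unfolding wsos_cone_eq_nonneg[OF D] by blast
  have "s - [:\<epsilon> / 2:] = p"
  proof (rule poly_eqI)
    fix i
    have deg': "degree (s - [:\<epsilon> / 2:]) \<le> D" using deg by (intro degree_diff_le) auto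
    show "coeff (s - [:\<epsilon> / 2:]) i = coeff p i"
    proof (cases "i \<le> D")
      case True
      then show ?thesis using arg_cong[OF p(1), of "\<lambda>v. v $ i"] by (simp add: coeff_vec_def)
    next
      case False
      then show ?thesis
        using deg' p(2) by (simp only: coeff_eq_0[OF order.strict_trans1] not_le)
    qed
  qed
  then have "poly s z - \<epsilon> / 2 = poly p z" by auto
  then show ?thesis using p(3) z \<epsilon>(1) by fastforce
qed

context wsos_pencil
begin

text \<open>With \<open>T = t . node_sum\<close> and \<open>W = (2 D) ^ D\<close>, a rounding error
  with coordinates at most 1 has squared local norm at most
  \<open>2 (T W)\<^sup>2 < (2 T W)\<^sup>2\<close>. Since \<open>T \<le> (D + 1)\<^sup>2 b\<close>,
  this quantity is below \<open>N\<^sup>2\<close>. \<open>B\<close> bounds the reciprocal of the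
  minimum of \<open>t\<close> on \<open>[-1, 1]\<close>.\<close>

lemma integer_dual_certificate:
  fixes t :: "int vec" and b :: int
  assumes t: "t \<in> carrier_vec (D + 1)" and int: "real_vec t \<in> vec_interior (D + 1) (wsos_cone D)"
    and b: "\<And>j. j \<le> D \<Longrightarrow> \<bar>t $ j\<bar> \<le> b" "b \<ge> 1"
  defines "N \<equiv> 2 * (real D + 1)\<^sup>2 * real_of_int b * (2 * real D) ^ D"
    and "B \<equiv> real_of_int (fact (2 * D) * ((int D + 1) * b) ^ (2 * D))"
  obtains y :: "int vec" where "y \<in> carrier_vec (D + 1)" "dual_certificate D L1 L2 (real_vec t) (real_vec y)"
    "max_norm (real_vec y) \<le> N * (2 * (real D + 1) * B) + 1"
proof -
  define p where "p = (\<Sum>j\<le>D. monom (t $ j) j)"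
  have cp: "coeff p i = (if i \<le> D then t $ i else 0)" for i by (simp add: p_def coeff_sum)
  have degp: "degree p \<le> D" by (rule degree_le) (simp add: cp)
  define s :: "real poly" where "s = of_int_poly p"
  have degs: "degree s \<le> D" using degp by (simp add: s_def)
  have rt: "real_vec t \<in> carrier_vec (D + 1)" using t by (simp add: real_vec_def)
  have cs: "coeff s j = real_of_int (t $ j)" "real_vec t $ j = real_of_int (t $ j)" if "j \<le> D" for j
    using that t by (simp_all add: s_def cp real_vec_def)
  have ts: "real_vec t = coeff_vec D s"
    using rt cs by (intro eq_vecI) (auto simp: coeff_vec_def)
  have pos: "poly s z > 0" if "z \<in> {-1..1}" for z
    by (rule interior_wsos_cone_pos[OF D degs int[unfolded ts] that])
  have "\<bar>coeff p i\<bar> \<le> b" for i using b by (auto simp: cp)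
  then have low: "1 \<le> poly s z * B" if "z \<in> {-1..1}" for z
    unfolding s_def B_def using pos that by (intro pos_int_poly_lower_bound[OF degp D]) (auto simp: s_def)
  have B: "B \<ge> 0" using b(2) by (simp add: B_def)
  have tx: "real_vec t \<bullet> x = (\<Sum>j\<le>D. coeff s j * x $ j)" if "x \<in> carrier_vec (D + 1)" for x
    unfolding ts by (rule coeff_vec_scalar_prod[OF that])
  have bounded: "\<bar>x $ j\<bar> \<le> real \<nu> * B"
    if x: "x \<in> carrier_vec (D + 1)" "psd (\<Lambda> x)" "real_vec t \<bullet> x = real \<nu>" and j: "j < D + 1" for x j
  proof -
    have xd: "x \<in> dual_cone (D + 1) (wsos_cone D)" using x psd_\<Lambda>_iff by blast
    \<comment> \<open>\<open>B s - 1\<close> is nonnegative on \<open>[-1, 1]\<close>. Paired with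
      \<open>x\<close>, it bounds \<open>x $ 0\<close> by \<open>B\<close> times the level
      \<open>\<nu>\<close> of the section, and \<open>x $ 0\<close> bounds all coordinates.\<close>
    have "0 \<le> (\<Sum>j\<le>D. coeff (Polynomial.smult B s - 1) j * x $ j)"
    proof (rule dual_coneD[OF xd])
      show "degree (Polynomial.smult B s - 1) \<le> D"
        using degs by (intro degree_diff_le) (auto intro: order_trans[OF degree_smult_le])
      show "0 \<le> poly (Polynomial.smult B s - 1) z" if "z \<in> {-1..1}" for z
        using low[OF that] by (simp add: mult.commute)
    qed
    also have "\<dots> = (\<Sum>j\<le>D. B * (coeff s j * x $ j)) - (\<Sum>j\<le>D. if j = 0 then x $ 0 else 0)"
      unfolding sum_subtractf[symmetric]
      by (intro sum.cong) (auto simp: one_pCons coeff_pCons algebra_simps split: nat.splits)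
    also have "\<dots> = B * real \<nu> - x $ 0" using x tx by (simp add: sum_distrib_left[symmetric])
    finally show ?thesis using dual_cone_abs_le[OF xd, of j] j by (simp add: mult.commute)
  qed
  define T where "T = real_vec t \<bullet> node_sum"
  have "T = (\<Sum>k\<le>D. poly s (real k / real D))"
    unfolding T_def tx[OF node_sum_carrier] by (rule coeff_node_sum[OF degs])
  then have T0: "T > 0" using pos node_in_interval by (auto intro!: sum_pos)
  have T: "T \<le> (real D + 1)\<^sup>2 * b"
  proof -
    have "T \<le> (\<Sum>j\<le>D. real_of_int b * (real D + 1))"
      unfolding T_def tx[OF node_sum_carrier]
    proof (rule sum_mono)
      fix j assume j: "j \<in> {..D}"
      have "0 \<le> node_sum $ j" using j by (auto simp: node_sum_def intro!: sum_nonneg)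
      moreover have "(\<Sum>k\<le>D. (real k / real D) ^ j) \<le> (\<Sum>k\<le>D. 1)"
        using D by (intro sum_mono power_le_one) auto
      then have "node_sum $ j \<le> real D + 1" using j by (simp add: node_sum_def)
      moreover have "coeff s j \<le> real_of_int b" using b(1)[of j] cs(1)[of j] j by (simp add: abs_le_iff)
      ultimately show "coeff s j * node_sum $ j \<le> real_of_int b * (real D + 1)"
        using b(2) by (intro order_trans[OF mult_right_mono mult_left_mono]) auto
    qed
    then show ?thesis by (simp add: power2_eq_square mult_ac add.commute)
  qed
  have "\<nu> > 0" using \<nu>_bounds(1) by linarith
  obtain y0 where y0: "y0 \<in> carrier_vec (D + 1)" "posdef (\<Lambda> y0)" "real_vec t \<bullet> y0 = real \<nu>"
    "\<And>j. j < D + 1 \<Longrightarrow> real_vec t $ j = mat_trace (minv (\<Lambda> y0) * \<Lambda> (unit_vec (D + 1) j))"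
  proof (rule gradient_certificate_exists[OF rt \<open>\<nu> > 0\<close> node_sum_carrier node_sum_posdef T0[unfolded T_def]])
    show "\<bar>x $ j\<bar> \<le> real \<nu> * B"
      if "x \<in> carrier_vec (D + 1)" "psd (\<Lambda> x)" "real_vec t \<bullet> x = real \<nu>" "j < D + 1" for x j
      by (rule bounded[OF that])
  qed (use that in blast)
  define y where "y = Matrix.vec (D + 1) (\<lambda>j. round (N * y0 $ j))"
  have y: "y \<in> carrier_vec (D + 1)" and ry: "real_vec y \<in> carrier_vec (D + 1)" by (simp_all add: y_def real_vec_def)
  have yj: "real_vec y $ j = of_int (round (N * y0 $ j))" if "j \<le> D" for j
    using that by (simp add: y_def real_vec_def)
  define \<delta> where "\<delta> = real_vec y - N \<cdot>\<^sub>v y0"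
  have \<delta>: "\<delta> \<in> carrier_vec (D + 1)" using ry y0 by (simp add: \<delta>_def)
  have \<delta>j: "\<bar>\<delta> $ j\<bar> \<le> 1" if "j \<le> D" for j
    using of_int_round_abs_le[of "N * y0 $ j"] yj[OF that] y0(1) that by (simp add: \<delta>_def)
  define W where "W = (2 * real D) ^ D"
  have W: "W > 0" using D by (simp add: W_def)
  have NW: "N = 2 * ((real D + 1)\<^sup>2 * b) * W" by (simp add: N_def W_def)
  have N0: "N > 0" unfolding NW using b(2) W by (intro mult_pos_pos) auto
  define v where "v = (1 / W) \<cdot>\<^sub>v \<delta>"
  have v: "v \<in> carrier_vec (D + 1)" using \<delta> by (simp add: v_def)
  have vj: "\<bar>v $ j\<bar> \<le> 1 / W" if "j \<le> D" for j
    using \<delta>j[OF that] \<delta> that W by (simp add: v_def abs_mult divide_right_mono)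
  have "psd (\<Lambda> (node_sum + v))" using vj by (intro node_sum_perturbation v) (auto simp: W_def)
  moreover have "node_sum - v = node_sum + (- 1) \<cdot>\<^sub>v v"
    using v node_sum_carrier by (intro eq_vecI) auto
  moreover have "psd (\<Lambda> (node_sum + (- 1) \<cdot>\<^sub>v v))"
    using v vj by (intro node_sum_perturbation) (auto simp: W_def)
  ultimately have "lnorm2 (minv (\<Lambda> y0)) (\<Lambda> v) \<le> 2 * T\<^sup>2"
    unfolding T_def by (intro local_norm_le[OF y0(1,2) rt y0(4) node_sum_carrier v]) simp_all
  then have "(1 / W)\<^sup>2 * lnorm2 (minv (\<Lambda> y0)) (\<Lambda> \<delta>) \<le> 2 * T\<^sup>2"
    unfolding v_def lnorm2_L_smult[OF L_minv(1)[OF y0(1,2)] \<delta>] .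
  then have "lnorm2 (minv (\<Lambda> y0)) (\<Lambda> \<delta>) \<le> 2 * (T * W)\<^sup>2"
    using W by (simp add: power_divide power_mult_distrib field_simps)
  also have "\<dots> < (2 * (T * W))\<^sup>2" using T0 W by (simp add: power_mult_distrib)
  also have "\<dots> \<le> N\<^sup>2"
    using T T0 W by (intro power_mono) (auto simp: NW mult.assoc intro!: mult_right_mono)
  finally have close: "lnorm2 (minv (\<Lambda> y0)) (\<Lambda> (real_vec y - N \<cdot>\<^sub>v y0)) < N\<^sup>2" by (simp only: \<delta>_def)
  note cert = scaled_certificate_perturbation[OF y0(1,2) ry rt y0(4) N0 close]
  have "barrier L1 L2 = logdet_barrier" by (simp add: barrier_def fun_eq_iff)
  then obtain Hinv where H: "mat_inverse (hessian (D + 1) (barrier L1 L2) (real_vec y)) = Some Hinv"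
    "Hinv *\<^sub>v real_vec t \<in> carrier_vec (D + 1)" "psd (\<Lambda> (Hinv *\<^sub>v real_vec t))"
    using cert(2) by metis
  have "real_vec t \<in> wsos_cone D"
    unfolding ts wsos_cone_eq_nonneg[OF D] using degs pos less_imp_le by blast
  then have dc: "dual_certificate D L1 L2 (real_vec t) (real_vec y)"
    unfolding dual_certificate_def
    using posdef_imp_interior[OF ry cert(1)] H psd_\<Lambda>_iff[OF H(2)] by blast
  have "\<bar>real_vec y $ j\<bar> \<le> N * (2 * (real D + 1) * B) + 1" if j: "j \<le> D" for j
  proof -
    have "\<bar>y0 $ j\<bar> \<le> real \<nu> * B" using bounded[OF y0(1) posdef_imp_psd[OF y0(2)] y0(3)] j by simp
    also have "\<dots> \<le> (2 * (real D + 1)) * B"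
      using of_nat_mono[OF \<nu>_bounds(2), where 'a = real] B by (intro mult_right_mono) simp_all
    finally have "N * \<bar>y0 $ j\<bar> \<le> N * (2 * (real D + 1) * B)" using N0 by (intro mult_left_mono) auto
    moreover have "\<bar>real_vec y $ j\<bar> \<le> \<bar>N * y0 $ j\<bar> + 1"
      using of_int_round_abs_le[of "N * y0 $ j"] yj[OF j] by linarith
    moreover have "\<bar>N * y0 $ j\<bar> = N * \<bar>y0 $ j\<bar>" using N0 by (simp add: abs_mult)
    ultimately show ?thesis by linarith
  qed
  then have "max_norm (real_vec y) \<le> N * (2 * (real D + 1) * B) + 1"
    unfolding max_norm_def using ry by (subst Max_le_iff) (auto simp: lessThan_empty_iff)
  with y dc that show thesis by blast
qed

end

section \<open>Logarithmic size of the certificate\<close>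

lemma bit_size_bounds:
  assumes "bit_size y \<le> int \<tau>"
  shows "\<tau> \<ge> 1" "\<bar>y\<bar> \<le> 2 ^ \<tau>"
proof -
  define l where "l = log 2 (\<bar>real_of_int y\<bar> + 1)"
  have l: "1 + \<lceil>l\<rceil> \<le> int \<tau>" using assms by (simp add: bit_size_def l_def)
  have "l \<ge> 0" by (simp add: l_def)
  then have "\<lceil>l\<rceil> \<ge> 0" by linarith
  with l show "\<tau> \<ge> 1" by linarith
  have "l \<le> real \<tau>" using l by linarith
  then have "\<bar>real_of_int y\<bar> + 1 \<le> 2 powr real \<tau>" by (simp add: l_def log_le_iff)
  then have "\<bar>real_of_int y\<bar> \<le> 2 ^ \<tau>" by (simp add: powr_realpow)
  then have "real_of_int \<bar>y\<bar> \<le> real_of_int (2 ^ \<tau>)" by simp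
  then show "\<bar>y\<bar> \<le> 2 ^ \<tau>" by linarith
qed

text \<open>\<open>q = 6 d\<close> dominates both \<open>2 D\<close> and \<open>D + 1\<close>; since
  \<open>q \<ge> 5\<close>, one more power of \<open>q\<close> absorbs the factor 4 and the added 1.
  This leaves \<open>q ^ (19 * d) * P ^ (7 * d)\<close>. As \<open>d * ln d\<close> vanishes for
  \<open>d = 1\<close>, the constant \<open>ln 6 \<le> 5\<close> is charged to
  \<open>\<tau> \<ge> 1\<close>, which yields \<open>19 * 5 + 7 = 102\<close>.\<close>

lemma certificate_log_bound:
  fixes d D \<tau> :: nat
  assumes d: "d \<ge> 1" and D: "D \<le> 3 * d" and \<tau>: "\<tau> \<ge> 1"
  shows "ln (2 * (real D + 1)\<^sup>2 * 2 ^ \<tau> * (2 * real D) ^ D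
      * (2 * (real D + 1) * (fact (2 * D) * ((real D + 1) * 2 ^ \<tau>) ^ (2 * D))) + 1)
    \<le> 102 * (real d * real \<tau> + real d * ln (real d))" (is "ln (?N * (2 * (real D + 1) * ?B) + 1) \<le> _")
proof -
  define q where "q = 6 * real d"
  define P where "P = (2 :: real) ^ \<tau>"
  have q: "q \<ge> 6" "2 * real D \<le> q" "real D + 1 \<le> q" using d D by (simp_all add: q_def)
  have P: "P \<ge> 1" by (simp add: P_def)
  have "fact (2 * D) \<le> real (2 * D) ^ (2 * D)" using fact_le_power[of "2 * D"] by simp
  also have "\<dots> \<le> q ^ (2 * D)" using q by (intro power_mono) auto
  also have "\<dots> \<le> q ^ (6 * d)" using q D by (intro power_increasing) auto
  finally have f: "fact (2 * D) \<le> q ^ (6 * d)" .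
  have "((real D + 1) * P) ^ (2 * D) \<le> (q * P) ^ (2 * D)" using q P by (intro power_mono mult_right_mono) auto
  also have "\<dots> \<le> (q * P) ^ (6 * d)" using q P D mult_mono[of 1 q 1 P] by (intro power_increasing) auto
  finally have "?B \<le> q ^ (6 * d) * (q * P) ^ (6 * d)"
    unfolding P_def[symmetric] using f q P by (intro mult_mono) auto
  then have B: "?B \<le> q ^ (12 * d) * P ^ (6 * d)"
    by (simp add: power_mult_distrib power_add[symmetric] mult.assoc[symmetric])
  have "(2 * real D) ^ D \<le> q ^ D" using q by (intro power_mono) auto
  also have "\<dots> \<le> q ^ (3 * d)" using q D by (intro power_increasing) auto
  finally have N: "?N \<le> 2 * q\<^sup>2 * P * q ^ (3 * d)"
    unfolding P_def[symmetric] using q P by (intro mult_mono power_mono) auto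
  have "2 * (real D + 1) * ?B \<le> 2 * q * (q ^ (12 * d) * P ^ (6 * d))"
    using q by (intro mult_mono[OF _ B]) auto
  with N have "?N * (2 * (real D + 1) * ?B) \<le> 2 * q\<^sup>2 * P * q ^ (3 * d) * (2 * q * (q ^ (12 * d) * P ^ (6 * d)))"
    by (rule mult_mono) (use q P in auto)
  also have "\<dots> = 4 * (q ^ (15 * d + 3) * P ^ (6 * d + 1))"
    by (simp add: power_add power2_eq_square power3_eq_cube power_mult[symmetric])
      (simp add: mult_ac power_add[symmetric])
  finally have "?N * (2 * (real D + 1) * ?B) + 1 \<le> 4 * (q ^ (15 * d + 3) * P ^ (6 * d + 1)) + 1" by simp
  also have "\<dots> \<le> q * (q ^ (15 * d + 3) * P ^ (6 * d + 1))"
  proof -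
    have "4 * x + 1 \<le> q * x" if "x \<ge> 1" for x using mult_right_mono[of 5 q x] q that by linarith
    moreover have "1 * 1 \<le> q ^ (15 * d + 3) * P ^ (6 * d + 1)"
      using q P by (intro mult_mono one_le_power) auto
    ultimately show ?thesis by simp
  qed
  also have "\<dots> \<le> q ^ (19 * d) * P ^ (7 * d)"
  proof -
    have "q * q ^ (15 * d + 3) \<le> q ^ (19 * d)"
      unfolding power_Suc[symmetric] using q d by (intro power_increasing) auto
    moreover have "P ^ (6 * d + 1) \<le> P ^ (7 * d)" using P d by (intro power_increasing) auto
    ultimately show ?thesis unfolding mult.assoc[symmetric] using q P by (intro mult_mono) auto
  qed
  finally have le: "?N * (2 * (real D + 1) * ?B) + 1 \<le> q ^ (19 * d) * P ^ (7 * d)" .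
  have "0 \<le> ?N * (2 * (real D + 1) * ?B)" by simp
  then have "ln (?N * (2 * (real D + 1) * ?B) + 1) \<le> ln (q ^ (19 * d) * P ^ (7 * d))"
    using le by (intro ln_mono; linarith)
  also have "\<dots> = 19 * real d * ln q + 7 * real d * (real \<tau> * ln 2)"
    using q P by (simp add: ln_mult ln_realpow P_def)
  also have "\<dots> \<le> 19 * real d * (5 * real \<tau> + ln (real d)) + 7 * real d * (real \<tau> * 1)"
  proof -
    have "ln q = ln 6 + ln (real d)" using d by (simp add: q_def ln_mult)
    also have "ln (6 :: real) \<le> 5 * real \<tau>" using ln_le_minus_one[of "6 :: real"] \<tau> by simp
    finally have "ln q \<le> 5 * real \<tau> + ln (real d)" by simp
    moreover have "ln (2 :: real) \<le> 1" using ln_le_minus_one[of "2 :: real"] by simp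
    ultimately show ?thesis by (intro add_mono mult_left_mono) auto
  qed
  also have "\<dots> \<le> 102 * (real d * real \<tau> + real d * ln (real d))"
    using d by (simp add: algebra_simps)
  finally show ?thesis .
qed

theorem corollary3p7:
  shows "\<exists>C::real. C > 0 \<and>
    (\<forall>(d::nat) (D::nat) p1 p2 \<Lambda>1 \<Lambda>2 t (\<tau>::nat).
       d \<ge> 1 \<longrightarrow> D \<in> {2 * d, 2 * d + 1} \<longrightarrow>
       ordered_basis (deg1 D) p1 \<longrightarrow> ordered_basis (deg2 D) p2 \<longrightarrow>
       is_Lambda D (weight1 D) p1 \<Lambda>1 \<longrightarrow> is_Lambda D (weight2 D) p2 \<Lambda>2 \<longrightarrow>
       t \<in> carrier_vec (D + 1) \<longrightarrow>
       real_vec t \<in> vec_interior (D + 1) (wsos_cone D) \<longrightarrow>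
       (\<forall>i<D + 1. bit_size (vec_index t i) \<le> int \<tau>) \<longrightarrow>
       (\<exists>ybar. ybar \<in> carrier_vec (D + 1) \<and>
          dual_certificate D \<Lambda>1 \<Lambda>2 (real_vec t) (real_vec ybar) \<and>
          ln (max_norm (real_vec ybar)) \<le> C * (real d * real \<tau> + real d * ln (real d))))"
proof (intro exI[of _ 102] conjI allI impI)
  fix d D :: nat and p1 p2 :: "real poly list" and \<Lambda>1 \<Lambda>2 :: "real vec \<Rightarrow> real mat" and t :: "int vec" and \<tau> :: nat
  assume d: "d \<ge> 1" and D: "D \<in> {2 * d, 2 * d + 1}"
    and basis: "ordered_basis (deg1 D) p1" "ordered_basis (deg2 D) p2"
    and Lambda: "is_Lambda D (weight1 D) p1 \<Lambda>1" "is_Lambda D (weight2 D) p2 \<Lambda>2"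
    and t: "t \<in> carrier_vec (D + 1)" "real_vec t \<in> vec_interior (D + 1) (wsos_cone D)"
    and bits: "\<forall>i<D + 1. bit_size (vec_index t i) \<le> int \<tau>"
  \<comment> \<open>\<open>2 d + 1 \<le> 3 d\<close> because \<open>d \<ge> 1\<close>; after this
    the two parities need no distinction.\<close>
  have D1: "D \<ge> 1" "D \<le> 3 * d" using d D by auto
  interpret wsos_pencil D p1 p2 \<Lambda>1 \<Lambda>2
    using D1(1) basis Lambda by unfold_locales
  have \<tau>: "\<tau> \<ge> 1" using bit_size_bounds(1)[of "t $ 0" \<tau>] bits by simp
  have bound: "\<bar>t $ j\<bar> \<le> 2 ^ \<tau>" if "j \<le> D" for j using bit_size_bounds(2) bits that by simp
  let ?E = "2 * (real D + 1)\<^sup>2 * 2 ^ \<tau> * (2 * real D) ^ D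
      * (2 * (real D + 1) * (fact (2 * D) * ((real D + 1) * 2 ^ \<tau>) ^ (2 * D))) + 1"
  obtain y :: "int vec" where y: "y \<in> carrier_vec (D + 1)" "dual_certificate D \<Lambda>1 \<Lambda>2 (real_vec t) (real_vec y)"
    "max_norm (real_vec y) \<le> ?E"
    using integer_dual_certificate[OF t bound] by auto
  have "0 \<le> \<bar>real_vec y $ 0\<bar>" by simp
  also have "\<dots> \<le> max_norm (real_vec y)"
    unfolding max_norm_def using y(1) by (intro Max_ge) (auto simp: real_vec_def)
  \<comment> \<open>Monotonicity of \<open>ln\<close> requires a positive argument. If the norm is
    0, the convention \<open>ln 0 = 0\<close> together with \<open>ln ?E \<ge> 0\<close> gives the
    inequality.\<close>
  finally have "max_norm (real_vec y) = 0 \<or> max_norm (real_vec y) > 0" by auto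
  moreover have "ln ?E \<ge> 0" by simp
  ultimately have "ln (max_norm (real_vec y)) \<le> ln ?E"
    using y(3) by (auto intro: ln_mono)
  also have "\<dots> \<le> 102 * (real d * real \<tau> + real d * ln (real d))"
    by (rule certificate_log_bound[OF d D1(2) \<tau>])
  finally show "\<exists>ybar. ybar \<in> carrier_vec (D + 1) \<and>
      dual_certificate D \<Lambda>1 \<Lambda>2 (real_vec t) (real_vec ybar) \<and>
      ln (max_norm (real_vec ybar)) \<le> 102 * (real d * real \<tau> + real d * ln (real d))"
    using y by blast
qed simp

end
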